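(* Fix $T>0$ and $x_0\in\mathbb{S}^1$. For $k\in\mathbb{N}$ let $\mathbb{P}_k$ be the law on the Skorohod space $D[0,T]$ of the continuous time random walk $X_k=\{X_k(t)\}_{t\in[0,T]}$ on $\Gamma_k=\{0,\frac1k,\dots,\frac{k-1}{k}\}\subset\mathbb{S}^1$ with generator $k\mathcal{L}_k$ and initial measure the Dirac delta at $\lfloor kx_0\rfloor/k$. Define the rate function $I_T$ on $D[0,T]$ by $$I_T(\gamma)=\int_0^T\Big\{\gamma'(s)\log\Big(\frac{\gamma'(s)+\sqrt{(\gamma'(s))^2+4}}{2}\Big)-\sqrt{(\gamma'(s))^2+4}+2\Big\}\,ds$$ if $\gamma\in\mathcal{AC}[0,T]$, and $I_T(\gamma)=\infty$ otherwise. Then the sequence $\{\mathbb{P}_k\}_k$ satisfies: (Upper bound) for every closed set $\mathcal{C}\subset D[0,T]$, $$\limsup_{k\to\infty}\frac1k\log\mathbb{P}_k[X_k\in\mathcal{C}]\le-\inf_{\gamma\in\mathcal{C}}I_T(\gamma);$$ (Lower bound) for every open set $\mathcal{O}\subset D[0,T]$, $$\liminf_{k\to\infty}\frac1k\log\mathbb{P}_k[X_k\in\mathcal{O}]\ge-\inf_{\gamma\in\mathcal{O}}I_T(\gamma).$$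
   Context: $\mathbb{S}^1$ is the unit circle, identified with $[0,1)$, and $\Gamma_k=\{0,1/k,\dots,(k-1)/k\}$, with indices taken mod $k$. For $f:\Gamma_k\to\mathbb{R}$, $$(\mathcal{L}_kf)(\tfrac jk)=\big[f(\tfrac{j+1}k)-f(\tfrac jk)\big]+\big[f(\tfrac{j-1}k)-f(\tfrac jk)\big],$$ so the chain with generator $k\mathcal{L}_k$ jumps from $j/k$ to each of its two neighbours at rate $k$. $D[0,T]$ is the Skorohod space of càdlàg trajectories $[0,T]\to\mathbb{S}^1$. $\mathcal{AC}[0,T]$ is the set of all absolutely continuous functions $\gamma:[0,T]\to\mathbb{S}^1$: for every $\varepsilon>0$ there is $\delta>0$ such that for every finite family of (disjoint) intervals $(s_i,t_i)$ in $[0,T]$ with $\sum_i(t_i-s_i)<\delta$ one has $\sum_i|\gamma(t_i)-\gamma(s_i)|<\varepsilon$.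
   Formalization: The rate function I_T is additionally set to infinity unless γ(0)=x_0; without this the lower bound fails, e.g. for a small open ball around a constant path at a point other than x_0, where the probability is 0 for large k but the infimum of I_T is 0. *)

theory Defs
  imports "HOL-Probability.Probability"
begin

section \<open>The circle of length one\<close>

typedef circle = "{0..<1::real}" morphisms coord Abs_circle
  by (rule exI[of _ 0]) simp

definition circle_of :: "real \<Rightarrow> circle" where
  "circle_of a = Abs_circle (frac a)"

lemma coord_ge_0 [simp]: "0 \<le> coord x" and coord_lt_1 [simp]: "coord x < 1"
  using coord[of x] by auto

lemma coord_circle_of [simp]: "coord (circle_of a) = frac a"
  unfolding circle_of_def by (rule Abs_circle_inverse) (simp add: frac_lt_1)

lemma circle_of_coord [simp]: "circle_of (coord x) = x"
  by (metis coord_circle_of coord_inject coord_ge_0 coord_lt_1 frac_eq)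

lemma circle_of_eq_iff: "circle_of a = circle_of b \<longleftrightarrow> a - b \<in> \<int>"
proof -
  have "circle_of a = circle_of b \<longleftrightarrow> frac a = frac b"
    by (metis coord_circle_of coord_inject)
  also have "\<dots> \<longleftrightarrow> a - b \<in> \<int>"
  proof
    assume "frac a = frac b"
    then have "a - b = of_int (\<lfloor>a\<rfloor> - \<lfloor>b\<rfloor>)" by (simp add: frac_def)
    then show "a - b \<in> \<int>" by (metis Ints_of_int)
  next
    assume "a - b \<in> \<int>"
    then have "frac (b + (a - b)) = frac b" by (rule frac_add_int_right)
    then show "frac a = frac b" by simp
  qed
  finally show ?thesis .
qed

text \<open>The metric is the length of the shorter arc, so that points on either side of \<open>0\<close> are close.\<close>

instantiation circle :: metric_space
begin

definition dist_circle :: "circle \<Rightarrow> circle \<Rightarrow> real" where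
  "dist_circle x y = min \<bar>coord x - coord y\<bar> (1 - \<bar>coord x - coord y\<bar>)"

definition uniformity_circle :: "(circle \<times> circle) filter" where
  "uniformity_circle = (INF e\<in>{0 <..}. principal {(x, y). dist x y < e})"

definition open_circle :: "circle set \<Rightarrow> bool" where
  "open_circle U \<longleftrightarrow> (\<forall>x\<in>U. \<forall>\<^sub>F (x', y) in uniformity. x' = x \<longrightarrow> y \<in> U)"

instance
proof
  show "uniformity = (INF e\<in>{0 <..}. principal {(x, y). dist (x::circle) y < e})"
    by (rule uniformity_circle_def)
  show "open U \<longleftrightarrow> (\<forall>x\<in>U. \<forall>\<^sub>F (x', y) in uniformity. x' = x \<longrightarrow> y \<in> U)" for U :: "circle set"
    by (rule open_circle_def)
  fix x y z :: circle
  note b = coord_ge_0[of x] coord_lt_1[of x] coord_ge_0[of y] coord_lt_1[of y]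
    coord_ge_0[of z] coord_lt_1[of z]
  show "dist x y = 0 \<longleftrightarrow> x = y"
  proof -
    have "dist x y = 0 \<longleftrightarrow> coord x = coord y"
      using b unfolding dist_circle_def by linarith
    then show ?thesis by (simp add: coord_inject)
  qed
  show "dist x y \<le> dist x z + dist y z"
    using b unfolding dist_circle_def min_def abs_if
    by (cases "coord x < coord y"; cases "coord x < coord z"; cases "coord y < coord z"; simp; linarith)
qed

end

lemma dist_circle_le: "dist (x::circle) y \<le> 1 / 2"
  unfolding dist_circle_def by (simp add: min_def)

section \<open>The Skorohod space\<close>

definition cadlag :: "real \<Rightarrow> (real \<Rightarrow> circle) \<Rightarrow> bool" where
  "cadlag T \<gamma> \<longleftrightarrow>
     (\<forall>t\<in>{0..<T}. (\<gamma> \<longlongrightarrow> \<gamma> t) (at_right t)) \<and>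
     (\<forall>t\<in>{0<..T}. \<exists>l. (\<gamma> \<longlongrightarrow> l) (at_left t))"

definition skorohod_space :: "real \<Rightarrow> (real \<Rightarrow> circle) set" where
  "skorohod_space T = {\<gamma> \<in> extensional {0..T}. cadlag T \<gamma>}"

definition time_changes :: "real \<Rightarrow> (real \<Rightarrow> real) set" where
  "time_changes T = {\<mu>. strict_mono_on {0..T} \<mu> \<and> \<mu> ` {0..T} = {0..T}}"

definition skorohod_dist :: "real \<Rightarrow> (real \<Rightarrow> circle) \<Rightarrow> (real \<Rightarrow> circle) \<Rightarrow> real" where
  "skorohod_dist T \<gamma> \<eta> =
     Inf {e. \<exists>\<mu>\<in>time_changes T. \<forall>t\<in>{0..T}. \<bar>\<mu> t - t\<bar> \<le> e \<and> dist (\<gamma> t) (\<eta> (\<mu> t)) \<le> e}"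

definition skorohod_topology :: "real \<Rightarrow> (real \<Rightarrow> circle) topology" where
  "skorohod_topology T = Metric_space.mtopology (skorohod_space T) (skorohod_dist T)"

definition skorohod_borel :: "real \<Rightarrow> (real \<Rightarrow> circle) measure" where
  "skorohod_borel T = sigma (skorohod_space T) {U. openin (skorohod_topology T) U}"

lemma id_time_change: "(\<lambda>t. t) \<in> time_changes T"
  unfolding time_changes_def by (auto simp: strict_mono_on_def)

lemma time_change_comp:
  assumes "\<mu> \<in> time_changes T" "\<nu> \<in> time_changes T"
  shows "(\<lambda>t. \<nu> (\<mu> t)) \<in> time_changes T"
proof -
  have m: "\<mu> t \<in> {0..T}" if "t \<in> {0..T}" for t
    using assms(1) that unfolding time_changes_def by blast
  have "strict_mono_on {0..T} (\<lambda>t. \<nu> (\<mu> t))"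
  proof (rule strict_mono_onI)
    fix s t assume st: "s \<in> {0..T}" "t \<in> {0..T}" "s < t"
    have sm: "strict_mono_on {0..T} \<mu>" "strict_mono_on {0..T} \<nu>"
      using assms unfolding time_changes_def by auto
    show "\<nu> (\<mu> s) < \<nu> (\<mu> t)"
      using strict_mono_onD[OF sm(2) m[OF st(1)] m[OF st(2)] strict_mono_onD[OF sm(1) st]] .
  qed
  moreover have "(\<lambda>t. \<nu> (\<mu> t)) ` {0..T} = \<nu> ` (\<mu> ` {0..T})" by auto
  ultimately show ?thesis using assms unfolding time_changes_def by simp
qed

lemma time_change_inv:
  assumes "\<mu> \<in> time_changes T"
  obtains \<nu> where "\<nu> \<in> time_changes T" "\<And>t. t \<in> {0..T} \<Longrightarrow> \<mu> (\<nu> t) = t"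
    "\<And>t. t \<in> {0..T} \<Longrightarrow> \<nu> (\<mu> t) = t"
proof -
  have sm: "strict_mono_on {0..T} \<mu>" and im: "\<mu> ` {0..T} = {0..T}"
    using assms unfolding time_changes_def by auto
  have inj: "inj_on \<mu> {0..T}" using sm by (rule strict_mono_on_imp_inj_on)
  define \<nu> where "\<nu> = inv_into {0..T} \<mu>"
  have r: "\<mu> (\<nu> t) = t" if "t \<in> {0..T}" for t
    unfolding \<nu>_def using im that by (simp add: f_inv_into_f)
  have l: "\<nu> (\<mu> t) = t" if "t \<in> {0..T}" for t
    unfolding \<nu>_def using inj that by (simp add: inv_into_f_f)
  have n: "\<nu> t \<in> {0..T}" if "t \<in> {0..T}" for t
    unfolding \<nu>_def using im that by (metis inv_into_into)
  have "strict_mono_on {0..T} \<nu>"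
  proof (rule strict_mono_onI)
    fix s t assume s: "s \<in> {0..T}" and t: "t \<in> {0..T}" and "s < t"
    show "\<nu> s < \<nu> t"
    proof (rule ccontr)
      assume "\<not> \<nu> s < \<nu> t"
      then have "\<nu> t < \<nu> s \<or> \<nu> t = \<nu> s" by auto
      then have "\<mu> (\<nu> t) \<le> \<mu> (\<nu> s)"
        using strict_mono_onD[OF sm n[OF t] n[OF s]] by auto
      then show False using r s t \<open>s < t\<close> by simp
    qed
  qed
  moreover have "\<nu> ` {0..T} = {0..T}"
  proof
    show "\<nu> ` {0..T} \<subseteq> {0..T}" using n by blast
    show "{0..T} \<subseteq> \<nu> ` {0..T}"
    proof
      fix t assume t: "t \<in> {0..T}"
      then have "\<mu> t \<in> {0..T}" using im by blast
      then show "t \<in> \<nu> ` {0..T}" using l[OF t] by (metis image_eqI)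
    qed
  qed
  ultimately have "\<nu> \<in> time_changes T" unfolding time_changes_def by simp
  then show ?thesis using that r l by blast
qed

lemma Metric_space_skorohod:
  assumes T: "T > 0"
  shows "Metric_space (skorohod_space T) (skorohod_dist T)"
proof -
  define adm where "adm \<gamma> \<eta> \<mu> e \<longleftrightarrow> \<mu> \<in> time_changes T \<and>
    (\<forall>t\<in>{0..T}. \<bar>\<mu> t - t\<bar> \<le> e \<and> dist (\<gamma> t) (\<eta> (\<mu> t)) \<le> e)"
    for \<gamma> \<eta> :: "real \<Rightarrow> circle" and \<mu> e
  have d: "skorohod_dist T \<gamma> \<eta> = Inf {e. \<exists>\<mu>. adm \<gamma> \<eta> \<mu> e}" for \<gamma> \<eta>
    unfolding skorohod_dist_def adm_def by (simp add: Bex_def)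
  have ne: "adm \<gamma> \<eta> (\<lambda>t. t) 1" for \<gamma> \<eta>
    unfolding adm_def using id_time_change
    by (auto intro: order_trans[OF dist_circle_le])
  have pos: "0 \<le> e" if "adm \<gamma> \<eta> \<mu> e" for \<gamma> \<eta> \<mu> e
  proof -
    have "0 \<in> {0..T}" using T by simp
    then have "\<bar>\<mu> 0 - 0\<bar> \<le> e" using that unfolding adm_def by blast
    then show ?thesis by linarith
  qed
  have bdd: "bdd_below {e. \<exists>\<mu>. adm \<gamma> \<eta> \<mu> e}" for \<gamma> \<eta>
    using pos by (intro bdd_belowI[of _ 0]) auto
  have sym: "\<exists>\<nu>. adm \<eta> \<gamma> \<nu> e" if a: "adm \<gamma> \<eta> \<mu> e" for \<gamma> \<eta> \<mu> e
  proof -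
    have "\<mu> \<in> time_changes T" using a unfolding adm_def by simp
    then obtain \<nu> where n: "\<nu> \<in> time_changes T" "\<And>t. t \<in> {0..T} \<Longrightarrow> \<mu> (\<nu> t) = t"
      using time_change_inv by blast
    have "\<bar>\<nu> t - t\<bar> \<le> e \<and> dist (\<eta> t) (\<gamma> (\<nu> t)) \<le> e" if t: "t \<in> {0..T}" for t
    proof -
      have "\<nu> t \<in> {0..T}" using n(1) t unfolding time_changes_def by blast
      then have "\<bar>\<mu> (\<nu> t) - \<nu> t\<bar> \<le> e \<and> dist (\<gamma> (\<nu> t)) (\<eta> (\<mu> (\<nu> t))) \<le> e"
        using a unfolding adm_def by blast
      then show ?thesis using n(2)[OF t] by (simp add: dist_commute abs_minus_commute)
    qed
    then show ?thesis using n(1) unfolding adm_def by blast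
  qed
  have tri: "\<exists>\<kappa>. adm \<gamma> \<zeta> \<kappa> (e + e')" if a: "adm \<gamma> \<eta> \<mu> e" and b: "adm \<eta> \<zeta> \<nu> e'"
    for \<gamma> \<eta> \<zeta> \<mu> \<nu> e e'
  proof -
    have "\<bar>\<nu> (\<mu> t) - t\<bar> \<le> e + e' \<and> dist (\<gamma> t) (\<zeta> (\<nu> (\<mu> t))) \<le> e + e'" if t: "t \<in> {0..T}" for t
    proof -
      have m: "\<mu> t \<in> {0..T}" using a t unfolding adm_def time_changes_def by blast
      have 1: "\<bar>\<mu> t - t\<bar> \<le> e" "dist (\<gamma> t) (\<eta> (\<mu> t)) \<le> e"
        using a t unfolding adm_def by auto
      have 2: "\<bar>\<nu> (\<mu> t) - \<mu> t\<bar> \<le> e'" "dist (\<eta> (\<mu> t)) (\<zeta> (\<nu> (\<mu> t))) \<le> e'"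
        using b m unfolding adm_def by auto
      show ?thesis
        using 1 2 dist_triangle[of "\<gamma> t" "\<zeta> (\<nu> (\<mu> t))" "\<eta> (\<mu> t)"] by linarith
    qed
    moreover have "(\<lambda>t. \<nu> (\<mu> t)) \<in> time_changes T"
      using a b unfolding adm_def by (blast intro: time_change_comp)
    ultimately show ?thesis unfolding adm_def by blast
  qed
  have lt: "\<exists>\<mu> e. adm \<gamma> \<eta> \<mu> e \<and> e < c" if "skorohod_dist T \<gamma> \<eta> < c" for \<gamma> \<eta> c
    using that ne bdd unfolding d by (subst (asm) cInf_less_iff) auto
  have le: "skorohod_dist T \<gamma> \<eta> \<le> e" if "adm \<gamma> \<eta> \<mu> e" for \<gamma> \<eta> \<mu> e
    unfolding d using that bdd by (intro cInf_lower) auto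
  show ?thesis
  proof
    fix \<gamma> \<eta> \<zeta> :: "real \<Rightarrow> circle"
    show "0 \<le> skorohod_dist T \<gamma> \<eta>"
      unfolding d using ne pos by (intro cInf_greatest) auto
    show "skorohod_dist T \<gamma> \<eta> = skorohod_dist T \<eta> \<gamma>"
    proof -
      have "{e. \<exists>\<mu>. adm \<gamma> \<eta> \<mu> e} = {e. \<exists>\<mu>. adm \<eta> \<gamma> \<mu> e}" using sym by blast
      then show ?thesis unfolding d by simp
    qed
    show "skorohod_dist T \<gamma> \<zeta> \<le> skorohod_dist T \<gamma> \<eta> + skorohod_dist T \<eta> \<zeta>"
    proof (rule field_le_epsilon)
      fix c :: real assume c: "0 < c"
      obtain \<mu> e where 1: "adm \<gamma> \<eta> \<mu> e" "e < skorohod_dist T \<gamma> \<eta> + c / 2"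
        using lt[of \<gamma> \<eta> "skorohod_dist T \<gamma> \<eta> + c / 2"] c by auto
      obtain \<nu> e' where 2: "adm \<eta> \<zeta> \<nu> e'" "e' < skorohod_dist T \<eta> \<zeta> + c / 2"
        using lt[of \<eta> \<zeta> "skorohod_dist T \<eta> \<zeta> + c / 2"] c by auto
      show "skorohod_dist T \<gamma> \<zeta> \<le> skorohod_dist T \<gamma> \<eta> + skorohod_dist T \<eta> \<zeta> + c"
      proof -
        obtain \<kappa> where "adm \<gamma> \<zeta> \<kappa> (e + e')" using tri[OF 1(1) 2(1)] by blast
        then have "skorohod_dist T \<gamma> \<zeta> \<le> e + e'" by (rule le)
        then show ?thesis using 1(2) 2(2) by simp
      qed
    qed
    assume g: "\<gamma> \<in> skorohod_space T" and h: "\<eta> \<in> skorohod_space T"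
    show "skorohod_dist T \<gamma> \<eta> = 0 \<longleftrightarrow> \<gamma> = \<eta>"
    proof
      assume "\<gamma> = \<eta>"
      then have "adm \<gamma> \<eta> (\<lambda>t. t) 0" unfolding adm_def using id_time_change by auto
      then have "skorohod_dist T \<gamma> \<eta> \<le> 0" by (rule le)
      moreover have "0 \<le> skorohod_dist T \<gamma> \<eta>"
        unfolding d using ne pos by (intro cInf_greatest) auto
      ultimately show "skorohod_dist T \<gamma> \<eta> = 0" by simp
    next
      assume z: "skorohod_dist T \<gamma> \<eta> = 0"
      have small: "\<exists>\<mu> e. adm \<gamma> \<eta> \<mu> e \<and> e < c" if "0 < c" for c
        using lt[of \<gamma> \<eta> c] z that by simp
      have "\<gamma> t = \<eta> t" if t: "t \<in> {0..T}" for t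
      proof (cases "t = T")
        case False
        then have t': "t \<in> {0..<T}" using t by auto
        have "dist (\<gamma> t) (\<eta> t) < c" if c: "0 < c" for c
        proof -
          have "(\<gamma> \<longlongrightarrow> \<gamma> t) (at_right t)" "(\<eta> \<longlongrightarrow> \<eta> t) (at_right t)"
            using g h t' unfolding skorohod_space_def cadlag_def by auto
          then have "\<forall>\<^sub>F s in at_right t. dist (\<gamma> s) (\<gamma> t) < c / 3 \<and> dist (\<eta> s) (\<eta> t) < c / 3"
            using c by (intro eventually_conj tendstoD) auto
          then obtain b where b: "t < b"
            "\<And>s. t < s \<Longrightarrow> s < b \<Longrightarrow> dist (\<gamma> s) (\<gamma> t) < c / 3 \<and> dist (\<eta> s) (\<eta> t) < c / 3"
            unfolding eventually_at_right_field by blast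
          define \<delta> where "\<delta> = min (b - t) (T - t)"
          have \<delta>: "0 < \<delta>" "t + \<delta> \<le> b" "t + \<delta> \<le> T"
            using b(1) t' unfolding \<delta>_def by (auto simp: min_def)
          define s where "s = t + \<delta> / 2"
          obtain \<mu> e where m: "adm \<gamma> \<eta> \<mu> e" "e < min (\<delta> / 4) (c / 3)"
            using small[of "min (\<delta> / 4) (c / 3)"] \<delta>(1) c by auto
          have s: "s \<in> {0..T}" "t < s" "s < b"
            using \<delta> t unfolding s_def by auto
          have 1: "\<bar>\<mu> s - s\<bar> \<le> e" "dist (\<gamma> s) (\<eta> (\<mu> s)) \<le> e"
            using m(1) s(1) unfolding adm_def by auto
          have "t < \<mu> s" "\<mu> s < b"
            using 1(1) m(2) \<delta> unfolding s_def by (auto simp: abs_if split: if_splits)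
          then have 2: "dist (\<eta> (\<mu> s)) (\<eta> t) < c / 3" using b(2) by blast
          have 3: "dist (\<gamma> s) (\<gamma> t) < c / 3" using b(2) s by blast
          have "dist (\<gamma> t) (\<eta> t) \<le> dist (\<gamma> s) (\<gamma> t) + dist (\<gamma> s) (\<eta> (\<mu> s)) + dist (\<eta> (\<mu> s)) (\<eta> t)"
            using dist_triangle[of "\<gamma> t" "\<eta> t" "\<gamma> s"] dist_triangle[of "\<gamma> s" "\<eta> t" "\<eta> (\<mu> s)"]
            by (simp add: dist_commute)
          then show ?thesis using 1(2) 2 3 m(2) by simp
        qed
        then have "\<not> 0 < dist (\<gamma> t) (\<eta> t)" by blast
        then show ?thesis by simp
      next
        case True
        have "dist (\<gamma> T) (\<eta> T) < c" if c: "0 < c" for c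
        proof -
          obtain \<mu> e where m: "adm \<gamma> \<eta> \<mu> e" "e < c" using small[OF c] by blast
          have sm: "strict_mono_on {0..T} \<mu>" and im: "\<mu> ` {0..T} = {0..T}"
            using m(1) unfolding adm_def time_changes_def by auto
          obtain u where u: "u \<in> {0..T}" "\<mu> u = T" 
          proof -
            have "T \<in> \<mu> ` {0..T}" unfolding im using T by simp
            then show ?thesis using that by blast
          qed
          have TT: "T \<in> {0..T}" using T by simp
          then have "\<mu> T \<in> {0..T}" using im by blast
          then have "\<mu> T = T"
            using u strict_mono_onD[OF sm, of u T] T by (cases "u = T") auto
          moreover have "dist (\<gamma> T) (\<eta> (\<mu> T)) \<le> e" using m(1) TT unfolding adm_def by blast
          ultimately show ?thesis using m(2) by simp
        qed
        then have "\<not> 0 < dist (\<gamma> T) (\<eta> T)" by blast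
        then show ?thesis using True by simp
      qed
      then show "\<gamma> = \<eta>"
        using g h unfolding skorohod_space_def by (auto intro: extensionalityI)
    qed
  qed
qed

section \<open>Continuous time Markov chains\<close>

text \<open>The semigroup \<open>exp (t G)\<close> of a bounded generator \<open>G\<close>, as an operator power series.\<close>

definition semigroup_of :: "((circle \<Rightarrow> real) \<Rightarrow> circle \<Rightarrow> real) \<Rightarrow> real \<Rightarrow> (circle \<Rightarrow> real) \<Rightarrow> circle \<Rightarrow> real"
  where "semigroup_of G t f x = (\<Sum>n. t ^ n / fact n * (G ^^ n) f x)"

text \<open>A random element \<open>X\<close> of the Skorohod space is a Markov chain on \<open>S\<close> with generator \<open>G\<close> and
  initial distribution \<open>\<iota>\<close> if its finite-dimensional distributions are the products of the
  transition probabilities \<open>semigroup_of G t (indicator {y}) x\<close> from \<open>x\<close> to \<open>y\<close> in time \<open>t\<close>.\<close>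

definition markov_chain_with_generator ::
  "'w measure \<Rightarrow> real \<Rightarrow> circle set \<Rightarrow> ((circle \<Rightarrow> real) \<Rightarrow> circle \<Rightarrow> real) \<Rightarrow> circle pmf \<Rightarrow>
    ('w \<Rightarrow> real \<Rightarrow> circle) \<Rightarrow> bool" where
  "markov_chain_with_generator M T S G \<iota> X \<longleftrightarrow>
     prob_space M \<and>
     X \<in> measurable M (skorohod_borel T) \<and>
     (\<forall>\<omega>\<in>space M. \<forall>t\<in>{0..T}. X \<omega> t \<in> S) \<and>
     (\<forall>n. \<forall>t :: nat \<Rightarrow> real. \<forall>y :: nat \<Rightarrow> circle.
        t 0 = 0 \<and> (\<forall>i<n. t i \<le> t (Suc i)) \<and> t n \<le> T \<and> (\<forall>i\<le>n. y i \<in> S) \<longrightarrow>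
        measure M {\<omega> \<in> space M. \<forall>i\<le>n. X \<omega> (t i) = y i} =
          pmf \<iota> (y 0) *
          (\<Prod>i<n. semigroup_of G (t (Suc i) - t i) (indicator {y (Suc i)}) (y i)))"

definition grid :: "nat \<Rightarrow> circle set" where
  "grid k = {circle_of (real j / real k) | j. j < k}"

text \<open>Only the values of \<open>f\<close> on \<open>grid k\<close> matter for \<open>discrete_laplacian k f x\<close> with \<open>x\<close> in
  \<open>grid k\<close>.\<close>

definition discrete_laplacian :: "nat \<Rightarrow> (circle \<Rightarrow> real) \<Rightarrow> circle \<Rightarrow> real" where
  "discrete_laplacian k f x =
     (f (circle_of (coord x + 1 / real k)) - f x) + (f (circle_of (coord x - 1 / real k)) - f x)"

lemma discrete_laplacian_grid:
  "discrete_laplacian k f (circle_of (of_int j / real k)) =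
     (f (circle_of (of_int (j + 1) / real k)) - f (circle_of (of_int j / real k))) +
     (f (circle_of (of_int (j - 1) / real k)) - f (circle_of (of_int j / real k)))"
proof -
  define a :: real where "a = of_int j / real k"
  have eq: "circle_of (frac a + h) = circle_of (a + h)" for h
  proof -
    have "frac a + h - (a + h) = of_int (- \<lfloor>a\<rfloor>)" by (simp add: frac_def)
    then show ?thesis unfolding circle_of_eq_iff by (metis Ints_of_int)
  qed
  have "of_int (j + 1) / real k = a + 1 / real k"
    unfolding a_def of_int_add of_int_1 by (rule add_divide_distrib)
  moreover have "of_int (j - 1) / real k = a - 1 / real k"
    unfolding a_def of_int_diff of_int_1 by (rule diff_divide_distrib)
  moreover have "circle_of (frac a - 1 / real k) = circle_of (a - 1 / real k)"
    using eq[of "- (1 / real k)"] by simp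
  ultimately show ?thesis
    unfolding discrete_laplacian_def coord_circle_of by (simp only: a_def[symmetric] coord_circle_of eq)
qed

text \<open>\<open>random_walk M T k x\<^sub>0 X\<close>: the walk started at the grid point \<open>\<lfloor>k x\<^sub>0\<rfloor> / k\<close> that jumps to each
  of its two neighbours at rate \<open>k\<close>.\<close>

definition random_walk ::
  "'w measure \<Rightarrow> real \<Rightarrow> nat \<Rightarrow> circle \<Rightarrow> ('w \<Rightarrow> real \<Rightarrow> circle) \<Rightarrow> bool" where
  "random_walk M T k x\<^sub>0 X \<longleftrightarrow>
     markov_chain_with_generator M T (grid k) (\<lambda>f x. real k * discrete_laplacian k f x)
       (return_pmf (circle_of (of_int \<lfloor>real k * coord x\<^sub>0\<rfloor> / real k))) X"

section \<open>The rate function\<close>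

definition abs_continuous :: "real \<Rightarrow> (real \<Rightarrow> circle) \<Rightarrow> bool" where
  "abs_continuous T \<gamma> \<longleftrightarrow>
     (\<forall>\<epsilon>>0. \<exists>\<delta>>0. \<forall>n. \<forall>s t :: nat \<Rightarrow> real.
        (\<forall>i<n. 0 \<le> s i \<and> s i < t i \<and> t i \<le> T) \<and>
        disjoint_family_on (\<lambda>i. {s i<..<t i}) {..<n} \<and>
        (\<Sum>i<n. t i - s i) < \<delta> \<longrightarrow>
        (\<Sum>i<n. dist (\<gamma> (t i)) (\<gamma> (s i))) < \<epsilon>)"

text \<open>The derivative of a circle-valued path is that of any real lift \<open>\<theta>\<close> differentiable at the point
  in question; at other points the value is unspecified.\<close>

definition circle_deriv :: "real \<Rightarrow> (real \<Rightarrow> circle) \<Rightarrow> real \<Rightarrow> real" where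
  "circle_deriv T \<gamma> s =
     (THE v. \<exists>\<theta>. (\<forall>t\<in>{0..T}. \<gamma> t = circle_of (\<theta> t)) \<and>
                 (\<theta> has_real_derivative v) (at s within {0..T}))"

lemma circle_deriv_eqI:
  assumes T: "0 < T" and s: "s \<in> {0..T}"
    and lift: "\<And>t. t \<in> {0..T} \<Longrightarrow> \<gamma> t = circle_of (\<theta> t)"
    and der: "(\<theta> has_real_derivative v) (at s within {0..T})"
  shows "circle_deriv T \<gamma> s = v"
  unfolding circle_deriv_def
proof (rule the_equality)
  show "\<exists>\<theta>. (\<forall>t\<in>{0..T}. \<gamma> t = circle_of (\<theta> t)) \<and> (\<theta> has_real_derivative v) (at s within {0..T})"
    using lift der by blast
  fix w assume "\<exists>\<theta>. (\<forall>t\<in>{0..T}. \<gamma> t = circle_of (\<theta> t)) \<and> (\<theta> has_real_derivative w) (at s within {0..T})"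
  then obtain \<phi> where lift': "\<And>t. t \<in> {0..T} \<Longrightarrow> \<gamma> t = circle_of (\<phi> t)"
    and der': "(\<phi> has_real_derivative w) (at s within {0..T})" by blast
  have dd: "((\<lambda>t. \<phi> t - \<theta> t) has_real_derivative w - v) (at s within {0..T})"
    by (rule DERIV_diff[OF der' der])
  have int: "\<phi> t - \<theta> t \<in> \<int>" if "t \<in> {0..T}" for t
    using lift[OF that] lift'[OF that] circle_of_eq_iff by simp
  have "continuous (at s within {0..T}) (\<lambda>t. \<phi> t - \<theta> t)"
    using dd by (rule DERIV_continuous)
  then have "\<forall>\<^sub>F t in at s within {0..T}. dist (\<phi> t - \<theta> t) (\<phi> s - \<theta> s) < 1"
    unfolding continuous_within by (rule tendstoD) simp
  then have "\<forall>\<^sub>F t in at s within {0..T}. \<phi> t - \<theta> t = \<phi> s - \<theta> s"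
    unfolding eventually_at_filter
  proof (rule eventually_mono, intro impI)
    fix t assume *: "t \<noteq> s \<longrightarrow> t \<in> {0..T} \<longrightarrow> dist (\<phi> t - \<theta> t) (\<phi> s - \<theta> s) < 1"
      and "t \<noteq> s" and t: "t \<in> {0..T}"
    then have "dist (\<phi> t - \<theta> t) (\<phi> s - \<theta> s) < 1" by blast
    moreover obtain a b where "\<phi> t - \<theta> t = of_int a" "\<phi> s - \<theta> s = of_int b"
      using int[OF t] int[OF s] by (auto elim!: Ints_cases)
    ultimately show "\<phi> t - \<theta> t = \<phi> s - \<theta> s"
      by (simp add: dist_real_def flip: of_int_diff of_int_abs)
  qed
  then have "\<forall>\<^sub>F t in at s within {0..T}. (\<phi> t - \<theta> t - (\<phi> s - \<theta> s)) / (t - s) = 0"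
    by eventually_elim simp
  then have "((\<lambda>t. (\<phi> t - \<theta> t - (\<phi> s - \<theta> s)) / (t - s)) \<longlongrightarrow> 0) (at s within {0..T})"
    by (rule tendsto_eventually)
  moreover have "((\<lambda>t. (\<phi> t - \<theta> t - (\<phi> s - \<theta> s)) / (t - s)) \<longlongrightarrow> w - v) (at s within {0..T})"
    using dd by (simp add: has_field_derivative_iff)
  moreover have "at s within {0..T} \<noteq> bot"
    using T s by (simp add: trivial_limit_within)
  ultimately have "w - v = 0" using tendsto_unique by blast
  then show "w = v" by simp
qed

definition lagrangian :: "real \<Rightarrow> real" where
  "lagrangian v = v * ln ((v + sqrt (v\<^sup>2 + 4)) / 2) - sqrt (v\<^sup>2 + 4) + 2"

text \<open>Nonnegativity ensures that \<open>ennreal\<close> does not truncate the integrand below.\<close>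

lemma lagrangian_nonneg: "0 \<le> lagrangian v"
proof -
  define r where "r = sqrt (v\<^sup>2 + 4)"
  define u where "u = (v + r) / 2"
  have r2: "r * r = v * v + 4" unfolding r_def by (simp add: power2_eq_square)
  have "\<bar>v\<bar> < r" unfolding r_def by (rule real_less_rsqrt) simp
  then have "0 < v + r" by linarith
  then have u: "0 < u" unfolding u_def by simp
  have "u * ((r - v) / 2) = 1" using r2 unfolding u_def by (simp add: algebra_simps)
  then have iu: "1 / u = (r - v) / 2" using u by (simp add: field_simps)
  have v: "v = u - 1 / u" and r: "r = u + 1 / u" unfolding iu by (simp_all add: u_def field_simps)
  have 1: "1 / u * ln u \<le> 1 / u * (u - 1)"
    using u ln_le_minus_one[OF u] by (intro mult_left_mono) auto
  have "ln (1 / u) \<le> 1 / u - 1" using u by (intro ln_le_minus_one) simp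
  then have "1 - 1 / u \<le> ln u" using u by (simp add: ln_div)
  then have 2: "u * (1 - 1 / u) \<le> u * ln u" using u by (intro mult_left_mono) auto
  have "lagrangian v = v * ln u - r + 2" unfolding lagrangian_def u_def r_def by simp
  also have "\<dots> = u * ln u - 1 / u * ln u - u - 1 / u + 2"
    by (subst v, subst r) (simp add: algebra_simps)
  also have "\<dots> \<ge> 0"
  proof -
    have "u * (1 - 1 / u) = u - 1" "1 / u * (u - 1) = 1 - 1 / u"
      using u by (simp_all add: field_simps)
    then show ?thesis using 1 2 by linarith
  qed
  finally show ?thesis .
qed

text \<open>The integral may be infinite even for absolutely continuous paths. The walks start (almost) at
  \<open>x\<^sub>0\<close>, so the rate is finite only for paths that start at \<open>x\<^sub>0\<close>; without this the lower bound
  fails for a small ball around a constant path at another point.\<close>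

definition rate_function :: "real \<Rightarrow> circle \<Rightarrow> (real \<Rightarrow> circle) \<Rightarrow> ereal" where
  "rate_function T x\<^sub>0 \<gamma> =
     (if abs_continuous T \<gamma> \<and> \<gamma> 0 = x\<^sub>0
      then enn2ereal (\<integral>\<^sup>+ s\<in>{0..T}. ennreal (lagrangian (circle_deriv T \<gamma> s)) \<partial>lebesgue)
      else \<infinity>)"

definition log_prob :: "real \<Rightarrow> ereal" where
  "log_prob p = (if p = 0 then - \<infinity> else ereal (ln p))"

end

theory Submission
  imports Defs "HOL-Complex_Analysis.Great_Picard"
begin

text \<open>
  The Lagrangian is the Legendre transform of \<open>cumulant \<alpha> = 2 cosh \<alpha> - 2\<close>, the logarithmic moment
  generating function of the jumps. Sampled at the \<open>2 ^ n\<close> dyadic times of level \<open>n\<close>, with spacing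
  \<open>h\<close>, the walk is a Markov chain whose transition probabilities satisfy, up to polynomial factors in
  \<open>k\<close>,
    \<open>trans_prob k h x y = exp (- k h lagrangian (dist x y / h))\<close>
  (\<open>trans_prob_upper\<close>, \<open>trans_prob_lower\<close>). Hence the probability of a sampled path is
  \<open>exp (- k energy)\<close> up to such factors, where the energy is the action of the path that interpolates
  along shortest arcs.

  Between the sampling times the walk could make a large excursion. A maximal inequality, obtained
  from the fact that \<open>cosh (\<alpha> k dist z c)\<close> grows in mean by at most the factor
  \<open>exp (k t cumulant \<alpha>)\<close>, bounds the probability of an excursion beyond \<open>\<delta>\<close> by
  \<open>2 exp (- k h lagrangian (\<delta> / h))\<close>. As the Lagrangian grows faster than linearly, this exponential
  rate exceeds any given number once \<open>h\<close> is small (\<open>lagrangian_superlinear\<close>), so excursions are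
  negligible in both bounds.

  The upper bound follows because only polynomially many sampled paths exist: a path in the closed
  set \<open>C\<close> makes an excursion or has large energy (\<open>walk_upper\<close>). Indeed, if \<open>a\<close> is less than the
  rate of all paths in \<open>C\<close>, then at some level all paths in \<open>C\<close> that start near \<open>x\<^sub>0\<close> and make no
  excursion have energy above \<open>a\<close> (\<open>closed_energy_gap\<close>); this is a compactness argument. The
  lower bound follows by forcing the walk to visit points near the values of a given path at
  the sampling times (\<open>walk_lower\<close>).

  Both bounds rest on the fact that the rate of a path is the limit of its energies. An absolutely
  continuous path has energies at most its rate by Jensen's inequality (\<open>energy_le_rate\<close>), and a
  continuous path with energies at most \<open>a\<close> is absolutely continuous with rate at most \<open>a\<close> by
  superlinear growth and Fatou's lemma (\<open>rate_le_energy_bound\<close>). The two statements use that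
  absolutely continuous real functions are differentiable almost everywhere, which is proved by a
  double application of the Vitali covering theorem (\<open>ac_differentiable_ae\<close>), and that their increments
  are at most the integral of the absolute derivative (\<open>ac_increment_le_nn_integral\<close>).
\<close>

section \<open>Differentiability of absolutely continuous functions\<close>

definition increment :: "(real \<Rightarrow> real) \<Rightarrow> real set \<Rightarrow> real" where
  "increment f K = f (Sup K) - f (Inf K)"

lemma increment_Icc [simp]: "u \<le> v \<Longrightarrow> increment f {u..v} = f v - f u"
  by (simp add: increment_def)

text \<open>Absolute continuity of a real function, phrased with divisions into intervals so that the
  additivity of divisions applies to it. Degenerate intervals are allowed; their increment is
  zero.\<close>

definition ac_on :: "real \<Rightarrow> real \<Rightarrow> (real \<Rightarrow> real) \<Rightarrow> bool" where
  "ac_on a b f \<longleftrightarrow> (\<forall>\<epsilon>>0. \<exists>\<delta>>0. \<forall>D. D division_of \<Union>D \<and> \<Union>D \<subseteq> {a..b} \<and> (\<Sum>K\<in>D. measure lebesgue K) < \<delta> \<longrightarrow>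
     (\<Sum>K\<in>D. \<bar>increment f K\<bar>) < \<epsilon>)"

lemma ac_onD:
  assumes "ac_on a b f" "\<epsilon> > 0"
  obtains \<delta> where "\<delta> > 0" "\<And>D. D division_of \<Union>D \<Longrightarrow> \<Union>D \<subseteq> {a..b} \<Longrightarrow> (\<Sum>K\<in>D. measure lebesgue K) < \<delta> \<Longrightarrow>
     (\<Sum>K\<in>D. \<bar>increment f K\<bar>) < \<epsilon>"
  using assms unfolding ac_on_def by meson

lemma ac_on_subset: "ac_on a b f \<Longrightarrow> a \<le> c \<Longrightarrow> d \<le> b \<Longrightarrow> ac_on c d f"
  unfolding ac_on_def
  by (meson atLeastatMost_subset_iff subset_trans)

lemma ac_on_uminus: "ac_on a b f \<Longrightarrow> ac_on a b (\<lambda>x. - f x)"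
proof -
  have *: "\<bar>increment (\<lambda>x. - f x) K\<bar> = \<bar>increment f K\<bar>" for K by (simp add: increment_def)
  show "ac_on a b f \<Longrightarrow> ac_on a b (\<lambda>x. - f x)" unfolding ac_on_def * .
qed

lemma division_of_Icc: "u \<le> v \<Longrightarrow> {{u..v}} division_of \<Union>{{u..v::real}}"
  using division_of_self[of u v] by simp

lemma ac_on_continuous:
  assumes "ac_on a b f"
  shows "continuous_on {a..b} f"
  unfolding continuous_on_iff
proof (intro ballI allI impI)
  fix x e assume x: "x \<in> {a..b}" and e: "(e::real) > 0"
  obtain \<delta> where \<delta>: "\<delta> > 0" "\<And>D. D division_of \<Union>D \<Longrightarrow> \<Union>D \<subseteq> {a..b} \<Longrightarrow> (\<Sum>K\<in>D. measure lebesgue K) < \<delta> \<Longrightarrow>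
     (\<Sum>K\<in>D. \<bar>increment f K\<bar>) < e" by (rule ac_onD[OF assms e]) blast
  have "\<bar>f v - f u\<bar> < e" if "u \<in> {a..b}" "v \<in> {a..b}" "u \<le> v" "v - u < \<delta>" for u v
    using \<delta>(2)[OF division_of_Icc[OF that(3)]] that by auto
  then have "\<forall>y\<in>{a..b}. dist y x < \<delta> \<longrightarrow> dist (f y) (f x) < e"
    using x by (smt (verit, best) dist_real_def abs_minus_commute)
  then show "\<exists>d>0. \<forall>y\<in>{a..b}. dist y x < d \<longrightarrow> dist (f y) (f x) < e" using \<delta>(1) by blast
qed

lemma increment_sum_Icc:
  assumes "a \<le> b" "D division_of {a..b}"
  shows "(\<Sum>K\<in>D. increment f K) = f b - f a"
proof -
  have K: "Inf K \<in> K" if KD: "K \<in> D" for K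
  proof -
    from division_ofD(3,4)[OF assms(2) KD] obtain u v where "K = {u..v}" "u \<le> v" by auto
    then show ?thesis by simp
  qed
  have "(\<lambda>K. (Inf K, K)) ` D tagged_division_of {a..b}"
  proof (rule tagged_division_ofI)
    show "finite ((\<lambda>K. (Inf K, K)) ` D)" using assms(2) by auto
    show "\<Union>{K. \<exists>x. (x, K) \<in> (\<lambda>K. (Inf K, K)) ` D} = {a..b}"
    proof -
      have "{K. \<exists>x. (x, K) \<in> (\<lambda>K. (Inf K, K)) ` D} = D" by auto
      then show ?thesis using division_ofD(6)[OF assms(2)] by simp
    qed
    fix x K assume xK: "(x, K) \<in> (\<lambda>K. (Inf K, K)) ` D"
    then show "x \<in> K" "K \<subseteq> {a..b}" "\<exists>u v. K = cbox u v"
      using division_ofD(2,4)[OF assms(2)] K by blast+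
    fix y L assume yL: "(y, L) \<in> (\<lambda>K. (Inf K, K)) ` D" "(x, K) \<noteq> (y, L)"
    then show "interior K \<inter> interior L = {}" using xK division_ofD(5)[OF assms(2)] by auto
  qed
  from additive_tagged_division_1[OF assms(1) this, of f] show ?thesis
    by (subst (asm) sum.reindex) (auto simp: inj_on_def increment_def)
qed

text \<open>A division of \<open>S\<close> can be completed to a division of an enclosing interval, and all
  divisions of \<open>S\<close> share the same completion; on the interval the increments telescope.
  Comparing two divisions of one set is what makes a double covering argument work.\<close>

lemma increment_sum_unique:
  fixes f :: "real \<Rightarrow> real"
  assumes D: "D division_of S" and D': "D' division_of S"
  shows "(\<Sum>K\<in>D. increment f K) = (\<Sum>K\<in>D'. increment f K)"
proof -
  obtain a b where ab: "S \<subseteq> {a..b}" "a \<le> b"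
  proof -
    have "bounded S" using D by blast
    then obtain a where "S \<subseteq> cbox (-a) a" using bounded_subset_cbox_symmetric by blast
    then have "S \<subseteq> {-max a 0..max a 0}" by auto
    then show ?thesis using that[of "-max a 0" "max a 0"] by auto
  qed
  have U: "\<Union>D = S" "\<Union>D' = S" using division_ofD(6) D D' by auto
  obtain q where q: "D \<subseteq> q" "q division_of {a..b}"
    using partial_division_extend_interval[of D a b] D U(1) ab by auto
  note dq = division_ofD[OF q(2)]
  define H where "H = q - D"
  have H: "H division_of \<Union>H" unfolding H_def using division_of_subset[OF division_of_union_self[OF q(2)]] by auto
  have I: "interior S \<inter> interior (\<Union>H) = {}"
  proof (rule Int_interior_Union_intervals)
    show "finite H" "open (interior S)" using H by auto
    show "\<And>T. T \<in> H \<Longrightarrow> \<exists>a b. T = cbox a b" using division_ofD(4)[OF H] .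
    fix T assume T: "T \<in> H"
    have "interior T \<inter> interior (\<Union>D) = {}"
      using T dq(4) dq(5)[of T] q(1) by (intro Int_interior_Union_intervals) (use division_ofD(1,4)[OF D] in \<open>auto simp: H_def\<close>)
    then show "interior S \<inter> interior T = {}" using U by auto
  qed
  have "\<Union>q = \<Union>D \<union> \<Union>H" unfolding H_def using q(1) by blast
  then have SH: "S \<union> \<Union>H = {a..b}" using U dq(6) by simp
  have *: "(\<Sum>K\<in>E. increment f K) + (\<Sum>K\<in>H. increment f K) = f b - f a" if E: "E division_of S" for E
  proof -
    have "E \<union> H division_of {a..b}" using division_disjoint_union[OF E H I] SH by simp
    then have "(\<Sum>K\<in>E \<union> H. increment f K) = f b - f a" by (rule increment_sum_Icc[OF ab(2)])
    moreover have "(\<Sum>K\<in>E \<union> H. increment f K) = (\<Sum>K\<in>E. increment f K) + (\<Sum>K\<in>H. increment f K)"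
    proof (rule sum.union_inter_neutral)
      show "finite E" "finite H" using E H by auto
      show "\<forall>x\<in>E \<inter> H. increment f x = 0"
      proof
        fix K assume K: "K \<in> E \<inter> H"
        then have KE: "K \<in> E" by simp
        obtain u v where "K = {u..v}" using division_ofD(4)[OF E KE] by auto
        then have uv: "K = {u..v}" "u \<le> v" using division_ofD(3)[OF E KE] by auto
        have "K \<subseteq> S" "K \<subseteq> \<Union>H" using K division_ofD(2)[OF E KE] by auto
        then have "interior K \<subseteq> interior S \<inter> interior (\<Union>H)" by (simp add: interior_mono)
        then have "interior K = {}" using I by auto
        then have "u = v" using uv by (simp add: interior_atLeastAtMost_real)
        then show "increment f K = 0" using uv by (simp add: increment_def)
      qed
    qed
    ultimately show ?thesis by simp
  qed
  from *[OF D] *[OF D'] show ?thesis by simp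
qed

text \<open>The Vitali covering theorem gives countably many disjoint intervals that cover almost all
  of \<open>E\<close>; finitely many of them are enough up to measure \<open>\<eta>\<close>, and a finite disjoint family is a
  division, to which absolute continuity applies.\<close>

lemma Vitali_finite:
  fixes U E :: "real set"
  assumes U: "open U" "U \<in> lmeasurable" and E: "E \<subseteq> U" "E \<in> sets lebesgue" and \<eta>: "\<eta> > 0"
    and fine: "\<And>x d. x \<in> E \<Longrightarrow> d > 0 \<Longrightarrow> \<exists>u v. u < x \<and> x < v \<and> v - u < d \<and> P u v"
  obtains F where "F division_of \<Union>F" "\<Union>F \<subseteq> U" "\<And>K. K \<in> F \<Longrightarrow> \<exists>u v. u < v \<and> K = {u..v} \<and> P u v"
    "measure lebesgue (E - \<Union>F) < \<eta>"
proof -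
  define K where "K = {(u, v). u < v \<and> {u..v} \<subseteq> U \<and> P u v}"
  define c where "c = (\<lambda>(u, v). (u + v) / 2 :: real)"
  define r where "r = (\<lambda>(u, v). (v - u) / 2 :: real)"
  have cb: "cball (c i) (r i) = {fst i..snd i}" for i
    unfolding c_def r_def cball_eq_atLeastAtMost by (auto simp: case_prod_beta field_simps)
  obtain C where C: "countable C" "C \<subseteq> K" "pairwise (\<lambda>i j. disjnt (cball (c i) (r i)) (cball (c j) (r j))) C"
    "negligible (E - (\<Union>i\<in>C. cball (c i) (r i)))"
  proof (rule Vitali_covering_theorem_cballs[of K r E c])
    show "0 < r i" if "i \<in> K" for i using that unfolding K_def r_def by auto
    show "\<exists>i. i \<in> K \<and> x \<in> cball (c i) (r i) \<and> r i < d" if x: "x \<in> E" and d: "0 < d" for x d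
    proof -
      obtain e where e: "e > 0" "ball x e \<subseteq> U" using U E x openE by blast
      obtain u v where uv: "u < x" "x < v" "v - u < min d e" "P u v" using fine[OF x, of "min d e"] d e by auto
      have "{u..v} \<subseteq> ball x e" using uv by (auto simp: dist_real_def)
      then have "(u, v) \<in> K" using uv e unfolding K_def by auto
      moreover have "r (u, v) < d" using uv unfolding r_def by auto
      ultimately show ?thesis using uv unfolding cb by (intro exI[of _ "(u, v)"]) auto
    qed
  qed auto
  define D where "D = (\<lambda>i. {fst i..snd i}) ` C"
  have D1: "countable D" unfolding D_def using C(1) by simp
  have D2: "L \<in> lmeasurable" if "L \<in> D" for L using that unfolding D_def by auto
  have DU: "\<Union>D \<subseteq> U" using C(2) unfolding D_def K_def by fastforce
  obtain F where F: "F \<subseteq> D" "finite F" "measure lebesgue (\<Union>D) - \<eta> < measure lebesgue (\<Union>F)"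
  proof (rule measure_countable_Union_approachable[OF D1 \<eta> D2])
    show "measure lebesgue (\<Union>F) \<le> measure lebesgue U" if "F \<subseteq> D" "finite F" for F
      using that DU D2 U(2) by (intro measure_mono_fmeasurable) (auto intro!: fmeasurableD fmeasurable.finite_Union)
  qed auto
  have DL: "\<Union>D \<in> lmeasurable"
    by (rule fmeasurableI2[OF U(2) DU]) (use D1 D2 in \<open>auto intro!: sets.countable_Union\<close>)
  show ?thesis
  proof
    show "F division_of \<Union>F"
    proof (rule division_ofI)
      show "finite F" by fact
      show "L \<noteq> {}" "\<exists>a b. L = cbox a b" if LF: "L \<in> F" for L
      proof -
        obtain i where "i \<in> K" "L = {fst i..snd i}" using LF F(1) C(2) unfolding D_def by blast
        then show "L \<noteq> {}" "\<exists>a b. L = cbox a b" unfolding K_def by auto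
      qed
      show "interior L \<inter> interior L' = {}" if "L \<in> F" "L' \<in> F" "L \<noteq> L'" for L L'
      proof -
        obtain i where "i \<in> C" "L = {fst i..snd i}" using \<open>L \<in> F\<close> F(1) unfolding D_def by blast
        moreover obtain j where "j \<in> C" "L' = {fst j..snd j}" using \<open>L' \<in> F\<close> F(1) unfolding D_def by blast
        ultimately have "disjnt L L'" using C(3) \<open>L \<noteq> L'\<close> unfolding cb pairwise_def by metis
        then show ?thesis using interior_subset unfolding disjnt_def by blast
      qed
    qed auto
    show "\<Union>F \<subseteq> U" using F(1) DU by auto
    show "\<exists>u v. u < v \<and> L = {u..v} \<and> P u v" if LF: "L \<in> F" for L
    proof -
      obtain i where "i \<in> K" "L = {fst i..snd i}" using LF F(1) C(2) unfolding D_def by blast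
      then show ?thesis unfolding K_def by auto
    qed
    have FL: "\<Union>F \<in> lmeasurable" using F D2 by (intro fmeasurable.finite_Union) auto
    have "negligible (E - \<Union>D)" using C(4) unfolding cb D_def .
    then have N: "E - \<Union>D \<in> lmeasurable" "measure lebesgue (E - \<Union>D) = 0"
      by (simp_all add: negligible_iff_measure)
    have "measure lebesgue (E - \<Union>F) \<le> measure lebesgue ((E - \<Union>D) \<union> (\<Union>D - \<Union>F))"
    proof (rule measure_mono_fmeasurable)
      show "E - \<Union>F \<in> sets lebesgue" using E(2) fmeasurableD[OF FL] by (rule sets.Diff)
      show "(E - \<Union>D) \<union> (\<Union>D - \<Union>F) \<in> lmeasurable" using N DL FL by (intro fmeasurable.Un N(1) fmeasurable_Diff fmeasurableD)
    qed blast
    also have "\<dots> \<le> measure lebesgue (E - \<Union>D) + measure lebesgue (\<Union>D - \<Union>F)"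
      by (rule measure_Un_le) (use fmeasurableD[OF N(1)] fmeasurableD[OF DL] fmeasurableD[OF FL] in blast)+
    also have "\<dots> = measure lebesgue (\<Union>D) - measure lebesgue (\<Union>F)"
      using N DL FL F(1) by (simp add: measurable_measure_Diff Union_mono)
    finally show "measure lebesgue (E - \<Union>F) < \<eta>" using F(3) by simp
  qed
qed

text \<open>The points that lie inside arbitrarily short intervals over which \<open>f\<close> has slope larger
  than \<open>q\<close>. Since the point need only lie inside the interval, this is a countable intersection
  of open sets for every \<open>f\<close>. Slopes smaller than \<open>p\<close> are slopes of \<open>- f\<close> larger than \<open>-
  p\<close>.\<close>

definition steep :: "real \<Rightarrow> real \<Rightarrow> (real \<Rightarrow> real) \<Rightarrow> real \<Rightarrow> real set" where
  "steep a b f q = {x. \<forall>d>0. \<exists>u v. u < x \<and> x < v \<and> a < u \<and> v < b \<and> v - u < d \<and> q * (v - u) < f v - f u}"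

lemma steep_borel: "steep a b f q \<in> sets borel"
proof -
  have "steep a b f q = (\<Inter>n::nat. \<Union>{{u<..<v} |u v. a < u \<and> v < b \<and> v - u < 1 / Suc n \<and> q * (v - u) < f v - f u})" (is "_ = ?R")
  proof
    show "steep a b f q \<subseteq> ?R"
    proof (intro subsetI INT_I)
      fix x n assume x: "x \<in> steep a b f q"
      have "1 / real (Suc n) > 0" by simp
      then obtain u v where "u < x \<and> x < v \<and> a < u \<and> v < b \<and> v - u < 1 / Suc n \<and> q * (v - u) < f v - f u"
        using x unfolding steep_def by blast
      then show "x \<in> \<Union>{{u<..<v} |u v. a < u \<and> v < b \<and> v - u < 1 / Suc n \<and> q * (v - u) < f v - f u}"
        by (intro UnionI[of "{u<..<v}"]) auto
    qed
    show "?R \<subseteq> steep a b f q"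
    proof
      fix x assume x: "x \<in> ?R"
      show "x \<in> steep a b f q" unfolding steep_def
      proof (intro CollectI allI impI)
        fix d :: real assume "0 < d"
        then obtain n where n: "1 / real (Suc n) < d" using nat_approx_posE by blast
        from x obtain u v where "u < x" "x < v" "a < u" "v < b" "v - u < 1 / Suc n" "q * (v - u) < f v - f u" by fastforce
        then show "\<exists>u v. u < x \<and> x < v \<and> a < u \<and> v < b \<and> v - u < d \<and> q * (v - u) < f v - f u"
          using n by (intro exI[of _ u] exI[of _ v]) auto
      qed
    qed
  qed
  moreover have "?R \<in> sets borel"
    by (intro sets.countable_INT image_subsetI borel_open open_Union) auto
  ultimately show ?thesis by simp
qed

lemma steep_subset: "steep a b f q \<subseteq> {a<..<b}"
proof
  fix x assume "x \<in> steep a b f q"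
  then obtain u v where "u < x \<and> x < v \<and> a < u \<and> v < b" unfolding steep_def using zero_less_one by blast
  then show "x \<in> {a<..<b}" by auto
qed

lemma lmeasurable_subset_Ioo:
  fixes U :: "real set"
  shows "U \<in> sets lebesgue \<Longrightarrow> U \<subseteq> {a<..<b} \<Longrightarrow> U \<in> lmeasurable"
  by (rule fmeasurableI2[of "{a<..<b}"]) auto

lemma division_measure_sum: "F division_of \<Union>F \<Longrightarrow> (\<Sum>K\<in>F. measure lebesgue K) = measure lebesgue (\<Union>F)"
  by (rule content_division)

lemma division_lmeasurable: "F division_of \<Union>F \<Longrightarrow> \<Union>F \<in> lmeasurable"
  using lmeasurable_division by blast

lemma measure_le_open_superset:
  assumes "E \<in> sets lebesgue" "E \<subseteq> {a<..<b::real}" "\<eta> > 0"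
  obtains U where "open U" "E \<subseteq> U" "U \<subseteq> {a<..<b}" "U \<in> lmeasurable" "measure lebesgue U < measure lebesgue E + \<eta>"
proof -
  obtain V where V: "open V" "E \<subseteq> V" "V - E \<in> lmeasurable" "emeasure lebesgue (V - E) < ennreal \<eta>"
    by (rule sets_lebesgue_outer_open[OF assms(1,3)])
  define U where "U = V \<inter> {a<..<b}"
  have U: "open U" "E \<subseteq> U" "U \<subseteq> {a<..<b}" using V assms(2) unfolding U_def by auto
  have UL: "U \<in> lmeasurable" using U by (intro lmeasurable_subset_Ioo) auto
  have EL: "E \<in> lmeasurable" using U assms UL fmeasurableI2 by blast
  have "measure lebesgue U - measure lebesgue E = measure lebesgue (U - E)"
    using UL EL U by (simp add: measurable_measure_Diff)
  also have "\<dots> \<le> measure lebesgue (V - E)"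
    using V UL EL by (intro measure_mono_fmeasurable) (auto simp: U_def)
  also have "\<dots> < \<eta>" using V(3,4) assms(3) by (metis emeasure_eq_measure2 ennreal_less_iff measure_nonneg)
  finally show ?thesis using that U UL by simp
qed

text \<open>Let \<open>e\<close> be the measure of this set. Cover almost all of it by finitely many disjoint
  intervals \<open>F\<close> of slope below \<open>p\<close> and total length at most \<open>e + \<eta>\<close>, and then, inside them, by
  finitely many disjoint intervals \<open>G\<close> of slope above \<open>q\<close>. The part \<open>R\<close> of \<open>F\<close> outside
  \<open>G\<close> is so short that \<open>f\<close> hardly changes on it, so \<open>q e\<close> is at most about \<open>p e\<close>, whence
  \<open>e = 0\<close>. Absolute continuity replaces the monotonicity that the classical argument uses at
  this point.\<close>

lemma ac_flat_steep_negligible: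
  assumes ac: "ac_on a b f" and pq: "p < q"
  shows "negligible (steep a b f q \<inter> steep a b (\<lambda>x. - f x) (- p))"
proof -
  define E where "E = steep a b f q \<inter> steep a b (\<lambda>x. - f x) (- p)"
  have Eb: "E \<in> sets lebesgue" using steep_borel unfolding E_def by (metis sets.Int sets_completionI_sets sets_lborel)
  have Eab: "E \<subseteq> {a<..<b}" using steep_subset unfolding E_def by blast
  have EL: "E \<in> lmeasurable" using Eb Eab by (rule lmeasurable_subset_Ioo)
  define e where "e = measure lebesgue E"
  have "e = 0"
  proof (rule ccontr)
    assume "e \<noteq> 0"
    then have e: "e > 0" unfolding e_def by (simp add: zero_less_measure_iff)
    define \<epsilon> where "\<epsilon> = (q - p) * e / 8"
    have \<epsilon>: "\<epsilon> > 0" unfolding \<epsilon>_def using e pq by simp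
    obtain \<delta> where \<delta>: "\<delta> > 0" "\<And>D. D division_of \<Union>D \<Longrightarrow> \<Union>D \<subseteq> {a..b} \<Longrightarrow> (\<Sum>K\<in>D. measure lebesgue K) < \<delta> \<Longrightarrow>
     (\<Sum>K\<in>D. \<bar>increment f K\<bar>) < \<epsilon>" by (rule ac_onD[OF ac \<epsilon>]) blast
    \<comment> \<open>Chosen such that \<open>R\<close> below is shorter than \<open>3 \<eta> < \<delta>\<close> and the errors sum to less than
      \<open>(q - p) e / 2\<close>.\<close>
    define \<eta> where "\<eta> = min (\<delta> / 4) (min (e / 4) (\<epsilon> / (4 * (\<bar>p\<bar> + 1))))"
    have \<eta>: "\<eta> > 0" unfolding \<eta>_def using \<delta> e \<epsilon> by auto
    have \<eta>1: "\<eta> \<le> \<delta> / 4" "\<eta> \<le> e / 4" unfolding \<eta>_def by linarith+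
    have \<eta>2: "\<bar>p\<bar> * (3 * \<eta>) \<le> \<epsilon>"
    proof -
      have "4 * (\<bar>p\<bar> + 1) * \<eta> \<le> 4 * (\<bar>p\<bar> + 1) * (\<epsilon> / (4 * (\<bar>p\<bar> + 1)))"
        unfolding \<eta>_def by (intro mult_left_mono) auto
      also have "\<dots> = \<epsilon>" by (simp add: field_simps)
      finally have "4 * (\<bar>p\<bar> + 1) * \<eta> \<le> \<epsilon>" .
      moreover have "\<bar>p\<bar> * (3 * \<eta>) \<le> 4 * (\<bar>p\<bar> + 1) * \<eta>" using \<eta> by (simp add: algebra_simps)
      ultimately show ?thesis by linarith
    qed
    obtain U where U: "open U" "E \<subseteq> U" "U \<subseteq> {a<..<b}" "U \<in> lmeasurable" "measure lebesgue U < e + \<eta>"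
      unfolding e_def by (rule measure_le_open_superset[OF Eb Eab \<eta>])
    obtain F where F: "F division_of \<Union>F" "\<Union>F \<subseteq> U" "\<And>K. K \<in> F \<Longrightarrow> \<exists>u v. u < v \<and> K = {u..v} \<and> f v - f u < p * (v - u)"
      "measure lebesgue (E - \<Union>F) < \<eta>"
    proof (rule Vitali_finite[OF U(1,4,2) Eb \<eta>, of "\<lambda>u v. f v - f u < p * (v - u)"])
      show "\<exists>u v. u < x \<and> x < v \<and> v - u < d \<and> f v - f u < p * (v - u)" if xE: "x \<in> E" and d: "0 < d" for x d
      proof -
        have "x \<in> steep a b (\<lambda>x. - f x) (- p)" using xE unfolding E_def by simp
        then obtain u v where "u < x" "x < v" "v - u < d" "- p * (v - u) < - f v - - f u"
          using d unfolding steep_def by blast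
        then show ?thesis by (intro exI[of _ u] exI[of _ v]) (auto simp: algebra_simps)
      qed
    qed auto
    define W where "W = interior (\<Union>F)"
    define E' where "E' = E \<inter> W"
    have W: "open W" "W \<subseteq> \<Union>F" unfolding W_def by (auto simp: interior_subset)
    have FL: "\<Union>F \<in> lmeasurable" using division_lmeasurable F(1) .
    have Wm: "W \<in> lmeasurable" by (rule fmeasurableI2[OF FL W(2)]) (use W in auto)
    have WF: "negligible (\<Union>F - W)"
    proof -
      have "\<Union>F - W \<subseteq> (\<Union>K\<in>F. K - interior K)" unfolding W_def
        using interior_mono[of _ "\<Union>F"] by blast
      moreover have "negligible (K - interior K)" if "K \<in> F" for K
      proof -
        obtain u v where "K = {u..v}" using F(3)[OF \<open>K \<in> F\<close>] by blast
        then have "K - interior K \<subseteq> {u, v}" by (auto simp: interior_atLeastAtMost_real)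
        then show ?thesis by (meson finite.emptyI finite.insertI finite_subset negligible_finite)
      qed
      then have "negligible (\<Union>K\<in>F. K - interior K)" using F(1) by (intro negligible_Union) auto
      ultimately show ?thesis using negligible_subset by blast
    qed
    have E'L: "E' \<in> lmeasurable" "E' \<subseteq> W" "E' \<in> sets lebesgue" unfolding E'_def using EL Wm fmeasurable.Int fmeasurableD by blast+
    obtain G where G: "G division_of \<Union>G" "\<Union>G \<subseteq> W" "\<And>K. K \<in> G \<Longrightarrow> \<exists>u v. u < v \<and> K = {u..v} \<and> q * (v - u) < f v - f u"
      "measure lebesgue (E' - \<Union>G) < \<eta>"
    proof (rule Vitali_finite[OF W(1) Wm E'L(2,3) \<eta>, of "\<lambda>u v. q * (v - u) < f v - f u"])
      show "\<exists>u v. u < x \<and> x < v \<and> v - u < d \<and> q * (v - u) < f v - f u" if "x \<in> E'" "0 < d" for x d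
      proof -
        have "x \<in> steep a b f q" using that unfolding E'_def E_def by simp
        then show ?thesis using that(2) unfolding steep_def by blast
      qed
    qed auto
    have GL: "\<Union>G \<in> lmeasurable" using division_lmeasurable G(1) .
    define lF where "lF = measure lebesgue (\<Union>F)"
    define lG where "lG = measure lebesgue (\<Union>G)"
    have "e \<le> measure lebesgue ((E - \<Union>F) \<union> ((\<Union>F - W) \<union> ((E' - \<Union>G) \<union> \<Union>G)))"
      unfolding e_def by (rule measure_mono_fmeasurable) (use Eb EL FL Wm E'L GL in \<open>auto simp: E'_def\<close>)
    also have "\<dots> \<le> measure lebesgue (E - \<Union>F) + (measure lebesgue (\<Union>F - W) + (measure lebesgue (E' - \<Union>G) + lG))"
      unfolding lG_def using Eb EL FL Wm E'L GL
      by (intro order_trans[OF measure_Un_le] add_left_mono) auto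
    also have "\<dots> < \<eta> + (0 + (\<eta> + lG))" using F(4) G(4) WF negligible_imp_measure0 by fastforce
    finally have lG: "lG > e - 2 * \<eta>" by simp
    have lF: "lF < e + \<eta>" unfolding lF_def using measure_mono_fmeasurable[OF F(2) fmeasurableD[OF FL] U(4)] U(5) by simp
    have lGF: "lG \<le> lF" unfolding lF_def lG_def using G(2) W(2) GL FL by (intro measure_mono_fmeasurable) auto
    obtain r where r: "G \<subseteq> r" "r division_of \<Union>F"
      using partial_division_extend[OF G(1) F(1)] G(2) W(2) by blast
    have fr: "finite r" using r(2) by auto
    define R where "R = r - G"
    have R: "R division_of \<Union>R" unfolding R_def using division_of_subset[OF division_of_union_self[OF r(2)]] by auto
    have len: "(\<Sum>K\<in>r. measure lebesgue K) = lF" unfolding lF_def using content_division[OF r(2)] .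
    have split: "(\<Sum>K\<in>r. g K) = (\<Sum>K\<in>G. g K) + (\<Sum>K\<in>R. g K)" for g :: "real set \<Rightarrow> real"
      unfolding R_def using sum.subset_diff[OF r(1) fr, of g] by simp
    have lR: "(\<Sum>K\<in>R. measure lebesgue K) = lF - lG"
      using split[of "measure lebesgue"] len division_measure_sum[OF G(1)] unfolding lG_def by simp
    have "\<Union>R \<subseteq> \<Union>F" unfolding R_def using division_ofD(6)[OF r(2)] by auto
    then have "\<Union>R \<subseteq> {a<..<b}" using F(2) U(3) by blast
    then have "\<Union>R \<subseteq> {a..b}" by (rule subset_trans) auto
    then have "(\<Sum>K\<in>R. \<bar>increment f K\<bar>) < \<epsilon>"
      by (intro \<delta>(2)[OF R]) (use lR lF lG \<eta>1 \<delta>(1) in auto)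
    then have iR: "(\<Sum>K\<in>R. increment f K) > - \<epsilon>"
      using sum_abs[of "increment f" R] by linarith
    have iF: "(\<Sum>K\<in>F. increment f K) \<le> p * lF"
      unfolding lF_def division_measure_sum[OF F(1), symmetric] sum_distrib_left
      by (intro sum_mono) (use F(3) in fastforce)
    have iG: "(\<Sum>K\<in>G. increment f K) \<ge> q * lG"
      unfolding lG_def division_measure_sum[OF G(1), symmetric] sum_distrib_left
      by (intro sum_mono) (use G(3) in fastforce)
    have "(\<Sum>K\<in>F. increment f K) = (\<Sum>K\<in>r. increment f K)" by (rule increment_sum_unique[OF F(1) r(2)])
    then have "q * lG - \<epsilon> \<le> p * lF" using split[of "increment f"] iR iF iG by linarith
    then have "(q - p) * lG \<le> \<epsilon> + p * (lF - lG)" by (simp add: algebra_simps)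
    also have "p * (lF - lG) \<le> \<bar>p\<bar> * (3 * \<eta>)" using lF lG lGF by (intro mult_mono) auto
    finally have 1: "(q - p) * lG \<le> 2 * \<epsilon>" using \<eta>2 by linarith
    have "(q - p) * (e / 2) \<le> (q - p) * lG" using lG \<eta>1 pq by (intro mult_left_mono) auto
    then show False using 1 \<epsilon> unfolding \<epsilon>_def by (simp add: field_simps)
  qed
  then show ?thesis using EL unfolding e_def E_def by (simp add: negligible_iff_measure)
qed

text \<open>Locally, disjoint intervals have total length less than the \<open>\<delta>\<close> that belongs to
  \<open>\<epsilon> = 1\<close>. If they all had slope above \<open>n\<close> and covered half of a set of measure
  \<open>e\<close>, then \<open>n e / 2\<close> would be at most \<open>1\<close> for every \<open>n\<close>.\<close>

lemma ac_infinitely_steep_negligible: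
  assumes ac: "ac_on a b f"
  shows "negligible (\<Inter>n::nat. steep a b f (real n))"
proof -
  define E where "E = (\<Inter>n::nat. steep a b f (real n))"
  have Eb: "E \<in> sets lebesgue" using steep_borel unfolding E_def
    by (intro sets.countable_INT) (auto simp: sets_completionI_sets)
  obtain \<delta> where \<delta>: "\<delta> > 0" "\<And>D. D division_of \<Union>D \<Longrightarrow> \<Union>D \<subseteq> {a..b} \<Longrightarrow> (\<Sum>K\<in>D. measure lebesgue K) < \<delta> \<Longrightarrow>
     (\<Sum>K\<in>D. \<bar>increment f K\<bar>) < 1" by (rule ac_onD[OF ac zero_less_one]) blast
  have "negligible (E \<inter> ball x (\<delta> / 3))" for x
  proof -
    define U where "U = ball x (\<delta> / 3) \<inter> {a<..<b}"
    have U: "open U" unfolding U_def by auto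
    have UL: "U \<in> lmeasurable" by (rule fmeasurableI2[of "ball x (\<delta> / 3)"]) (auto simp: U_def)
    have Um: "measure lebesgue U < \<delta>"
    proof -
      have "measure lebesgue U \<le> measure lebesgue (cball x (\<delta> / 3))"
        using UL unfolding U_def by (intro measure_mono_fmeasurable) auto
      also have "\<dots> = 2 * (\<delta> / 3)" using \<delta>(1) by (simp add: cball_eq_atLeastAtMost)
      finally show ?thesis using \<delta>(1) by simp
    qed
    define E' where "E' = E \<inter> ball x (\<delta> / 3)"
    have "E \<subseteq> {a<..<b}" using steep_subset unfolding E_def by fastforce
    then have E': "E' \<subseteq> U" "E' \<in> sets lebesgue" using Eb unfolding E'_def U_def by auto
    have E'L: "E' \<in> lmeasurable" using E' UL fmeasurableI2 by blast
    define e where "e = measure lebesgue E'"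
    have "e = 0"
    proof (rule ccontr)
      assume "e \<noteq> 0"
      then have e: "e / 2 > 0" unfolding e_def by (simp add: zero_less_measure_iff)
      have "real n * (e / 2) \<le> 1" for n :: nat
      proof -
        obtain F where F: "F division_of \<Union>F" "\<Union>F \<subseteq> U" "\<And>K. K \<in> F \<Longrightarrow> \<exists>u v. u < v \<and> K = {u..v} \<and> real n * (v - u) < f v - f u"
          "measure lebesgue (E' - \<Union>F) < e / 2"
        proof (rule Vitali_finite[OF U UL E' e, of "\<lambda>u v. real n * (v - u) < f v - f u"])
          show "\<exists>u v. u < x \<and> x < v \<and> v - u < d \<and> real n * (v - u) < f v - f u" if "x \<in> E'" "0 < d" for x d
          proof -
            have "x \<in> steep a b f (real n)" using that unfolding E'_def E_def by blast
            then show ?thesis using that(2) unfolding steep_def by blast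
          qed
        qed auto
        have FL: "\<Union>F \<in> lmeasurable" using division_lmeasurable F(1) .
        have "e \<le> measure lebesgue ((E' - \<Union>F) \<union> \<Union>F)" unfolding e_def
          using E'L FL by (intro measure_mono_fmeasurable) auto
        also have "\<dots> \<le> measure lebesgue (E' - \<Union>F) + measure lebesgue (\<Union>F)"
          using E'L FL by (intro measure_Un_le) auto
        finally have lF: "e / 2 \<le> measure lebesgue (\<Union>F)" using F(4) by simp
        have "measure lebesgue (\<Union>F) < \<delta>" using measure_mono_fmeasurable[OF F(2) fmeasurableD[OF FL] UL] Um by simp
        moreover have "\<Union>F \<subseteq> {a..b}" using F(2) unfolding U_def by auto
        ultimately have 1: "(\<Sum>K\<in>F. \<bar>increment f K\<bar>) < 1"
          by (intro \<delta>(2)[OF F(1)]) (simp_all add: division_measure_sum[OF F(1)])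
        have "real n * (e / 2) \<le> real n * measure lebesgue (\<Union>F)" using lF by (intro mult_left_mono) auto
        also have "\<dots> \<le> (\<Sum>K\<in>F. increment f K)"
          unfolding division_measure_sum[OF F(1), symmetric] sum_distrib_left
          by (intro sum_mono) (use F(3) in fastforce)
        also have "\<dots> \<le> (\<Sum>K\<in>F. \<bar>increment f K\<bar>)" by (intro sum_mono) auto
        finally show ?thesis using 1 by simp
      qed
      then have "real n \<le> 1 / (e / 2)" for n :: nat using e by (simp add: field_simps)
      then show False by (meson not_le reals_Archimedean2)
    qed
    then show ?thesis using E'L unfolding e_def E'_def by (simp add: negligible_iff_measure)
  qed
  then show ?thesis unfolding E_def[symmetric]
    by (subst locally_negligible_alt)
       (metis (no_types, lifting) Int_iff \<delta>(1) centre_in_ball divide_pos_pos open_ball openin_open_Int zero_less_numeral)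
qed

text \<open>An interval around \<open>x\<close> with slope at most \<open>q\<close> can be shrunk on one side until
  \<open>x\<close> is an endpoint, by continuity.\<close>

lemma not_steep_quotient_le:
  assumes x: "x \<in> {a<..<b}" and f: "continuous_on {a..b} f" and ns: "x \<notin> steep a b f q"
  shows "\<forall>\<^sub>F y in at x. (f y - f x) / (y - x) \<le> q"
proof -
  obtain d where d: "d > 0" "\<And>u v. u < x \<Longrightarrow> x < v \<Longrightarrow> a < u \<Longrightarrow> v < b \<Longrightarrow> v - u < d \<Longrightarrow> f v - f u \<le> q * (v - u)"
    using ns unfolding steep_def by fastforce
  have cont: "(f \<longlongrightarrow> f x) (at x)"
  proof -
    have "isCont f x" using f x continuous_on_interior[of "{a..b}" f x] by (simp add: interior_atLeastAtMost_real)
    then show ?thesis by (simp add: isCont_def)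
  qed
  define e where "e = min (d / 2) (min (x - a) (b - x))"
  have e: "e > 0" "e \<le> d / 2" "e \<le> x - a" "e \<le> b - x" using x d(1) unfolding e_def by (auto simp: min_def)
  have R: "f v - f x \<le> q * (v - x)" if v: "x < v" "v < x + e" for v
  proof (rule tendsto_le[of "at_left x"])
    show "((\<lambda>u. f v - f u) \<longlongrightarrow> f v - f x) (at_left x)"
      by (intro tendsto_intros tendsto_mono[OF _ cont]) (simp add: at_within_le_at)
    show "((\<lambda>u. q * (v - u)) \<longlongrightarrow> q * (v - x)) (at_left x)" by (intro tendsto_intros)
    have "\<forall>\<^sub>F u in at_left x. u \<in> {x - e<..<x}" using e(1) by (intro eventually_at_left_real) auto
    then show "\<forall>\<^sub>F u in at_left x. f v - f u \<le> q * (v - u)"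
      by (rule eventually_mono) (use v e in \<open>auto intro!: d(2)\<close>)
  qed simp
  have L: "f x - f u \<le> q * (x - u)" if u: "u < x" "x - e < u" for u
  proof (rule tendsto_le[of "at_right x"])
    show "((\<lambda>v. f v - f u) \<longlongrightarrow> f x - f u) (at_right x)"
      by (intro tendsto_intros tendsto_mono[OF _ cont]) (simp add: at_within_le_at)
    show "((\<lambda>v. q * (v - u)) \<longlongrightarrow> q * (x - u)) (at_right x)" by (intro tendsto_intros)
    have "\<forall>\<^sub>F v in at_right x. v \<in> {x<..<x + e}" using e(1) by (intro eventually_at_right_real) auto
    then show "\<forall>\<^sub>F v in at_right x. f v - f u \<le> q * (v - u)"
      by (rule eventually_mono) (use u e in \<open>auto intro!: d(2)\<close>)
  qed simp
  have "\<forall>\<^sub>F y in at x. y \<in> {x - e<..<x + e} - {x}"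
    using e(1) by (intro eventually_at_in_open) auto
  then show ?thesis
  proof (rule eventually_mono)
    fix y assume y: "y \<in> {x - e<..<x + e} - {x}"
    show "(f y - f x) / (y - x) \<le> q"
    proof (cases "x < y")
      case True
      then show ?thesis using R[of y] y by (simp add: pos_divide_le_eq)
    next
      case False
      then have "y < x" using y by auto
      then show ?thesis using L[of y] y by (simp add: neg_divide_le_eq algebra_simps)
    qed
  qed
qed

text \<open>At a point outside the exceptional sets the infimum of the slopes \<open>q\<close> that are not
  exceeded in arbitrarily short intervals is finite. It is the limit of the difference
  quotients, since a smaller lower limit would make the point flat and steep at once.\<close>

theorem ac_differentiable_ae:
  assumes ac: "ac_on a b f"
  obtains N where "negligible N" "\<And>x. x \<in> {a<..<b} - N \<Longrightarrow> \<exists>v. (f has_real_derivative v) (at x)"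
proof -
  let ?g = "\<lambda>x. - f x"
  define N where "N = (\<Union>(p, q) \<in> {(p, q). p \<in> \<rat> \<and> q \<in> \<rat> \<and> p < q}. steep a b f q \<inter> steep a b ?g (- p)) \<union>
    (\<Inter>n::nat. steep a b f (real n)) \<union> (\<Inter>n::nat. steep a b ?g (real n))"
  have ac': "ac_on a b ?g" by (rule ac_on_uminus[OF ac])
  have f: "continuous_on {a..b} f" "continuous_on {a..b} ?g"
    using ac_on_continuous ac ac' by auto
  have "negligible N" unfolding N_def
  proof (intro negligible_Un ac_infinitely_steep_negligible ac ac' negligible_countable_Union)
    have "countable ({(p, q). p \<in> \<rat> \<and> q \<in> \<rat> \<and> p < q} :: (real \<times> real) set)"
      by (rule countable_subset[of _ "\<rat> \<times> \<rat>"]) (auto intro: countable_rat)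
    then show "countable ((\<lambda>(p, q). steep a b f q \<inter> steep a b ?g (- p)) ` {(p, q). p \<in> \<rat> \<and> q \<in> \<rat> \<and> p < q})" by simp
  qed (auto intro!: ac_flat_steep_negligible[OF ac])
  moreover have "\<exists>v. (f has_real_derivative v) (at x)" if x: "x \<in> {a<..<b} - N" for x
  proof -
    define S where "S = {q. x \<notin> steep a b f q}"
    have xab: "x \<in> {a<..<b}" using x by simp
    obtain n m :: nat where n: "x \<notin> steep a b f (real n)" and m: "x \<notin> steep a b ?g (real m)"
      using x unfolding N_def by auto
    have up: "\<forall>\<^sub>F y in at x. (f y - f x) / (y - x) \<le> q" if "q \<in> S" for q
      using not_steep_quotient_le[OF xab f(1)] that unfolding S_def by auto
    have lo: "\<forall>\<^sub>F y in at x. (f y - f x) / (y - x) \<ge> p" if "x \<notin> steep a b ?g (- p)" for p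
      using not_steep_quotient_le[OF xab f(2) that]
      by (rule eventually_mono) (simp add: divide_simps split: if_splits)
    have lom: "- real m \<le> q" if "q \<in> S" for q
    proof -
      have "\<forall>\<^sub>F y in at x. - real m \<le> q"
        by (rule eventually_elim2[OF up[OF that] lo[of "- real m"]]) (use m in auto)
      then show ?thesis by simp
    qed
    define v where "v = Inf S"
    have nS: "real n \<in> S" using n unfolding S_def by simp
    have bS: "bdd_below S" by (rule bdd_belowI) (rule lom)
    have "((\<lambda>y. (f y - f x) / (y - x)) \<longlongrightarrow> v) (at x)"
    proof (rule order_tendstoI)
      fix c assume c: "v < c"
      then obtain q where "q \<in> S" "q < c" unfolding v_def using cInf_less_iff[of S c] nS bS by auto
      then show "\<forall>\<^sub>F y in at x. (f y - f x) / (y - x) < c" using up[of q] by (auto elim: eventually_mono)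
    next
      fix c assume c: "c < v"
      obtain p where p: "p \<in> \<rat>" "c < p" "p < v" using Rats_dense_in_real[OF c] by blast
      obtain q where q: "q \<in> \<rat>" "p < q" "q < v" using Rats_dense_in_real[OF p(3)] by blast
      have "q \<notin> S" using q(3) cInf_lower[OF _ bS, of q] unfolding v_def by auto
      then have "x \<in> steep a b f q" unfolding S_def by simp
      then have "x \<notin> steep a b ?g (- p)" using x p q unfolding N_def by auto
      from lo[OF this] show "\<forall>\<^sub>F y in at x. c < (f y - f x) / (y - x)"
        using p(2) by (auto elim: eventually_mono)
    qed
    then show ?thesis by (auto simp: has_field_derivative_iff)
  qed
  ultimately show ?thesis using that by blast
qed

section \<open>Absolutely continuous functions are controlled by their derivative\<close>

text \<open>The difference quotient of \<open>f\<close> over the cell of the grid \<open>a + h \<int>\<close> that contains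
  \<open>x\<close>: a step function of \<open>x\<close>, whose integrals are finite sums.\<close>

definition step_quotient :: "(real \<Rightarrow> real) \<Rightarrow> real \<Rightarrow> real \<Rightarrow> real \<Rightarrow> real" where
  "step_quotient f a h x = (f (a + h * (of_int \<lfloor>(x - a) / h\<rfloor> + 1)) - f (a + h * of_int \<lfloor>(x - a) / h\<rfloor>)) / h"

lemma borel_measurable_lebesgueI: "f \<in> borel_measurable borel \<Longrightarrow> f \<in> borel_measurable lebesgue"
  by (rule measurable_completion) simp

lemma step_quotient_measurable [measurable]: "step_quotient f a h \<in> borel_measurable borel"
proof -
  have "(\<lambda>x. (\<lambda>i. (f (a + h * (of_int i + 1)) - f (a + h * of_int i)) / h) \<lfloor>(x - a) / h\<rfloor>) \<in> borel_measurable borel"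
    by (rule measurable_compose[of "\<lambda>x. \<lfloor>(x - a) / h\<rfloor>" borel "count_space UNIV"]) auto
  then show ?thesis unfolding step_quotient_def .
qed

lemma step_quotient_eq:
  assumes "h > 0" "x \<in> {a + h * real i..<a + h * real (Suc i)}"
  shows "step_quotient f a h x = (f (a + h * real (Suc i)) - f (a + h * real i)) / h"
proof -
  have "\<lfloor>(x - a) / h\<rfloor> = int i"
    using assms by (intro floor_unique) (auto simp: field_simps)
  then show ?thesis unfolding step_quotient_def by (simp add: add.commute)
qed

lemma nn_integral_cells:
  fixes F :: "real \<Rightarrow> ennreal"
  assumes h: "h > 0" and F: "F \<in> borel_measurable lebesgue"
  shows "(\<integral>\<^sup>+ x. F x * indicator {a..<a + h * real n} x \<partial>lebesgue) =
    (\<Sum>i<n. \<integral>\<^sup>+ x. F x * indicator {a + h * real i..<a + h * real (Suc i)} x \<partial>lebesgue)"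
proof (induction n)
  case 0
  then show ?case by simp
next
  case (Suc n)
  define A where "A = {a..<a + h * real n}"
  define B where "B = {a + h * real n..<a + h * real (Suc n)}"
  have AB: "A \<in> sets lebesgue" "B \<in> sets lebesgue" unfolding A_def B_def by auto
  obtain t where t: "t = h * real n" "t \<ge> 0" using h by simp
  then have "h * real (Suc n) = t + h" by (simp add: algebra_simps)
  then have "indicator {a..<a + h * real (Suc n)} x = (indicator A x + indicator B x :: ennreal)" for x
    using h t(2) unfolding A_def B_def indicator_def t(1)[symmetric] by auto
  then have "(\<integral>\<^sup>+ x. F x * indicator {a..<a + h * real (Suc n)} x \<partial>lebesgue) =
    (\<integral>\<^sup>+ x. F x * indicator A x + F x * indicator B x \<partial>lebesgue)"
    by (simp add: distrib_left)
  also have "\<dots> = (\<integral>\<^sup>+ x. F x * indicator A x \<partial>lebesgue) + (\<integral>\<^sup>+ x. F x * indicator B x \<partial>lebesgue)"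
    using F AB by (intro nn_integral_add) auto
  finally show ?case using Suc.IH by (simp add: A_def B_def)
qed

lemma nn_integral_step_quotient:
  fixes \<phi> :: "real \<Rightarrow> ennreal"
  assumes h: "h > 0" and [measurable]: "\<phi> \<in> borel_measurable borel"
  shows "(\<integral>\<^sup>+ x. \<phi> (step_quotient f a h x) * indicator {a..<a + h * real n} x \<partial>lebesgue) =
    (\<Sum>i<n. ennreal h * \<phi> ((f (a + h * real (Suc i)) - f (a + h * real i)) / h))"
proof -
  have "(\<integral>\<^sup>+ x. \<phi> (step_quotient f a h x) * indicator {a + h * real i..<a + h * real (Suc i)} x \<partial>lebesgue) =
    ennreal h * \<phi> ((f (a + h * real (Suc i)) - f (a + h * real i)) / h)" for i
  proof -
    define B where "B = {a + h * real i..<a + h * real (Suc i)}"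
    define q where "q = (f (a + h * real (Suc i)) - f (a + h * real i)) / h"
    have "(\<integral>\<^sup>+ x. \<phi> (step_quotient f a h x) * indicator B x \<partial>lebesgue) = (\<integral>\<^sup>+ x. \<phi> q * indicator B x \<partial>lebesgue)"
      by (intro nn_integral_cong) (auto simp: indicator_def q_def B_def step_quotient_eq[OF h])
    also have "\<dots> = \<phi> q * emeasure lebesgue B" by (intro nn_integral_cmult_indicator) (simp add: B_def)
    also have "emeasure lebesgue B = ennreal h" unfolding B_def using h by (simp add: algebra_simps)
    finally show ?thesis by (simp add: B_def q_def mult.commute)
  qed
  moreover have "(\<lambda>x. \<phi> (step_quotient f a h x)) \<in> borel_measurable lebesgue"
    by (rule borel_measurable_lebesgueI) simp
  ultimately show ?thesis by (simp add: nn_integral_cells[OF h])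
qed

lemma step_quotient_tendsto:
  assumes f: "(f has_real_derivative v) (at x)" and h: "\<And>n. h n > 0" "h \<longlonglongrightarrow> 0"
  shows "(\<lambda>n. step_quotient f a (h n) x) \<longlonglongrightarrow> v"
proof (rule tendstoI)
  fix e :: real assume e: "e > 0"
  have "(f has_derivative (\<lambda>y. v * y)) (at x)" using f by (simp add: has_field_derivative_def)
  then obtain d where d: "d > 0" "\<And>y. \<bar>y - x\<bar> < d \<Longrightarrow> \<bar>f y - f x - v * (y - x)\<bar> \<le> e / 2 * \<bar>y - x\<bar>"
    unfolding has_derivative_at_alt using e by (metis half_gt_zero real_norm_def)
  have "\<forall>\<^sub>F n in sequentially. h n < d" using h(2) d(1) by (simp add: order_tendstoD)
  then show "\<forall>\<^sub>F n in sequentially. dist (step_quotient f a (h n) x) v < e"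
  proof (rule eventually_mono)
    fix n assume hd: "h n < d"
    define H where "H = h n"
    have H: "H > 0" "H < d" using h(1) hd unfolding H_def by auto
    define l where "l = a + H * of_int \<lfloor>(x - a) / H\<rfloor>"
    have l: "l \<le> x" "x < l + H"
    proof -
      have "H * of_int \<lfloor>(x - a) / H\<rfloor> \<le> H * ((x - a) / H)" "H * ((x - a) / H) < H * (of_int \<lfloor>(x - a) / H\<rfloor> + 1)"
        using H by (intro mult_left_mono mult_strict_left_mono; linarith)+
      moreover have "H * ((x - a) / H) = x - a" using H by simp
      ultimately show "l \<le> x" "x < l + H" using H unfolding l_def by (simp_all add: distrib_left)
    qed
    have s: "step_quotient f a H x = (f (l + H) - f l) / H"
      unfolding step_quotient_def l_def by (simp add: algebra_simps)
    have "\<bar>f (l + H) - f x - v * (l + H - x)\<bar> \<le> e / 2 * \<bar>l + H - x\<bar>" "\<bar>f l - f x - v * (l - x)\<bar> \<le> e / 2 * \<bar>l - x\<bar>"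
      using l H by (intro d(2); auto)+
    moreover have "f (l + H) - f l - v * H = (f (l + H) - f x - v * (l + H - x)) - (f l - f x - v * (l - x))"
      by (simp add: algebra_simps)
    ultimately have "\<bar>f (l + H) - f l - v * H\<bar> \<le> e / 2 * \<bar>l + H - x\<bar> + e / 2 * \<bar>l - x\<bar>"
      by linarith
    then have "\<bar>f (l + H) - f l - v * H\<bar> \<le> e / 2 * (l + H - x) + e / 2 * (x - l)"
      using l by simp
    also have "\<dots> = e / 2 * H" unfolding distrib_left[symmetric] by simp
    finally have "\<bar>(f (l + H) - f l) / H - v\<bar> \<le> e / 2"
      using H by (simp add: abs_le_iff field_simps)
    then show "dist (step_quotient f a (h n) x) v < e" using e s unfolding H_def dist_real_def by simp
  qed
qed

lemma cells_division:
  fixes h a :: real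
  assumes h: "h > 0" and J: "finite J"
  defines "c \<equiv> \<lambda>i::nat. {a + h * real i..a + h * real (Suc i)}"
  shows "c ` J division_of \<Union>(c ` J)" "inj c"
proof -
  have ne: "c i \<noteq> {}" for i unfolding c_def using h by simp
  have I: "Inf (c i) = a + h * real i" for i unfolding c_def using h by simp
  show inj: "inj c" using I h by (metis (mono_tags, lifting) add_left_cancel injI less_irrefl mult_left_cancel of_nat_eq_iff)
  show "c ` J division_of \<Union>(c ` J)"
  proof (rule division_ofI)
    fix K L assume "K \<in> c ` J" "L \<in> c ` J" "K \<noteq> L"
    then obtain i j where ij: "K = c i" "L = c j" "i \<noteq> j" by auto
    have *: "interior (c i) \<inter> interior (c j) = {}" if "i < j" for i j
    proof -
      have "h * real (Suc i) \<le> h * real j" using that h by (intro mult_left_mono) auto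
      then show ?thesis unfolding c_def interior_atLeastAtMost_real by auto
    qed
    show "interior K \<inter> interior L = {}" using *[of i j] *[of j i] ij by (cases "i < j") auto
  qed (use J ne in \<open>auto simp: c_def\<close>)
qed

text \<open>The quotients over equal cells are uniformly integrable: the cells where the quotient
  exceeds \<open>R = 2 \<epsilon> / \<delta>\<close> have total length below \<open>\<delta>\<close>, so the increments over them sum to less
  than \<open>\<epsilon>\<close>, and elsewhere truncation at \<open>R\<close> changes nothing.\<close>

lemma ac_truncation:
  assumes ac: "ac_on a b f" and \<epsilon>: "\<epsilon> > 0" and ab: "a < b"
  obtains R where "R > 0" "\<forall>\<^sub>F n in sequentially. \<bar>f b - f a\<bar> \<le>
     (\<Sum>i<n. (b - a) / n * min \<bar>(f (a + (b - a) / n * real (Suc i)) - f (a + (b - a) / n * real i)) / ((b - a) / n)\<bar> R) + \<epsilon>"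
proof -
  obtain \<delta> where \<delta>: "\<delta> > 0" "\<And>D. D division_of \<Union>D \<Longrightarrow> \<Union>D \<subseteq> {a..b} \<Longrightarrow> (\<Sum>K\<in>D. measure lebesgue K) < \<delta> \<Longrightarrow>
     (\<Sum>K\<in>D. \<bar>increment f K\<bar>) < \<epsilon>" by (rule ac_onD[OF ac \<epsilon>]) blast
  define R where "R = 2 * \<epsilon> / \<delta>"
  have R: "R > 0" unfolding R_def using \<epsilon> \<delta> by simp
  have "(\<lambda>n. (b - a) / real n) \<longlonglongrightarrow> 0" by real_asymp
  then have "\<forall>\<^sub>F n in sequentially. (b - a) / real n < \<delta> / 2" using \<delta>(1) by (intro order_tendstoD(2)) auto
  moreover have "\<forall>\<^sub>F n in sequentially. n > 0" by (rule eventually_gt_at_top)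
  ultimately have "\<forall>\<^sub>F n in sequentially. \<bar>f b - f a\<bar> \<le>
     (\<Sum>i<n. (b - a) / n * min \<bar>(f (a + (b - a) / n * real (Suc i)) - f (a + (b - a) / n * real i)) / ((b - a) / n)\<bar> R) + \<epsilon>"
  proof eventually_elim
    case (elim n)
    define h where "h = (b - a) / n"
    have h: "h > 0" "h < \<delta> / 2" "h * real n = b - a" using elim ab unfolding h_def by auto
    define \<Delta> where "\<Delta> = (\<lambda>i. f (a + h * real (Suc i)) - f (a + h * real i))"
    define c where "c = (\<lambda>i::nat. {a + h * real i..a + h * real (Suc i)})"
    have small: "(\<Sum>i\<in>J. \<bar>\<Delta> i\<bar>) < \<epsilon>" if J: "J \<subseteq> {..<n}" "h * real (card J) < \<delta>" for J
    proof -
      have fJ: "finite J" using J finite_subset by blast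
      note cd = cells_division[OF h(1) fJ, of a, folded c_def]
      have inj: "inj_on c J" using cd(2) inj_on_subset by blast
      have "\<Union>(c ` J) \<subseteq> {a..b}"
      proof -
        have "c i \<subseteq> {a..b}" if "i \<in> J" for i
        proof -
          have "h * real (Suc i) \<le> h * real n" using that J(1) h by (intro mult_left_mono) auto
          moreover have "0 \<le> h * real i" using h by simp
          ultimately show ?thesis using h unfolding c_def by auto
        qed
        then show ?thesis by blast
      qed
      moreover have "(\<Sum>K\<in>c ` J. measure lebesgue K) < \<delta>"
      proof -
        have "(\<Sum>K\<in>c ` J. measure lebesgue K) = (\<Sum>i\<in>J. h)"
          unfolding sum.reindex[OF inj] by (intro sum.cong) (use h in \<open>auto simp: c_def algebra_simps\<close>)
        then show ?thesis using J(2) by (simp add: mult.commute)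
      qed
      ultimately have "(\<Sum>K\<in>c ` J. \<bar>increment f K\<bar>) < \<epsilon>" by (rule \<delta>(2)[OF cd(1)])
      moreover have "(\<Sum>K\<in>c ` J. \<bar>increment f K\<bar>) = (\<Sum>i\<in>J. \<bar>\<Delta> i\<bar>)"
        unfolding sum.reindex[OF inj] by (intro sum.cong) (use h in \<open>auto simp: c_def \<Delta>_def algebra_simps\<close>)
      ultimately show ?thesis by simp
    qed
    define J where "J = {i. i < n \<and> \<bar>\<Delta> i / h\<bar> > R}"
    \<comment> \<open>Otherwise some of these cells would have total length in \<open>[\<delta>/2, \<delta>)\<close>, and their increments
      would sum to at least \<open>R \<delta> / 2 = \<epsilon>\<close>.\<close>
    have "h * real (card J) < \<delta>"
    proof (rule ccontr)
      assume "\<not> h * real (card J) < \<delta>"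
      then have big: "real (card J) \<ge> \<delta> / h" using h by (simp add: field_simps)
      define m where "m = nat \<lceil>\<delta> / (2 * h)\<rceil>"
      have m: "real m \<ge> \<delta> / (2 * h)" "real m < \<delta> / (2 * h) + 1" using \<delta>(1) h(1) unfolding m_def
        using ceiling_correct[of "\<delta> / (2 * h)"] by (auto simp: of_nat_nat)
      have hm: "h * real m < \<delta>" "h * real m \<ge> \<delta> / 2"
      proof -
        have "h * real m < h * (\<delta> / (2 * h) + 1)" using m(2) h(1) by simp
        also have "\<dots> = \<delta> / 2 + h" using h(1) by (simp add: field_simps)
        finally show "h * real m < \<delta>" using h(2) by simp
        have "h * real m \<ge> h * (\<delta> / (2 * h))" using m(1) h(1) by (intro mult_left_mono) auto
        then show "h * real m \<ge> \<delta> / 2" using h(1) by simp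
      qed
      have "real m < \<delta> / h" using hm(1) h(1) by (simp add: field_simps)
      then have "m \<le> card J" using big by linarith
      then obtain J' where J': "J' \<subseteq> J" "card J' = m" by (meson obtain_subset_with_card_n)
      have "(\<Sum>i\<in>J'. \<bar>\<Delta> i\<bar>) < \<epsilon>" by (rule small) (use J' hm in \<open>auto simp: J_def\<close>)
      moreover have "(\<Sum>i\<in>J'. h * R) \<le> (\<Sum>i\<in>J'. \<bar>\<Delta> i\<bar>)"
        by (intro sum_mono) (use J'(1) h(1) in \<open>auto simp: J_def field_simps\<close>)
      moreover have "(\<Sum>i\<in>J'. h * R) \<ge> \<epsilon>"
      proof -
        have "(\<Sum>i\<in>J'. h * R) = (h * real m) * R" using J'(2) by simp
        also have "\<dots> \<ge> (\<delta> / 2) * R" using hm R by (intro mult_right_mono) auto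
        finally show ?thesis unfolding R_def using \<delta>(1) by simp
      qed
      ultimately show False by linarith
    qed
    then have sJ: "(\<Sum>i\<in>J. \<bar>\<Delta> i\<bar>) < \<epsilon>" by (intro small) (auto simp: J_def)
    have "f b - f a = (\<Sum>i<n. \<Delta> i)"
      unfolding \<Delta>_def using h(3) by (subst sum_lessThan_telescope[of "\<lambda>i. f (a + h * real i)"]) simp
    then have "\<bar>f b - f a\<bar> \<le> (\<Sum>i<n. \<bar>\<Delta> i\<bar>)" by (simp add: sum_abs)
    also have "\<dots> \<le> (\<Sum>i<n. h * min \<bar>\<Delta> i / h\<bar> R + (if i \<in> J then \<bar>\<Delta> i\<bar> else 0))"
    proof (intro sum_mono)
      fix i assume i: "i \<in> {..<n}"
      show "\<bar>\<Delta> i\<bar> \<le> h * min \<bar>\<Delta> i / h\<bar> R + (if i \<in> J then \<bar>\<Delta> i\<bar> else 0)"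
        using i h(1) R by (auto simp: J_def min_def)
    qed
    also have "\<dots> = (\<Sum>i<n. h * min \<bar>\<Delta> i / h\<bar> R) + (\<Sum>i\<in>J. \<bar>\<Delta> i\<bar>)"
      unfolding sum.distrib by (subst sum.inter_restrict[symmetric]) (auto intro!: sum.cong simp: J_def)
    finally show ?case using sJ unfolding \<Delta>_def h_def by linarith
  qed
  then show ?thesis using that R by blast
qed

text \<open>Truncated quotients over finer and finer cells converge by dominated convergence to the
  truncated derivative, and the truncation costs at most \<open>\<epsilon>\<close>.\<close>

theorem ac_increment_le_nn_integral:
  assumes ac: "ac_on a b f" and ab: "a < b" and g: "g \<in> borel_measurable borel"
    and der: "AE x in lebesgue. x \<in> {a<..<b} \<longrightarrow> (f has_real_derivative g x) (at x)"
  shows "ennreal \<bar>f b - f a\<bar> \<le> (\<integral>\<^sup>+ x. ennreal \<bar>g x\<bar> * indicator {a..b} x \<partial>lebesgue)"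
proof (rule ennreal_le_epsilon)
  fix \<epsilon> :: real assume \<epsilon>: "0 < \<epsilon>"
  obtain R where R: "R > 0" "\<forall>\<^sub>F n in sequentially. \<bar>f b - f a\<bar> \<le>
     (\<Sum>i<n. (b - a) / n * min \<bar>(f (a + (b - a) / n * real (Suc i)) - f (a + (b - a) / n * real i)) / ((b - a) / n)\<bar> R) + \<epsilon>"
    by (rule ac_truncation[OF ac \<epsilon> ab])
  let ?u = "\<lambda>n x. ennreal (min \<bar>step_quotient f a ((b - a) / n) x\<bar> R) * indicator {a..<b} x"
  let ?w = "\<lambda>x. ennreal (min \<bar>g x\<bar> R) * indicator {a..<b} x"
  have m: "(\<lambda>x. ennreal (min \<bar>step_quotient f a ((b - a) / real (n::nat)) x\<bar> R) * indicator {a..<b} x) \<in> borel_measurable lebesgue" for n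
    by (rule borel_measurable_lebesgueI) simp
  have lim: "(\<lambda>n. \<integral>\<^sup>+ x. ?u (Suc n) x \<partial>lebesgue) \<longlonglongrightarrow> (\<integral>\<^sup>+ x. ?w x \<partial>lebesgue)"
  proof (rule nn_integral_dominated_convergence[where w = "\<lambda>x. ennreal R * indicator {a..<b} x"])
    show "?u (Suc n) \<in> borel_measurable lebesgue" for n by (rule m)
    show "?w \<in> borel_measurable lebesgue" by (rule borel_measurable_lebesgueI) (use g in simp)
    show "(\<lambda>x. ennreal R * indicator {a..<b} x) \<in> borel_measurable lebesgue" by (rule borel_measurable_lebesgueI) simp
    show "AE x in lebesgue. ?u (Suc n) x \<le> ennreal R * indicator {a..<b} x" for n
      by (intro AE_I2 mult_right_mono ennreal_leI) auto
    have "(\<integral>\<^sup>+ x. ennreal R * indicator {a..<b} x \<partial>lebesgue) = ennreal R * ennreal (b - a)"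
      using ab by (simp add: nn_integral_cmult_indicator)
    then show "(\<integral>\<^sup>+ x. ennreal R * indicator {a..<b} x \<partial>lebesgue) < \<infinity>" by (simp add: ennreal_mult_less_top)
    have "AE x in lebesgue. x \<noteq> a" by (metis AE_completion AE_lborel_singleton)
    then show "AE x in lebesgue. (\<lambda>n. ?u (Suc n) x) \<longlonglongrightarrow> ?w x"
      using der
    proof eventually_elim
      case (elim x)
      show ?case
      proof (cases "x \<in> {a<..<b}")
        case True
        then have "(\<lambda>n. step_quotient f a ((b - a) / real (Suc n)) x) \<longlonglongrightarrow> g x"
          using elim ab by (intro step_quotient_tendsto) (auto, real_asymp)
        then have "(\<lambda>n. ennreal (min \<bar>step_quotient f a ((b - a) / real (Suc n)) x\<bar> R)) \<longlonglongrightarrow> ennreal (min \<bar>g x\<bar> R)"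
          by (intro tendsto_intros)
        then show ?thesis using True by (simp add: indicator_def)
      next
        case False
        then have "x \<notin> {a..<b}" using elim by auto
        then show ?thesis by simp
      qed
    qed
  qed
  have ev: "\<forall>\<^sub>F n in sequentially. ennreal \<bar>f b - f a\<bar> \<le> (\<integral>\<^sup>+ x. ?u (Suc n) x \<partial>lebesgue) + ennreal \<epsilon>"
  proof (rule eventually_mono)
    show "\<forall>\<^sub>F n in sequentially. \<bar>f b - f a\<bar> \<le>
     (\<Sum>i<Suc n. (b - a) / Suc n * min \<bar>(f (a + (b - a) / Suc n * real (Suc i)) - f (a + (b - a) / Suc n * real i)) / ((b - a) / Suc n)\<bar> R) + \<epsilon>"
      using R(2) by (subst eventually_sequentially_Suc)
    fix n
    define h where "h = (b - a) / Suc n"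
    have h: "h > 0" "a + h * real (Suc n) = b" using ab unfolding h_def by auto
    assume "\<bar>f b - f a\<bar> \<le>
     (\<Sum>i<Suc n. (b - a) / Suc n * min \<bar>(f (a + (b - a) / Suc n * real (Suc i)) - f (a + (b - a) / Suc n * real i)) / ((b - a) / Suc n)\<bar> R) + \<epsilon>"
    then have "ennreal \<bar>f b - f a\<bar> \<le> ennreal ((\<Sum>i<Suc n. h * min \<bar>(f (a + h * real (Suc i)) - f (a + h * real i)) / h\<bar> R) + \<epsilon>)"
      unfolding h_def by (rule ennreal_leI)
    also have "\<dots> = ennreal (\<Sum>i<Suc n. h * min \<bar>(f (a + h * real (Suc i)) - f (a + h * real i)) / h\<bar> R) + ennreal \<epsilon>"
      using h R \<epsilon> by (intro ennreal_plus sum_nonneg) auto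
    also have "ennreal (\<Sum>i<Suc n. h * min \<bar>(f (a + h * real (Suc i)) - f (a + h * real i)) / h\<bar> R) =
      (\<Sum>i<Suc n. ennreal h * ennreal (min \<bar>(f (a + h * real (Suc i)) - f (a + h * real i)) / h\<bar> R))"
      using h R by (subst sum_ennreal[symmetric]) (auto simp: ennreal_mult)
    also have "\<dots> = (\<integral>\<^sup>+ x. ?u (Suc n) x \<partial>lebesgue)"
      using nn_integral_step_quotient[OF h(1), of "\<lambda>q. ennreal (min \<bar>q\<bar> R)" f a "Suc n"] h(2) unfolding h_def by simp
    finally show "ennreal \<bar>f b - f a\<bar> \<le> (\<integral>\<^sup>+ x. ?u (Suc n) x \<partial>lebesgue) + ennreal \<epsilon>" .
  qed
  have "ennreal \<bar>f b - f a\<bar> \<le> (\<integral>\<^sup>+ x. ?w x \<partial>lebesgue) + ennreal \<epsilon>"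
    by (rule tendsto_le[OF _ tendsto_add[OF lim tendsto_const] tendsto_const ev]) simp
  also have "(\<integral>\<^sup>+ x. ?w x \<partial>lebesgue) \<le> (\<integral>\<^sup>+ x. ennreal \<bar>g x\<bar> * indicator {a..b} x \<partial>lebesgue)"
    by (intro nn_integral_mono mult_mono ennreal_leI) (auto simp: indicator_def)
  finally show "ennreal \<bar>f b - f a\<bar> \<le> (\<integral>\<^sup>+ x. ennreal \<bar>g x\<bar> * indicator {a..b} x \<partial>lebesgue) + ennreal \<epsilon>"
    by (simp add: add_mono)
qed

theorem ac_derivative:
  assumes ac: "ac_on a b f" and ab: "a < b"
  obtains g where "g \<in> borel_measurable borel"
    "AE x in lebesgue. x \<in> {a<..<b} \<longrightarrow> (f has_real_derivative g x) (at x)"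
    "\<And>c d. a \<le> c \<Longrightarrow> c < d \<Longrightarrow> d \<le> b \<Longrightarrow> ennreal \<bar>f d - f c\<bar> \<le> (\<integral>\<^sup>+ x. ennreal \<bar>g x\<bar> * indicator {c..d} x \<partial>lebesgue)"
proof -
  define g where "g = (\<lambda>x. lim (\<lambda>n. step_quotient f a (1 / real (Suc n)) x))"
  have g: "g \<in> borel_measurable borel" unfolding g_def by measurable
  obtain N where N: "negligible N" "\<And>x. x \<in> {a<..<b} - N \<Longrightarrow> \<exists>v. (f has_real_derivative v) (at x)"
    by (rule ac_differentiable_ae[OF ac]) blast
  have "(f has_real_derivative g x) (at x)" if x: "x \<in> {a<..<b}" "x \<notin> N" for x
  proof -
    obtain v where v: "(f has_real_derivative v) (at x)" using N(2) x by blast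
    have "(\<lambda>n. step_quotient f a (1 / real (Suc n)) x) \<longlonglongrightarrow> v"
      by (rule step_quotient_tendsto[OF v]) (auto, real_asymp)
    then show ?thesis using v unfolding g_def by (simp add: limI)
  qed
  then have der: "AE x in lebesgue. x \<in> {a<..<b} \<longrightarrow> (f has_real_derivative g x) (at x)"
    using N(1) by (intro AE_I'[of N]) (auto simp: negligible_iff_null_sets)
  show ?thesis
  proof (rule that[OF g der])
    fix c d assume cd: "a \<le> c" "c < d" "d \<le> b"
    show "ennreal \<bar>f d - f c\<bar> \<le> (\<integral>\<^sup>+ x. ennreal \<bar>g x\<bar> * indicator {c..d} x \<partial>lebesgue)"
      by (rule ac_increment_le_nn_integral[OF ac_on_subset[OF ac cd(1,3)] cd(2) g])
         (use der cd in \<open>auto elim!: eventually_mono\<close>)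
  qed
qed

section \<open>The circle and real lifts of its paths\<close>

lemma circle_of_lift_diff:
  obtains n :: int where "frac a - frac b = a - b - of_int n"
proof
  show "frac a - frac b = a - b - of_int (\<lfloor>a\<rfloor> - \<lfloor>b\<rfloor>)" by (simp add: frac_def)
qed

lemma dist_circle_of_le: "dist (circle_of a) (circle_of b) \<le> \<bar>a - b\<bar>"
proof (cases "\<bar>a - b\<bar> \<ge> 1 / 2")
  case True
  then show ?thesis using dist_circle_le[of "circle_of a" "circle_of b"] by linarith
next
  case False
  obtain n where n: "frac a - frac b = a - b - of_int n" by (rule circle_of_lift_diff)
  have f: "0 \<le> frac a" "frac a < 1" "0 \<le> frac b" "frac b < 1" by (auto simp: frac_lt_1)
  then have "of_int n < (2::real)" "of_int n > (-2::real)" using n False by linarith+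
  then have "n \<in> {-1, 0, 1}" by auto
  then show ?thesis using n False f unfolding dist_circle_def coord_circle_of by auto
qed

lemma dist_circle_of_eq:
  assumes "\<bar>a - b\<bar> \<le> 1 / 2"
  shows "dist (circle_of a) (circle_of b) = \<bar>a - b\<bar>"
proof -
  obtain n where n: "frac a - frac b = a - b - of_int n" by (rule circle_of_lift_diff)
  have f: "0 \<le> frac a" "frac a < 1" "0 \<le> frac b" "frac b < 1" by (auto simp: frac_lt_1)
  then have "of_int n < (2::real)" "of_int n > (-2::real)" using n assms by linarith+
  then have "n = -1 \<or> n = 0 \<or> n = 1" by auto
  then have "frac a - frac b = a - b + 1 \<or> frac a - frac b = a - b \<or> frac a - frac b = a - b - 1"
    using n by auto
  moreover have "\<bar>frac a - frac b\<bar> < 1" using f by linarith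
  moreover have "min \<bar>p\<bar> (1 - \<bar>p\<bar>) = \<bar>q\<bar>" if "p = q + 1 \<or> p = q \<or> p = q - 1" "\<bar>p\<bar> < 1" "\<bar>q\<bar> \<le> 1 / 2" for p q :: real
    using that by (elim disjE) (auto simp: min_def abs_if split: if_splits)
  ultimately show ?thesis using assms unfolding dist_circle_def coord_circle_of by blast
qed

text \<open>The signed length of the shorter arc from \<open>x\<close> to \<open>y\<close>; antipodal points are joined by
  \<open>- 1 / 2\<close>.\<close>

definition signed_arc :: "circle \<Rightarrow> circle \<Rightarrow> real" where
  "signed_arc x y = frac (coord y - coord x + 1 / 2) - 1 / 2"

lemma abs_signed_arc_le: "\<bar>signed_arc x y\<bar> \<le> 1 / 2"
  unfolding signed_arc_def using frac_ge_0[of "coord y - coord x + 1 / 2"] frac_lt_1[of "coord y - coord x + 1 / 2"] by linarith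

lemma circle_of_add_signed_arc:
  assumes "circle_of a = x"
  shows "circle_of (a + signed_arc x y) = y"
proof -
  have "frac a = coord x" using assms by (metis coord_circle_of)
  then have "a + signed_arc x y - coord y = of_int (\<lfloor>a\<rfloor> - \<lfloor>coord y - coord x + 1 / 2\<rfloor>)"
    unfolding signed_arc_def by (auto simp: frac_def)
  then have "circle_of (a + signed_arc x y) = circle_of (coord y)" unfolding circle_of_eq_iff by (metis Ints_of_int)
  then show ?thesis by simp
qed

lemma abs_signed_arc_eq_dist: "\<bar>signed_arc x y\<bar> = dist x y"
proof -
  have "dist (circle_of (coord x + signed_arc x y)) (circle_of (coord x)) = \<bar>signed_arc x y\<bar>"
    using dist_circle_of_eq[of "coord x + signed_arc x y" "coord x"] abs_signed_arc_le[of x y] by simp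
  then show ?thesis using circle_of_add_signed_arc[of "coord x" x y] by (simp add: dist_commute)
qed

text \<open>Both ways from \<open>x\<close> to \<open>y'\<close>, through \<open>y\<close> and through \<open>x'\<close>, have the same endpoint, so their
  signed lengths differ by an integer; all arcs being short, this integer is zero.\<close>

lemma signed_arc_perturb:
  assumes "dist x y < 1 / 4" "dist x' y' < 1 / 4" "dist x x' + dist y y' < 1 / 2"
  shows "\<bar>signed_arc x' y' - signed_arc x y\<bar> \<le> dist x x' + dist y y'"
proof -
  have 1: "circle_of (coord x + signed_arc x y + signed_arc y y') = y'"
    by (intro circle_of_add_signed_arc) simp
  have 2: "circle_of (coord x + signed_arc x x' + signed_arc x' y') = y'"
    by (intro circle_of_add_signed_arc) simp
  have "(coord x + signed_arc x y + signed_arc y y') - (coord x + signed_arc x x' + signed_arc x' y') \<in> \<int>"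
    using 1 2 circle_of_eq_iff by metis
  then obtain n where n: "signed_arc x y + signed_arc y y' - signed_arc x x' - signed_arc x' y' = of_int n"
    by (auto elim!: Ints_cases simp: algebra_simps)
  have "\<bar>signed_arc x y\<bar> < 1 / 4" "\<bar>signed_arc x' y'\<bar> < 1 / 4" "\<bar>signed_arc x x'\<bar> + \<bar>signed_arc y y'\<bar> < 1 / 2"
    using assms unfolding abs_signed_arc_eq_dist by auto
  then have "\<bar>of_int n :: real\<bar> < 1" unfolding n[symmetric] by linarith
  then have "n = 0" by simp
  then show ?thesis using n abs_signed_arc_eq_dist[of x x'] abs_signed_arc_eq_dist[of y y'] by linarith
qed

lemma signed_arc_continuous_on:
  fixes u v :: "real \<Rightarrow> circle"
  assumes u: "continuous_on S u" and v: "continuous_on S v" and d: "\<And>s. s \<in> S \<Longrightarrow> dist (u s) (v s) < 1 / 4"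
  shows "continuous_on S (\<lambda>s. signed_arc (u s) (v s))"
  unfolding continuous_on_iff
proof (intro ballI allI impI)
  fix x and e :: real assume x: "x \<in> S" and e: "e > 0"
  define c where "c = min (e / 2) (1 / 4)"
  have c: "c > 0" "c + c \<le> e" "c + c \<le> 1 / 2" using e unfolding c_def by auto
  obtain d1 where d1: "d1 > 0" "\<And>y. y \<in> S \<Longrightarrow> dist y x < d1 \<Longrightarrow> dist (u y) (u x) < c"
    using u x c(1) unfolding continuous_on_iff by metis
  obtain d2 where d2: "d2 > 0" "\<And>y. y \<in> S \<Longrightarrow> dist y x < d2 \<Longrightarrow> dist (v y) (v x) < c"
    using v x c(1) unfolding continuous_on_iff by metis
  show "\<exists>d>0. \<forall>y\<in>S. dist y x < d \<longrightarrow> dist (signed_arc (u y) (v y)) (signed_arc (u x) (v x)) < e"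
  proof (intro exI[of _ "min d1 d2"] conjI ballI impI)
    fix y assume y: "y \<in> S" "dist y x < min d1 d2"
    then have *: "dist (u x) (u y) < c" "dist (v x) (v y) < c" using d1(2)[of y] d2(2)[of y] by (auto simp: dist_commute)
    then have "\<bar>signed_arc (u y) (v y) - signed_arc (u x) (v x)\<bar> \<le> dist (u x) (u y) + dist (v x) (v y)"
      using c by (intro signed_arc_perturb d x y(1)) auto
    then show "dist (signed_arc (u y) (v y)) (signed_arc (u x) (v x)) < e" using * c unfolding dist_real_def by linarith
  qed (use d1 d2 in auto)
qed

text \<open>Stop the path at the times \<open>i T / N\<close>. For large \<open>N\<close> the paths stopped at consecutive times
  stay close to each other, so the signed arcs between them are continuous, and they sum to a
  lift.\<close>

theorem continuous_lift:
  fixes \<gamma> :: "real \<Rightarrow> circle"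
  assumes T: "T > 0" and \<gamma>: "continuous_on {0..T} \<gamma>"
  obtains \<theta> where "continuous_on {0..T} \<theta>" "\<And>t. t \<in> {0..T} \<Longrightarrow> \<gamma> t = circle_of (\<theta> t)"
proof -
  have "uniformly_continuous_on {0..T} \<gamma>" using \<gamma> by (intro compact_uniformly_continuous) auto
  then obtain d where d: "d > 0" "\<And>s t. s \<in> {0..T} \<Longrightarrow> t \<in> {0..T} \<Longrightarrow> dist s t < d \<Longrightarrow> dist (\<gamma> s) (\<gamma> t) < 1 / 4"
    unfolding uniformly_continuous_on_def by (metis dist_commute zero_less_divide_1_iff zero_less_numeral)
  obtain N :: nat where N: "T / d < real N" "N > 0" by (metis reals_Archimedean2 gr0I T d(1) divide_pos_pos not_less_iff_gr_or_eq of_nat_0 order.strict_trans)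
  define x where "x = (\<lambda>i::nat. \<lambda>t. \<gamma> (min t (real i * T / real N)))"
  define \<theta> where "\<theta> = (\<lambda>t. coord (\<gamma> 0) + (\<Sum>i<N. signed_arc (x i t) (x (Suc i) t)))"
  have in01: "min t (real i * T / real N) \<in> {0..T}" if "t \<in> {0..T}" for i t using that T by auto
  have xc: "continuous_on {0..T} (x i)" for i
    unfolding x_def by (rule continuous_on_compose2[OF \<gamma>]) (use in01 in \<open>auto intro!: continuous_intros\<close>)
  have xd: "dist (x i t) (x (Suc i) t) < 1 / 4" if t: "t \<in> {0..T}" for i t
    unfolding x_def
  proof (rule d(2)[OF in01[OF t] in01[OF t]])
    obtain A B where AB: "A = real i * T / real N" "B = T / real N" by simp
    have S: "real (Suc i) * T / real N = A + B" unfolding AB by (simp add: add_divide_distrib distrib_right)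
    have "B < d" "B > 0" using N d(1) T unfolding AB by (simp_all add: field_simps)
    then show "dist (min t (real i * T / real N)) (min t (real (Suc i) * T / real N)) < d"
      unfolding dist_real_def S AB(1)[symmetric] using d(1) by (auto simp: min_def)
  qed
  have "continuous_on {0..T} \<theta>" unfolding \<theta>_def
    by (intro continuous_intros signed_arc_continuous_on xc xd)
  moreover have "\<gamma> t = circle_of (\<theta> t)" if t: "t \<in> {0..T}" for t
  proof -
    have "circle_of (coord (\<gamma> 0) + (\<Sum>i<n. signed_arc (x i t) (x (Suc i) t))) = x n t" for n
    proof (induction n)
      case 0
      then show ?case using t unfolding x_def by simp
    next
      case (Suc n)
      then show ?case using circle_of_add_signed_arc[OF Suc] by (simp add: add.assoc)
    qed
    from this[of N] show ?thesis unfolding \<theta>_def x_def using N t by simp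
  qed
  ultimately show ?thesis using that by blast
qed

section \<open>The Lagrangian as a Legendre transform\<close>

text \<open>The logarithmic moment generating function, at time one, of the walk on the integers that
  jumps to each neighbour at rate one. The Lagrangian is its Legendre transform:
  \<open>lagrangian_young\<close> is the Young inequality and \<open>lagrangian_attained\<close> its equality case.\<close>

definition cumulant :: "real \<Rightarrow> real" where "cumulant \<alpha> = 2 * cosh \<alpha> - 2"

lemma cumulant_nonneg: "0 \<le> cumulant \<alpha>" unfolding cumulant_def using cosh_real_ge_1[of \<alpha>] by simp

lemma lagrangian_sinh: "lagrangian (2 * sinh \<beta>) = 2 * sinh \<beta> * \<beta> - cumulant \<beta>"
proof -
  have "(2 * sinh \<beta>)\<^sup>2 + 4 = (2 * cosh \<beta>)\<^sup>2" by (simp add: power_mult_distrib cosh_square_eq)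
  then have s: "sqrt ((2 * sinh \<beta>)\<^sup>2 + 4) = 2 * cosh \<beta>" by (metis real_sqrt_unique cosh_real_nonneg mult_nonneg_nonneg zero_le_numeral)
  have "(2 * sinh \<beta> + 2 * cosh \<beta>) / 2 = exp \<beta>" by (simp add: sinh_plus_cosh[symmetric])
  then show ?thesis unfolding lagrangian_def s cumulant_def by simp
qed

lemma two_sinh_surj: obtains \<beta> :: real where "v = 2 * sinh \<beta>"
  by (rule that[of "arsinh (v / 2)"]) simp

lemma cosh_tangent: "cosh \<beta> + sinh \<beta> * (\<alpha> - \<beta>) \<le> cosh (\<alpha>::real)"
proof -
  have 1: "exp \<beta> * (1 + (\<alpha> - \<beta>)) \<le> exp \<beta> * exp (\<alpha> - \<beta>)" by (intro mult_left_mono exp_ge_add_one_self) auto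
  have 2: "exp (- \<beta>) * (1 + (\<beta> - \<alpha>)) \<le> exp (- \<beta>) * exp (\<beta> - \<alpha>)" by (intro mult_left_mono exp_ge_add_one_self) auto
  have "exp \<beta> * exp (\<alpha> - \<beta>) = exp \<alpha>" "exp (- \<beta>) * exp (\<beta> - \<alpha>) = exp (- \<alpha>)" by (simp_all add: exp_add[symmetric])
  then show ?thesis using 1 2 unfolding cosh_def sinh_def by (simp add: field_simps)
qed

lemma lagrangian_young: "\<alpha> * v \<le> lagrangian v + cumulant \<alpha>"
proof -
  obtain \<beta> where v: "v = 2 * sinh \<beta>" by (rule two_sinh_surj)
  show ?thesis unfolding v lagrangian_sinh using cosh_tangent[of \<beta> \<alpha>] by (simp add: cumulant_def algebra_simps)
qed

lemma lagrangian_attained: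
  assumes "v \<ge> 0"
  obtains \<alpha> where "\<alpha> \<ge> 0" "\<alpha> * v = lagrangian v + cumulant \<alpha>" "v = 2 * sinh \<alpha>"
proof -
  obtain \<beta> where v: "v = 2 * sinh \<beta>" by (rule two_sinh_surj)
  have "\<beta> \<ge> 0" using assms v by simp
  then show ?thesis using that[of \<beta>] lagrangian_sinh[of \<beta>] v by (simp add: algebra_simps)
qed

lemma lagrangian_minus: "lagrangian (- v) = lagrangian v"
proof -
  obtain \<beta> where v: "v = 2 * sinh \<beta>" by (rule two_sinh_surj)
  show ?thesis using lagrangian_sinh[of "- \<beta>"] unfolding v by (simp add: lagrangian_sinh cumulant_def)
qed

lemma lagrangian_abs: "lagrangian \<bar>v\<bar> = lagrangian v"
  by (simp add: abs_if lagrangian_minus)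

lemma lagrangian_continuous: "continuous_on UNIV lagrangian"
proof -
  have "(v + sqrt (v\<^sup>2 + 4)) / 2 > 0" for v :: real
  proof -
    have "\<bar>v\<bar> < sqrt (v\<^sup>2 + 4)" by (rule real_less_rsqrt) simp
    then have "0 < v + sqrt (v\<^sup>2 + 4)" by linarith
    then show ?thesis by simp
  qed
  then have "\<forall>v\<in>UNIV. (v + sqrt (v\<^sup>2 + 4)) / 2 \<noteq> (0::real)" by (metis less_irrefl)
  then show ?thesis unfolding lagrangian_def by (intro continuous_intros) auto
qed

lemma lagrangian_tendsto: "(f \<longlongrightarrow> v) F \<Longrightarrow> ((\<lambda>x. lagrangian (f x)) \<longlongrightarrow> lagrangian v) F"
  using lagrangian_continuous continuous_on_tendsto_compose[of UNIV lagrangian f v F] by simp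

lemma lagrangian_measurable [measurable]: "lagrangian \<in> borel_measurable borel"
  by (intro borel_measurable_continuous_onI lagrangian_continuous)

lemma scaled_young: "h > 0 \<Longrightarrow> \<alpha> * d \<le> h * lagrangian (d / h) + h * cumulant \<alpha>"
  using mult_left_mono[OF lagrangian_young[of \<alpha> "d / h"], of h] by (simp add: distrib_left)

text \<open>The multiplier is nonnegative, so that the identity survives as an inequality when
  \<open>d\<close> is replaced by an upper bound such as a triangle inequality or an integral.\<close>

lemma scaled_young_attained:
  assumes "h > 0" "d \<ge> 0"
  obtains \<alpha> where "\<alpha> \<ge> 0" "\<alpha> * d = h * lagrangian (d / h) + h * cumulant \<alpha>" "d / h = 2 * sinh \<alpha>"
proof -
  obtain \<alpha> where \<alpha>: "\<alpha> \<ge> 0" "\<alpha> * (d / h) = lagrangian (d / h) + cumulant \<alpha>" "d / h = 2 * sinh \<alpha>"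
    using lagrangian_attained[of "d / h"] assms by (metis divide_nonneg_pos)
  have "h * (\<alpha> * (d / h)) = h * (lagrangian (d / h) + cumulant \<alpha>)" using \<alpha>(2) by simp
  then have "\<alpha> * d = h * lagrangian (d / h) + h * cumulant \<alpha>" using assms by (simp add: distrib_left)
  then show ?thesis using that \<alpha> by blast
qed

lemma lagrangian_superlinear:
  assumes d: "d > 0"
  obtains h0 where "h0 > 0" "\<And>h. 0 < h \<Longrightarrow> h < h0 \<Longrightarrow> B \<le> h * lagrangian (d / h)"
proof -
  define \<alpha> where "\<alpha> = (\<bar>B\<bar> + 1) / d"
  define h0 where "h0 = 1 / (cumulant \<alpha> + 1)"
  have c: "cumulant \<alpha> + 1 > 0" using cumulant_nonneg[of \<alpha>] by simp
  show ?thesis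
  proof
    show "h0 > 0" unfolding h0_def using c by simp
    fix h assume h: "0 < h" "h < h0"
    have "\<alpha> * d = \<bar>B\<bar> + 1" unfolding \<alpha>_def using d by simp
    then have "\<bar>B\<bar> + 1 \<le> h * lagrangian (d / h) + h * cumulant \<alpha>" using scaled_young[OF h(1), of \<alpha> d] by simp
    moreover have "h * cumulant \<alpha> \<le> 1"
    proof -
      have "h * cumulant \<alpha> \<le> h * (cumulant \<alpha> + 1)" using h by (simp add: algebra_simps)
      also have "\<dots> \<le> h0 * (cumulant \<alpha> + 1)" using h c by (intro mult_right_mono) auto
      also have "\<dots> = 1" unfolding h0_def using c by simp
      finally show ?thesis .
    qed
    ultimately show "B \<le> h * lagrangian (d / h)" by linarith
  qed
qed

text \<open>Take the optimal multiplier of the total displacement and apply the Young inequality to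
  each piece.\<close>

lemma lagrangian_jensen:
  assumes h: "\<And>j. j \<in> J \<Longrightarrow> h j > 0" and d: "\<And>j. j \<in> J \<Longrightarrow> d j \<ge> (0::real)"
    and H: "(\<Sum>j\<in>J. h j) = H" "H > 0" and D: "0 \<le> D" "D \<le> (\<Sum>j\<in>J. d j)"
  shows "H * lagrangian (D / H) \<le> (\<Sum>j\<in>J. h j * lagrangian (d j / h j))"
proof -
  obtain \<alpha> where a: "\<alpha> \<ge> 0" "\<alpha> * D = H * lagrangian (D / H) + H * cumulant \<alpha>"
    by (rule scaled_young_attained[OF H(2) D(1)])
  have "\<alpha> * d j - h j * cumulant \<alpha> \<le> h j * lagrangian (d j / h j)" if j: "j \<in> J" for j
    using scaled_young[OF h[OF j], of \<alpha> "d j"] by simp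
  then have "(\<Sum>j\<in>J. \<alpha> * d j - h j * cumulant \<alpha>) \<le> (\<Sum>j\<in>J. h j * lagrangian (d j / h j))" by (rule sum_mono)
  moreover have "(\<Sum>j\<in>J. \<alpha> * d j - h j * cumulant \<alpha>) = \<alpha> * (\<Sum>j\<in>J. d j) - H * cumulant \<alpha>"
    unfolding H(1)[symmetric] by (simp add: sum_subtractf sum_distrib_left sum_distrib_right)
  moreover have "\<alpha> * D \<le> \<alpha> * (\<Sum>j\<in>J. d j)" using a D by (intro mult_left_mono) auto
  ultimately show ?thesis using a(2) by linarith
qed

section \<open>The energy along dyadic times\<close>

definition mesh :: "real \<Rightarrow> nat \<Rightarrow> real" where "mesh T n = T / 2 ^ n"

text \<open>The action of the path that runs at constant speed along shortest arcs between the values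
  of \<open>\<gamma>\<close> at the times \<open>i T / 2 ^ n\<close>. It depends on finitely many values only and is continuous
  in them.\<close>

definition energy :: "real \<Rightarrow> nat \<Rightarrow> (real \<Rightarrow> circle) \<Rightarrow> real" where
  "energy T n \<gamma> = (\<Sum>i<2 ^ n. mesh T n * lagrangian (dist (\<gamma> (mesh T n * real i)) (\<gamma> (mesh T n * real (Suc i))) / mesh T n))"

lemma mesh_pos: "T > 0 \<Longrightarrow> mesh T n > 0" unfolding mesh_def by simp

lemma mesh_total: "mesh T n * real (2 ^ n) = T" unfolding mesh_def by simp

lemma mesh_refine: "mesh T n = mesh T (n + m) * real (2 ^ m)" unfolding mesh_def by (simp add: power_add)

lemma mesh_tendsto: "mesh T \<longlonglongrightarrow> 0"
  unfolding mesh_def by real_asymp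

lemma dist_telescope: "i \<le> j \<Longrightarrow> dist (x i) (x j) \<le> (\<Sum>l\<in>{i..<j}. dist (x l) (x (Suc l)))"
  for x :: "nat \<Rightarrow> 'a::metric_space"
proof (induction j rule: dec_induct)
  case (step j)
  have "dist (x i) (x (Suc j)) \<le> dist (x i) (x j) + dist (x j) (x (Suc j))" by (rule dist_triangle)
  then show ?case using step by simp
qed simp

lemma energy_block:
  assumes T: "T > 0" and ij: "i < j" "j \<le> 2 ^ n"
  defines "h \<equiv> mesh T n"
  shows "(h * real (j - i)) * lagrangian (dist (\<gamma> (h * real i)) (\<gamma> (h * real j)) / (h * real (j - i)))
    \<le> (\<Sum>l\<in>{i..<j}. h * lagrangian (dist (\<gamma> (h * real l)) (\<gamma> (h * real (Suc l))) / h))"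
proof (rule lagrangian_jensen)
  have h: "h > 0" using mesh_pos[OF T] unfolding h_def .
  show "(\<Sum>l\<in>{i..<j}. h) = h * real (j - i)" by simp
  show "h * real (j - i) > 0" using h ij by simp
  show "dist (\<gamma> (h * real i)) (\<gamma> (h * real j)) \<le> (\<Sum>l\<in>{i..<j}. dist (\<gamma> (h * real l)) (\<gamma> (h * real (Suc l))))"
    using dist_telescope[of i j "\<lambda>l. \<gamma> (h * real l)"] ij by simp
qed (use mesh_pos[OF T] in \<open>auto simp: h_def\<close>)

lemma energy_terms_nonneg: "T > 0 \<Longrightarrow> 0 \<le> mesh T n * lagrangian v"
  using mesh_pos[of T n] lagrangian_nonneg[of v] by simp

lemma energy_block_le:
  assumes T: "T > 0" and ij: "i < j" "j \<le> 2 ^ n"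
  shows "(mesh T n * real (j - i)) * lagrangian (dist (\<gamma> (mesh T n * real i)) (\<gamma> (mesh T n * real j)) / (mesh T n * real (j - i))) \<le> energy T n \<gamma>"
  unfolding energy_def
  by (rule order_trans[OF energy_block[OF T ij]], rule sum_mono2) (use ij energy_terms_nonneg[OF T] in auto)

lemma energy_mono:
  assumes T: "T > 0"
  shows "energy T n \<gamma> \<le> energy T (n + m) \<gamma>"
proof -
  define h where "h = mesh T (n + m)"
  have h: "h > 0" using mesh_pos[OF T] unfolding h_def .
  have r: "mesh T n = h * real (2 ^ m)" unfolding h_def by (rule mesh_refine)
  define e where "e = (\<lambda>l. h * lagrangian (dist (\<gamma> (h * real l)) (\<gamma> (h * real (Suc l))) / h))"
  have "energy T n \<gamma> \<le> (\<Sum>i<2 ^ n. sum e {i * 2 ^ m..<i * 2 ^ m + 2 ^ m})"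
    unfolding energy_def
  proof (rule sum_mono)
    fix i :: nat assume i: "i \<in> {..<2 ^ n}"
    have "Suc i * 2 ^ m \<le> 2 ^ n * 2 ^ m" using i by (intro mult_right_mono) auto
    then have b: "i * 2 ^ m + 2 ^ m \<le> 2 ^ (n + m)" by (simp add: power_add)
    have 1: "mesh T n * real i = h * real (i * 2 ^ m)" "mesh T n * real (Suc i) = h * real (i * 2 ^ m + 2 ^ m)"
      unfolding r by (simp_all add: algebra_simps)
    have 2: "mesh T n = h * real (i * 2 ^ m + 2 ^ m - i * 2 ^ m)" unfolding r by simp
    show "mesh T n * lagrangian (dist (\<gamma> (mesh T n * real i)) (\<gamma> (mesh T n * real (Suc i))) / mesh T n) \<le> sum e {i * 2 ^ m..<i * 2 ^ m + 2 ^ m}"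
      using energy_block[OF T _ b, of "i * 2 ^ m" \<gamma>] unfolding e_def 1 2[symmetric] h_def[symmetric] by simp
  qed
  also have "\<dots> = sum e {..<2 ^ n * 2 ^ m}" by (rule sum.nat_group)
  also have "\<dots> = energy T (n + m) \<gamma>" unfolding energy_def e_def h_def by (simp add: power_add)
  finally show ?thesis .
qed

section \<open>The energies exhaust the rate function\<close>

lemma abs_continuousD:
  assumes "abs_continuous T \<gamma>" "\<epsilon> > 0"
  obtains \<delta> where "\<delta> > 0" "\<And>n (s :: nat \<Rightarrow> real) t. (\<And>i. i < n \<Longrightarrow> 0 \<le> s i \<and> s i < t i \<and> t i \<le> T) \<Longrightarrow>
        disjoint_family_on (\<lambda>i. {s i<..<t i}) {..<n} \<Longrightarrow> (\<Sum>i<n. t i - s i) < \<delta> \<Longrightarrow>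
        (\<Sum>i<n. dist (\<gamma> (t i)) (\<gamma> (s i))) < \<epsilon>"
proof -
  obtain \<delta> where "\<delta> > 0" and d: "\<forall>n. \<forall>s t :: nat \<Rightarrow> real.
        (\<forall>i<n. 0 \<le> s i \<and> s i < t i \<and> t i \<le> T) \<and>
        disjoint_family_on (\<lambda>i. {s i<..<t i}) {..<n} \<and>
        (\<Sum>i<n. t i - s i) < \<delta> \<longrightarrow>
        (\<Sum>i<n. dist (\<gamma> (t i)) (\<gamma> (s i))) < \<epsilon>"
    using assms unfolding abs_continuous_def by meson
  then show ?thesis using that by blast
qed

lemma abs_continuous_imp_continuous:
  assumes "abs_continuous T \<gamma>"
  shows "continuous_on {0..T} \<gamma>"
  unfolding continuous_on_iff
proof (intro ballI allI impI)
  fix x e assume x: "x \<in> {0..T}" and e: "(e::real) > 0"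
  obtain \<delta> where \<delta>: "\<delta> > 0" "\<And>n (s :: nat \<Rightarrow> real) t. (\<And>i. i < n \<Longrightarrow> 0 \<le> s i \<and> s i < t i \<and> t i \<le> T) \<Longrightarrow>
        disjoint_family_on (\<lambda>i. {s i<..<t i}) {..<n} \<Longrightarrow> (\<Sum>i<n. t i - s i) < \<delta> \<Longrightarrow>
        (\<Sum>i<n. dist (\<gamma> (t i)) (\<gamma> (s i))) < e" by (rule abs_continuousD[OF assms e]) blast
  have *: "dist (\<gamma> v) (\<gamma> u) < e" if "0 \<le> u" "u < v" "v \<le> T" "v - u < \<delta>" for u v
    using \<delta>(2)[of 1 "\<lambda>_. u" "\<lambda>_. v"] that by (simp add: disjoint_family_on_def)
  have "dist (\<gamma> y) (\<gamma> x) < e" if y: "y \<in> {0..T}" "dist y x < \<delta>" for y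
  proof (cases "y = x")
    case True
    then show ?thesis using e by simp
  next
    case False
    then consider "y < x" | "x < y" by linarith
    then show ?thesis
      using *[of y x] *[of x y] x y by cases (auto simp: dist_real_def dist_commute)
  qed
  then show "\<exists>d>0. \<forall>y\<in>{0..T}. dist y x < d \<longrightarrow> dist (\<gamma> y) (\<gamma> x) < e" using \<delta>(1) by blast
qed

text \<open>Over short intervals a continuous lift moves by less than \<open>1 / 2\<close>, and then its increment
  is the distance on the circle.\<close>

lemma lift_ac_on:
  assumes ac: "abs_continuous T \<gamma>" and \<theta>: "continuous_on {0..T} \<theta>" "\<And>t. t \<in> {0..T} \<Longrightarrow> \<gamma> t = circle_of (\<theta> t)"
  shows "ac_on 0 T \<theta>"
  unfolding ac_on_def
proof (intro allI impI)
  fix \<epsilon> :: real assume \<epsilon>: "\<epsilon> > 0"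
  obtain \<delta>1 where \<delta>1: "\<delta>1 > 0" "\<And>n (s :: nat \<Rightarrow> real) t. (\<And>i. i < n \<Longrightarrow> 0 \<le> s i \<and> s i < t i \<and> t i \<le> T) \<Longrightarrow>
        disjoint_family_on (\<lambda>i. {s i<..<t i}) {..<n} \<Longrightarrow> (\<Sum>i<n. t i - s i) < \<delta>1 \<Longrightarrow>
        (\<Sum>i<n. dist (\<gamma> (t i)) (\<gamma> (s i))) < \<epsilon>" by (rule abs_continuousD[OF ac \<epsilon>]) blast
  have "uniformly_continuous_on {0..T} \<theta>" using \<theta>(1) by (intro compact_uniformly_continuous) auto
  then obtain \<delta>2 where \<delta>2: "\<delta>2 > 0" "\<And>s t. s \<in> {0..T} \<Longrightarrow> t \<in> {0..T} \<Longrightarrow> dist t s < \<delta>2 \<Longrightarrow> dist (\<theta> t) (\<theta> s) < 1 / 2"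
    unfolding uniformly_continuous_on_def by (meson half_gt_zero zero_less_one)
  show "\<exists>\<delta>>0. \<forall>D. D division_of \<Union>D \<and> \<Union>D \<subseteq> {0..T} \<and> (\<Sum>K\<in>D. measure lebesgue K) < \<delta> \<longrightarrow>
     (\<Sum>K\<in>D. \<bar>increment \<theta> K\<bar>) < \<epsilon>"
  proof (intro exI[of _ "min \<delta>1 \<delta>2"] conjI allI impI)
    show "min \<delta>1 \<delta>2 > 0" using \<delta>1 \<delta>2 by simp
    fix D :: "real set set"
    assume "D division_of \<Union>D \<and> \<Union>D \<subseteq> {0..T} \<and> (\<Sum>K\<in>D. measure lebesgue K) < min \<delta>1 \<delta>2"
    then have D: "D division_of \<Union>D" "\<Union>D \<subseteq> {0..T}" "(\<Sum>K\<in>D. measure lebesgue K) < min \<delta>1 \<delta>2" by auto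
    define E where "E = {K\<in>D. Inf K < Sup K}"
    have fD: "finite D" using D(1) by auto
    have K: "K = {Inf K..Sup K}" "Inf K \<le> Sup K" "Inf K \<in> {0..T}" "Sup K \<in> {0..T}" "measure lebesgue K = Sup K - Inf K" if KD: "K \<in> D" for K
    proof -
      obtain u v where uv: "K = {u..v}" "u \<le> v" using division_ofD(3,4)[OF D(1) KD] by auto
      moreover have "K \<subseteq> {0..T}" using KD D(2) by auto
      ultimately show "K = {Inf K..Sup K}" "Inf K \<le> Sup K" "Inf K \<in> {0..T}" "Sup K \<in> {0..T}" "measure lebesgue K = Sup K - Inf K" by auto
    qed
    obtain b where b: "bij_betw b {..<card E} E"
      using ex_bij_betw_nat_finite[of E] fD unfolding E_def atLeast0LessThan by auto
    have bE: "b i \<in> D" "Inf (b i) < Sup (b i)" if "i < card E" for i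
      using bij_betwE[OF b] that unfolding E_def by auto
    have sE: "(\<Sum>K\<in>E. g K) = (\<Sum>i<card E. g (b i))" for g :: "real set \<Rightarrow> real"
      using sum.reindex_bij_betw[OF b, of g] by simp
    have "(\<Sum>K\<in>D. \<bar>increment \<theta> K\<bar>) = (\<Sum>K\<in>E. \<bar>increment \<theta> K\<bar>)"
    proof (rule sum.mono_neutral_right[OF fD])
      show "\<forall>K\<in>D - E. \<bar>increment \<theta> K\<bar> = 0"
      proof
        fix K assume "K \<in> D - E"
        then have "Inf K = Sup K" using K(2)[of K] unfolding E_def by auto
        then show "\<bar>increment \<theta> K\<bar> = 0" unfolding increment_def by simp
      qed
    qed (auto simp: E_def)
    also have "\<dots> = (\<Sum>i<card E. \<bar>increment \<theta> (b i)\<bar>)" by (rule sE)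
    also have "\<dots> = (\<Sum>i<card E. dist (\<gamma> (Sup (b i))) (\<gamma> (Inf (b i))))"
    proof (rule sum.cong[OF refl])
      fix i assume i: "i \<in> {..<card E}"
      note Ki = K[OF bE(1)[of i]]
      have "measure lebesgue (b i) \<le> (\<Sum>K\<in>D. measure lebesgue K)"
        using i bE(1) fD by (intro member_le_sum) auto
      then have "Sup (b i) - Inf (b i) < \<delta>2" using D(3) Ki i by auto
      then have "dist (\<theta> (Sup (b i))) (\<theta> (Inf (b i))) < 1 / 2"
        using i Ki by (intro \<delta>2(2)) (auto simp: dist_real_def)
      then show "\<bar>increment \<theta> (b i)\<bar> = dist (\<gamma> (Sup (b i))) (\<gamma> (Inf (b i)))"
        using i Ki \<theta>(2) unfolding increment_def by (simp add: dist_circle_of_eq dist_real_def)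
    qed
    also have "\<dots> < \<epsilon>"
    proof (rule \<delta>1(2))
      show "0 \<le> Inf (b i) \<and> Inf (b i) < Sup (b i) \<and> Sup (b i) \<le> T" if "i < card E" for i
        using K(3,4)[OF bE(1)[OF that]] bE(2)[OF that] by auto
      show "disjoint_family_on (\<lambda>i. {Inf (b i)<..<Sup (b i)}) {..<card E}"
        unfolding disjoint_family_on_def
      proof (intro ballI impI)
        fix i j assume ij: "i \<in> {..<card E}" "j \<in> {..<card E}" "i \<noteq> j"
        then have "b i \<noteq> b j" using b unfolding bij_betw_def inj_on_def by blast
        then have "interior (b i) \<inter> interior (b j) = {}" using division_ofD(5)[OF D(1)] bE(1) ij by auto
        moreover have "interior (b l) = {Inf (b l)<..<Sup (b l)}" if "l < card E" for l
          using K(1)[OF bE(1)[OF that]] by (metis interior_atLeastAtMost_real)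
        ultimately show "{Inf (b i)<..<Sup (b i)} \<inter> {Inf (b j)<..<Sup (b j)} = {}" using ij by auto
      qed
      have "(\<Sum>i<card E. Sup (b i) - Inf (b i)) = (\<Sum>K\<in>E. measure lebesgue K)"
        unfolding sE using K(5) bE(1) by (intro sum.cong) auto
      also have "\<dots> \<le> (\<Sum>K\<in>D. measure lebesgue K)" using fD by (intro sum_mono2) (auto simp: E_def)
      finally show "(\<Sum>i<card E. Sup (b i) - Inf (b i)) < \<delta>1" using D(3) by simp
    qed
    finally show "(\<Sum>K\<in>D. \<bar>increment \<theta> K\<bar>) < \<epsilon>" .
  qed
qed

lemma abs_continuous_derivative:
  assumes T: "T > 0" and ac: "abs_continuous T \<gamma>"
  obtains \<theta> g where "continuous_on {0..T} \<theta>" "\<And>t. t \<in> {0..T} \<Longrightarrow> \<gamma> t = circle_of (\<theta> t)"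
    "g \<in> borel_measurable borel" "AE x in lebesgue. x \<in> {0<..<T} \<longrightarrow> (\<theta> has_real_derivative g x) (at x)"
    "\<And>c d. 0 \<le> c \<Longrightarrow> c < d \<Longrightarrow> d \<le> T \<Longrightarrow> ennreal (dist (\<gamma> c) (\<gamma> d)) \<le> (\<integral>\<^sup>+ x. ennreal \<bar>g x\<bar> * indicator {c..d} x \<partial>lebesgue)"
    "(\<integral>\<^sup>+ s\<in>{0..T}. ennreal (lagrangian (circle_deriv T \<gamma> s)) \<partial>lebesgue) =
     (\<integral>\<^sup>+ s. ennreal (lagrangian (g s)) * indicator {0..<T} s \<partial>lebesgue)"
proof -
  obtain \<theta> where \<theta>: "continuous_on {0..T} \<theta>" "\<And>t. t \<in> {0..T} \<Longrightarrow> \<gamma> t = circle_of (\<theta> t)"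
    by (rule continuous_lift[OF T abs_continuous_imp_continuous[OF ac]]) blast
  obtain g where g: "g \<in> borel_measurable borel"
    "AE x in lebesgue. x \<in> {0<..<T} \<longrightarrow> (\<theta> has_real_derivative g x) (at x)"
    "\<And>c d. 0 \<le> c \<Longrightarrow> c < d \<Longrightarrow> d \<le> T \<Longrightarrow> ennreal \<bar>\<theta> d - \<theta> c\<bar> \<le> (\<integral>\<^sup>+ x. ennreal \<bar>g x\<bar> * indicator {c..d} x \<partial>lebesgue)"
  proof (rule ac_derivative[OF lift_ac_on[OF ac \<theta>] T])
    fix g :: "real \<Rightarrow> real"
    assume "g \<in> borel_measurable borel" "AE x in lebesgue. x \<in> {0<..<T} \<longrightarrow> (\<theta> has_real_derivative g x) (at x)"
      "\<And>c d. 0 \<le> c \<Longrightarrow> c < d \<Longrightarrow> d \<le> T \<Longrightarrow> ennreal \<bar>\<theta> d - \<theta> c\<bar> \<le> (\<integral>\<^sup>+ x. ennreal \<bar>g x\<bar> * indicator {c..d} x \<partial>lebesgue)"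
    then show thesis by (rule that)
  qed
  show ?thesis
  proof (rule that[OF \<theta> g(1,2)])
    fix c d assume cd: "0 \<le> c" "c < d" "d \<le> T"
    have "dist (\<gamma> c) (\<gamma> d) \<le> \<bar>\<theta> d - \<theta> c\<bar>" using \<theta>(2)[of c] \<theta>(2)[of d] cd
      using dist_circle_of_le[of "\<theta> c" "\<theta> d"] by (simp add: abs_minus_commute)
    then show "ennreal (dist (\<gamma> c) (\<gamma> d)) \<le> (\<integral>\<^sup>+ x. ennreal \<bar>g x\<bar> * indicator {c..d} x \<partial>lebesgue)"
      using g(3)[OF cd] ennreal_leI order_trans by blast
  next
    show "(\<integral>\<^sup>+ s\<in>{0..T}. ennreal (lagrangian (circle_deriv T \<gamma> s)) \<partial>lebesgue) =
     (\<integral>\<^sup>+ s. ennreal (lagrangian (g s)) * indicator {0..<T} s \<partial>lebesgue)"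
    proof (rule nn_integral_cong_AE)
      have "AE x in lebesgue. x \<noteq> 0" "AE x in lebesgue. x \<noteq> T" by (metis AE_completion AE_lborel_singleton)+
      then show "AE s in lebesgue. ennreal (lagrangian (circle_deriv T \<gamma> s)) * indicator {0..T} s =
        ennreal (lagrangian (g s)) * indicator {0..<T} s"
        using g(2)
      proof eventually_elim
        case (elim s)
        show ?case
        proof (cases "s \<in> {0<..<T}")
          case True
          then have "(\<theta> has_real_derivative g s) (at s within {0..T})"
            using elim by (auto intro: has_field_derivative_at_within)
          then have "circle_deriv T \<gamma> s = g s"
            using True by (intro circle_deriv_eqI[OF T _ \<theta>(2)]) auto
          then show ?thesis using True by simp
        next
          case False
          then have "s \<notin> {0..T}" "s \<notin> {0..<T}" using elim by auto
          then show ?thesis by simp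
        qed
      qed
    qed
  qed
qed

text \<open>Jensen's inequality in each cell: with the optimal multiplier \<open>\<alpha>\<close>, the energy of the cell
  plus \<open>h * cumulant \<alpha>\<close> is \<open>\<alpha>\<close> times the distance of the endpoints, hence at most the integral
  of \<open>\<alpha> * \<bar>g\<bar>\<close>, and the integrand is at most \<open>lagrangian g + cumulant \<alpha>\<close>.\<close>

theorem energy_le_rate:
  assumes T: "T > 0" and ac: "abs_continuous T \<gamma>"
  shows "ennreal (energy T n \<gamma>) \<le> (\<integral>\<^sup>+ s\<in>{0..T}. ennreal (lagrangian (circle_deriv T \<gamma> s)) \<partial>lebesgue)"
proof -
  obtain \<theta> g where g: "g \<in> borel_measurable borel"
    "\<And>c d. 0 \<le> c \<Longrightarrow> c < d \<Longrightarrow> d \<le> T \<Longrightarrow> ennreal (dist (\<gamma> c) (\<gamma> d)) \<le> (\<integral>\<^sup>+ x. ennreal \<bar>g x\<bar> * indicator {c..d} x \<partial>lebesgue)"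
    "(\<integral>\<^sup>+ s\<in>{0..T}. ennreal (lagrangian (circle_deriv T \<gamma> s)) \<partial>lebesgue) =
     (\<integral>\<^sup>+ s. ennreal (lagrangian (g s)) * indicator {0..<T} s \<partial>lebesgue)"
    by (rule abs_continuous_derivative[OF T ac]) blast
  define h where "h = mesh T n"
  have h: "h > 0" "h * real (2 ^ n) = T" using mesh_pos[OF T] mesh_total unfolding h_def by auto
  define F where "F = (\<lambda>x. ennreal (lagrangian (g x)))"
  have F: "F \<in> borel_measurable lebesgue" unfolding F_def by (rule borel_measurable_lebesgueI) (use g(1) in simp)
  have cell: "ennreal (h * lagrangian (dist (\<gamma> (h * real i)) (\<gamma> (h * real (Suc i))) / h)) \<le>
     (\<integral>\<^sup>+ x. F x * indicator {h * real i..<h * real (Suc i)} x \<partial>lebesgue)" if i: "i < 2 ^ n" for i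
  proof -
    define c where "c = h * real i"
    define e where "e = h * real (Suc i)"
    have "h * real (Suc i) \<le> h * real (2 ^ n)" using h i by (intro mult_left_mono) (metis Suc_leI of_nat_le_iff, simp)
    then have ce: "0 \<le> c" "c < e" "e \<le> T" "e - c = h" unfolding c_def e_def using h by (auto simp: algebra_simps)
    define B where "B = {c..<e}"
    have B: "B \<in> sets lebesgue" "emeasure lebesgue B = ennreal h" unfolding B_def using ce by auto
    define d where "d = dist (\<gamma> c) (\<gamma> e)"
    have d: "d \<ge> 0" unfolding d_def by simp
    obtain \<alpha> where \<alpha>: "\<alpha> \<ge> 0" and sum: "\<alpha> * d = h * lagrangian (d / h) + h * cumulant \<alpha>"
      by (rule scaled_young_attained[OF h(1) d])
    have "ennreal (h * lagrangian (d / h)) + ennreal (h * cumulant \<alpha>) = ennreal (\<alpha> * d)"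
      unfolding sum using h lagrangian_nonneg cumulant_nonneg by (intro ennreal_plus[symmetric]) auto
    also have "\<dots> = ennreal \<alpha> * ennreal d" using \<alpha> d by (simp add: ennreal_mult)
    also have "\<dots> \<le> ennreal \<alpha> * (\<integral>\<^sup>+ x. ennreal \<bar>g x\<bar> * indicator {c..e} x \<partial>lebesgue)"
      unfolding d_def by (intro mult_left_mono g(2) ce) auto
    also have "(\<integral>\<^sup>+ x. ennreal \<bar>g x\<bar> * indicator {c..e} x \<partial>lebesgue) = (\<integral>\<^sup>+ x. ennreal \<bar>g x\<bar> * indicator B x \<partial>lebesgue)"
    proof (rule nn_integral_cong_AE)
      have "AE x in lebesgue. x \<noteq> e" by (metis AE_completion AE_lborel_singleton)
      then show "AE x in lebesgue. ennreal \<bar>g x\<bar> * indicator {c..e} x = ennreal \<bar>g x\<bar> * indicator B x"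
        by (rule eventually_mono) (auto simp: B_def indicator_def)
    qed
    also have "ennreal \<alpha> * \<dots> = (\<integral>\<^sup>+ x. ennreal \<alpha> * (ennreal \<bar>g x\<bar> * indicator B x) \<partial>lebesgue)"
      by (rule nn_integral_cmult[symmetric], rule borel_measurable_times_ennreal, rule borel_measurable_lebesgueI)
         (use g(1) B in auto)
    also have "\<dots> \<le> (\<integral>\<^sup>+ x. F x * indicator B x + ennreal (cumulant \<alpha>) * indicator B x \<partial>lebesgue)"
    proof (rule nn_integral_mono)
      fix x
      have "ennreal \<alpha> * ennreal \<bar>g x\<bar> = ennreal (\<alpha> * \<bar>g x\<bar>)" using \<alpha> by (simp add: ennreal_mult)
      also have "\<dots> \<le> ennreal (lagrangian (g x) + cumulant \<alpha>)"
        using lagrangian_young[of \<alpha> "\<bar>g x\<bar>"] lagrangian_abs[of "g x"] by (intro ennreal_leI) simp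
      also have "\<dots> = F x + ennreal (cumulant \<alpha>)" unfolding F_def using lagrangian_nonneg cumulant_nonneg by (intro ennreal_plus) auto
      finally show "ennreal \<alpha> * (ennreal \<bar>g x\<bar> * indicator B x) \<le> F x * indicator B x + ennreal (cumulant \<alpha>) * indicator B x"
        by (simp add: indicator_def)
    qed
    also have "\<dots> = (\<integral>\<^sup>+ x. F x * indicator B x \<partial>lebesgue) + (\<integral>\<^sup>+ x. ennreal (cumulant \<alpha>) * indicator B x \<partial>lebesgue)"
      using F B by (intro nn_integral_add) auto
    also have "(\<integral>\<^sup>+ x. ennreal (cumulant \<alpha>) * indicator B x \<partial>lebesgue) = ennreal (h * cumulant \<alpha>)"
      using B h cumulant_nonneg by (simp add: nn_integral_cmult_indicator ennreal_mult mult.commute)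
    finally have "ennreal (h * cumulant \<alpha>) + ennreal (h * lagrangian (d / h)) \<le> ennreal (h * cumulant \<alpha>) + (\<integral>\<^sup>+ x. F x * indicator B x \<partial>lebesgue)"
      by (simp add: add.commute)
    then show ?thesis unfolding d_def B_def c_def e_def using ennreal_add_left_cancel_le by auto
  qed
  have "ennreal (energy T n \<gamma>) = (\<Sum>i<2 ^ n. ennreal (h * lagrangian (dist (\<gamma> (h * real i)) (\<gamma> (h * real (Suc i))) / h)))"
    unfolding energy_def h_def by (rule sum_ennreal[symmetric]) (simp add: energy_terms_nonneg[OF T])
  also have "\<dots> \<le> (\<Sum>i<2 ^ n. \<integral>\<^sup>+ x. F x * indicator {h * real i..<h * real (Suc i)} x \<partial>lebesgue)"
    by (rule sum_mono) (use cell in auto)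
  also have "\<dots> = (\<integral>\<^sup>+ x. F x * indicator {0..<T} x \<partial>lebesgue)"
    using nn_integral_cells[OF h(1) F, of 0 "2 ^ n"] h(2) by simp
  finally show ?thesis unfolding g(3) F_def .
qed

lemma tendsto_cell_ends:
  assumes "T > 0" "0 \<le> s"
  shows "(\<lambda>m. mesh T m * real (nat \<lceil>s / mesh T m\<rceil>)) \<longlonglongrightarrow> s"
    and "(\<lambda>m. mesh T m * real (nat \<lfloor>s / mesh T m\<rfloor>)) \<longlonglongrightarrow> s"
proof -
  have b: "\<bar>mesh T m * real (nat \<lceil>s / mesh T m\<rceil>) - s\<bar> \<le> mesh T m \<and> \<bar>mesh T m * real (nat \<lfloor>s / mesh T m\<rfloor>) - s\<bar> \<le> mesh T m" for m
  proof -
    define h where "h = mesh T m"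
    have h: "h > 0" using mesh_pos[OF assms(1)] unfolding h_def .
    have 0: "0 \<le> s / h" using assms h by simp
    have s: "s = h * (s / h)" using h by simp
    have c: "\<bar>real (nat \<lceil>s / h\<rceil>) - s / h\<bar> \<le> 1" "\<bar>real (nat \<lfloor>s / h\<rfloor>) - s / h\<bar> \<le> 1"
      using 0 by (simp_all add: of_nat_nat; linarith)+
    have "\<bar>h * x - s\<bar> = h * \<bar>x - s / h\<bar>" for x
    proof -
      have "h * x - s = h * (x - s / h)" using h by (simp add: right_diff_distrib)
      then show ?thesis using h by (simp add: abs_mult)
    qed
    moreover have "h * \<bar>real (nat \<lceil>s / h\<rceil>) - s / h\<bar> \<le> h * 1" "h * \<bar>real (nat \<lfloor>s / h\<rfloor>) - s / h\<bar> \<le> h * 1"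
      using c h by (intro mult_left_mono; simp)+
    ultimately show ?thesis unfolding h_def by simp
  qed
  show "(\<lambda>m. mesh T m * real (nat \<lceil>s / mesh T m\<rceil>)) \<longlonglongrightarrow> s"
    by (rule LIM_zero_cancel, rule Lim_null_comparison[OF _ mesh_tendsto[of T]]) (use b in auto)
  show "(\<lambda>m. mesh T m * real (nat \<lfloor>s / mesh T m\<rfloor>)) \<longlonglongrightarrow> s"
    by (rule LIM_zero_cancel, rule Lim_null_comparison[OF _ mesh_tendsto[of T]]) (use b in auto)
qed

text \<open>The Lagrangian grows faster than linearly: for disjoint intervals with dyadic endpoints,
  \<open>\<alpha>\<close> times the sum of the distances is at most \<open>a\<close> plus \<open>cumulant \<alpha>\<close> times the total length.
  Choose \<open>\<alpha>\<close> large and then the total length small. General intervals are limits of dyadic ones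
  by continuity.\<close>

lemma energy_abs_continuous:
  assumes T: "T > 0" and \<gamma>: "continuous_on {0..T} \<gamma>" and E: "\<And>m. energy T m \<gamma> \<le> a"
  shows "abs_continuous T \<gamma>"
  unfolding abs_continuous_def
proof (intro allI impI)
  fix \<epsilon> :: real assume \<epsilon>: "\<epsilon> > 0"
  define \<alpha> where "\<alpha> = 2 * (\<bar>a\<bar> + 1) / \<epsilon>"
  define \<delta> where "\<delta> = 1 / (cumulant \<alpha> + 1)"
  have \<alpha>: "\<alpha> > 0" unfolding \<alpha>_def using \<epsilon> by simp
  have \<delta>: "\<delta> > 0" "cumulant \<alpha> * \<delta> \<le> 1" unfolding \<delta>_def using cumulant_nonneg[of \<alpha>] by (auto simp: field_simps)
  show "\<exists>\<delta>>0. \<forall>n. \<forall>s t :: nat \<Rightarrow> real.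
        (\<forall>i<n. 0 \<le> s i \<and> s i < t i \<and> t i \<le> T) \<and>
        disjoint_family_on (\<lambda>i. {s i<..<t i}) {..<n} \<and>
        (\<Sum>i<n. t i - s i) < \<delta> \<longrightarrow>
        (\<Sum>i<n. dist (\<gamma> (t i)) (\<gamma> (s i))) < \<epsilon>"
  proof (intro exI[of _ \<delta>] conjI allI impI)
    fix n and s t :: "nat \<Rightarrow> real"
    assume "(\<forall>i<n. 0 \<le> s i \<and> s i < t i \<and> t i \<le> T) \<and>
        disjoint_family_on (\<lambda>i. {s i<..<t i}) {..<n} \<and> (\<Sum>i<n. t i - s i) < \<delta>"
    then have st: "\<And>i. i < n \<Longrightarrow> 0 \<le> s i \<and> s i < t i \<and> t i \<le> T"
      and dis: "disjoint_family_on (\<lambda>i. {s i<..<t i}) {..<n}" and len: "(\<Sum>i<n. t i - s i) < \<delta>" by auto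
    \<comment> \<open>The largest interval with endpoints on the grid of level \<open>m\<close> inside \<open>[s i, t i]\<close>, which
      is nonempty for large \<open>m\<close>.\<close>
    define lo where "lo = (\<lambda>m i. nat \<lceil>s i / mesh T m\<rceil>)"
    define hi where "hi = (\<lambda>m i. nat \<lfloor>t i / mesh T m\<rfloor>)"
    have lim: "(\<lambda>m. \<Sum>i<n. dist (\<gamma> (mesh T m * real (lo m i))) (\<gamma> (mesh T m * real (hi m i)))) \<longlonglongrightarrow> (\<Sum>i<n. dist (\<gamma> (s i)) (\<gamma> (t i)))"
    proof (intro tendsto_sum tendsto_dist)
      fix i assume i: "i \<in> {..<n}"
      then have i': "0 \<le> s i" "s i \<le> t i" "s i \<in> {0..T}" "t i \<in> {0..T}" "s i < T" "t i > 0" "0 \<le> t i" using st[of i] by auto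
      have b: "mesh T m * real (hi m i) \<in> {0..T}" for m
      proof -
        have m: "mesh T m > 0" by (rule mesh_pos[OF T])
        have "0 \<le> t i / mesh T m" using i' m by simp
        then have "real (hi m i) \<le> t i / mesh T m" unfolding hi_def by (simp add: of_nat_nat)
        then have "mesh T m * real (hi m i) \<le> t i" using m by (simp add: field_simps)
        then show ?thesis using i' m by simp
      qed
      show "(\<lambda>m. \<gamma> (mesh T m * real (hi m i))) \<longlonglongrightarrow> \<gamma> (t i)"
        using tendsto_cell_ends(2)[OF T i'(7)] i' b unfolding hi_def
        by (intro continuous_on_tendsto_compose[OF \<gamma>]) auto
      have "\<forall>\<^sub>F m in sequentially. mesh T m * real (lo m i) < T"
        using order_tendstoD(2)[OF tendsto_cell_ends(1)[OF T i'(1)] i'(5)] unfolding lo_def by simp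
      then have "\<forall>\<^sub>F m in sequentially. mesh T m * real (lo m i) \<in> {0..T}"
        by (rule eventually_mono) (simp add: less_imp_le[OF mesh_pos[OF T]])
      then show "(\<lambda>m. \<gamma> (mesh T m * real (lo m i))) \<longlonglongrightarrow> \<gamma> (s i)"
        using tendsto_cell_ends(1)[OF T i'(1)] i' unfolding lo_def
        by (intro continuous_on_tendsto_compose[OF \<gamma>]) auto
    qed
    have "\<forall>\<^sub>F m in sequentially. \<forall>i\<in>{..<n}. mesh T m < t i - s i"
      using st by (intro eventually_ball_finite ballI order_tendstoD(2)[OF mesh_tendsto[of T]]) auto
    then have ev: "\<forall>\<^sub>F m in sequentially. (\<Sum>i<n. dist (\<gamma> (mesh T m * real (lo m i))) (\<gamma> (mesh T m * real (hi m i)))) \<le> \<epsilon> / 2"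
    proof (rule eventually_mono)
      fix m assume small: "\<forall>i\<in>{..<n}. mesh T m < t i - s i"
      define h where "h = mesh T m"
      have h: "h > 0" "h * real (2 ^ m) = T" using mesh_pos[OF T] mesh_total unfolding h_def by auto
      define J where "J = (\<lambda>i. {lo m i..<hi m i})"
      define e where "e = (\<lambda>l. dist (\<gamma> (h * real l)) (\<gamma> (h * real (Suc l))))"
      have ends: "s i \<le> h * real (lo m i)" "h * real (hi m i) \<le> t i" "lo m i \<le> hi m i" "hi m i \<le> 2 ^ m" if i: "i < n" for i
      proof -
        have 0: "0 \<le> s i / h" "0 \<le> t i / h" using st[OF i] h by auto
        have "h < t i - s i" using small i unfolding h_def[symmetric] by auto
        then have "s i + h < t i" by simp
        then have "(s i + h) / h < t i / h" using h by (intro divide_strict_right_mono) auto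
        then have "s i / h + 1 < t i / h" using h by (simp add: add_divide_distrib)
        then have "\<lceil>s i / h\<rceil> \<le> \<lfloor>t i / h\<rfloor>" by linarith
        then show "lo m i \<le> hi m i" unfolding lo_def hi_def h_def[symmetric] by (rule nat_mono)
        have "s i / h \<le> real (lo m i)" unfolding lo_def h_def[symmetric] using 0 by (simp add: of_nat_nat)
        then show "s i \<le> h * real (lo m i)" using h by (simp add: field_simps)
        have "real (hi m i) \<le> t i / h" unfolding hi_def h_def[symmetric] using 0 by (simp add: of_nat_nat)
        then show *: "h * real (hi m i) \<le> t i" using h by (simp add: field_simps)
        have "h * real (hi m i) \<le> h * real (2 ^ m)" using * st[OF i] h(2) by linarith
        then show "hi m i \<le> 2 ^ m" using h(1) by (metis mult_le_cancel_left_pos of_nat_le_iff)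
      qed
      have sub: "{h * real l..h * real (Suc l)} \<subseteq> {s i..t i}" if "i < n" "l \<in> J i" for i l
      proof -
        have "h * real (lo m i) \<le> h * real l" "h * real (Suc l) \<le> h * real (hi m i)"
          using that h unfolding J_def by (auto intro!: mult_left_mono)
        then show ?thesis using ends[OF that(1)] by auto
      qed
      \<comment> \<open>A common cell would have its midpoint in two disjoint intervals.\<close>
      have Jdis: "J i \<inter> J j = {}" if "i < n" "j < n" "i \<noteq> j" for i j
      proof (rule ccontr)
        assume "J i \<inter> J j \<noteq> {}"
        then obtain l where l: "l \<in> J i" "l \<in> J j" by auto
        have "h * real l < h * real l + h / 2" "h * real l + h / 2 < h * real (Suc l)" using h by (auto simp: algebra_simps)
        moreover have "s i \<le> h * real l" "h * real (Suc l) \<le> t i" "s j \<le> h * real l" "h * real (Suc l) \<le> t j"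
          using sub[OF that(1) l(1)] sub[OF that(2) l(2)] h by auto
        ultimately have "h * real l + h / 2 \<in> {s i<..<t i} \<inter> {s j<..<t j}" by auto
        then show False using dis that unfolding disjoint_family_on_def by blast
      qed
      have "\<alpha> * (\<Sum>i<n. dist (\<gamma> (h * real (lo m i))) (\<gamma> (h * real (hi m i)))) \<le> \<alpha> * (\<Sum>i<n. sum e (J i))"
        using \<alpha> dist_telescope[of "lo m _" "hi m _" "\<lambda>l. \<gamma> (h * real l)"] ends(3) unfolding J_def e_def
        by (intro mult_left_mono sum_mono) auto
      also have "\<dots> = (\<Sum>i<n. \<Sum>l\<in>J i. \<alpha> * e l)" by (simp add: sum_distrib_left)
      also have "\<dots> \<le> (\<Sum>i<n. \<Sum>l\<in>J i. h * lagrangian (e l / h) + h * cumulant \<alpha>)"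
      proof (intro sum_mono)
        show "\<alpha> * e l \<le> h * lagrangian (e l / h) + h * cumulant \<alpha>" for l by (rule scaled_young[OF h(1)])
      qed
      also have "\<dots> = (\<Sum>i<n. \<Sum>l\<in>J i. h * lagrangian (e l / h)) + (\<Sum>i<n. h * cumulant \<alpha> * real (card (J i)))"
        by (simp add: sum.distrib mult.commute)
      also have "(\<Sum>i<n. \<Sum>l\<in>J i. h * lagrangian (e l / h)) = (\<Sum>l\<in>(\<Union>i<n. J i). h * lagrangian (e l / h))"
        by (rule sum.UNION_disjoint[symmetric]) (use Jdis in \<open>auto simp: J_def\<close>)
      also have "\<dots> \<le> energy T m \<gamma>"
        unfolding energy_def h_def[symmetric] e_def
        by (rule sum_mono2) (use ends(4) h lagrangian_nonneg in \<open>fastforce simp: J_def\<close>)+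
      also have "(\<Sum>i<n. h * cumulant \<alpha> * real (card (J i))) \<le> (\<Sum>i<n. cumulant \<alpha> * (t i - s i))"
      proof (rule sum_mono)
        fix i assume "i \<in> {..<n}"
        then have i: "i < n" by simp
        have "h * real (card (J i)) = h * real (hi m i) - h * real (lo m i)"
          unfolding J_def using ends(3)[OF i] by (simp add: of_nat_diff right_diff_distrib)
        also have "\<dots> \<le> t i - s i" using ends[OF i] by linarith
        finally have "cumulant \<alpha> * (h * real (card (J i))) \<le> cumulant \<alpha> * (t i - s i)" using cumulant_nonneg by (rule mult_left_mono)
        then show "h * cumulant \<alpha> * real (card (J i)) \<le> cumulant \<alpha> * (t i - s i)" by (simp add: mult.left_commute mult.commute mult.assoc)
      qed
      also have "\<dots> = cumulant \<alpha> * (\<Sum>i<n. t i - s i)" by (simp add: sum_distrib_left)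
      also have "\<dots> \<le> cumulant \<alpha> * \<delta>" using len cumulant_nonneg by (intro mult_left_mono) auto
      finally have "\<alpha> * (\<Sum>i<n. dist (\<gamma> (h * real (lo m i))) (\<gamma> (h * real (hi m i)))) \<le> \<bar>a\<bar> + 1"
        using E[of m] \<delta>(2) by linarith
      then show "(\<Sum>i<n. dist (\<gamma> (mesh T m * real (lo m i))) (\<gamma> (mesh T m * real (hi m i)))) \<le> \<epsilon> / 2"
      proof -
        assume le: "\<alpha> * (\<Sum>i<n. dist (\<gamma> (h * real (lo m i))) (\<gamma> (h * real (hi m i)))) \<le> \<bar>a\<bar> + 1"
        have "(\<bar>a\<bar> + 1) / \<alpha> = \<epsilon> / 2" unfolding \<alpha>_def using \<epsilon> by (simp add: field_simps)
        then show ?thesis using le \<alpha> unfolding h_def[symmetric] by (metis mult.commute pos_le_divide_eq)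
      qed
    qed
    have "(\<Sum>i<n. dist (\<gamma> (s i)) (\<gamma> (t i))) \<le> \<epsilon> / 2"
      by (rule tendsto_upperbound[OF lim ev]) simp
    then show "(\<Sum>i<n. dist (\<gamma> (t i)) (\<gamma> (s i))) < \<epsilon>" using \<epsilon> by (simp add: dist_commute)
  qed (rule \<delta>(1))
qed

text \<open>The difference quotients at dyadic scales converge almost everywhere to the derivative, so
  Fatou's lemma bounds the action by the limit of the energies.\<close>

theorem rate_le_energy_bound:
  assumes T: "T > 0" and \<gamma>: "continuous_on {0..T} \<gamma>" and E: "\<And>m. energy T m \<gamma> \<le> a"
  shows "rate_function T (\<gamma> 0) \<gamma> \<le> ereal a"
proof -
  have ac: "abs_continuous T \<gamma>" by (rule energy_abs_continuous[OF T \<gamma> E])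
  obtain \<theta> g where \<theta>: "continuous_on {0..T} \<theta>" "\<And>t. t \<in> {0..T} \<Longrightarrow> \<gamma> t = circle_of (\<theta> t)"
    and g: "g \<in> borel_measurable borel" "AE x in lebesgue. x \<in> {0<..<T} \<longrightarrow> (\<theta> has_real_derivative g x) (at x)"
    "(\<integral>\<^sup>+ s\<in>{0..T}. ennreal (lagrangian (circle_deriv T \<gamma> s)) \<partial>lebesgue) =
     (\<integral>\<^sup>+ s. ennreal (lagrangian (g s)) * indicator {0..<T} s \<partial>lebesgue)"
    by (rule abs_continuous_derivative[OF T ac]) blast
  let ?u = "\<lambda>n x. ennreal (lagrangian (step_quotient \<theta> 0 (mesh T n) x)) * indicator {0..<T} x"
  have "uniformly_continuous_on {0..T} \<theta>" using \<theta>(1) by (intro compact_uniformly_continuous) auto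
  then obtain d where d: "d > 0" "\<And>s t. s \<in> {0..T} \<Longrightarrow> t \<in> {0..T} \<Longrightarrow> dist t s < d \<Longrightarrow> dist (\<theta> t) (\<theta> s) < 1 / 2"
    unfolding uniformly_continuous_on_def by (meson half_gt_zero zero_less_one)
  have "\<forall>\<^sub>F n in sequentially. mesh T n < d" by (rule order_tendstoD(2)[OF mesh_tendsto d(1)])
  then have ev: "\<forall>\<^sub>F n in sequentially. (\<integral>\<^sup>+ x. ?u n x \<partial>lebesgue) \<le> ennreal a"
  proof (rule eventually_mono)
    fix n assume n: "mesh T n < d"
    define h where "h = mesh T n"
    have h: "h > 0" "h < d" "h * real (2 ^ n) = T" using mesh_pos[OF T] mesh_total n unfolding h_def by auto
    have "(\<integral>\<^sup>+ x. ?u n x \<partial>lebesgue) = (\<Sum>i<2 ^ n. ennreal h * ennreal (lagrangian ((\<theta> (h * real (Suc i)) - \<theta> (h * real i)) / h)))"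
      using nn_integral_step_quotient[OF h(1), of "\<lambda>q. ennreal (lagrangian q)" \<theta> 0 "2 ^ n"] h(3) unfolding h_def by simp
    also have "\<dots> = (\<Sum>i<2 ^ n. ennreal (h * lagrangian (dist (\<gamma> (h * real i)) (\<gamma> (h * real (Suc i))) / h)))"
    proof (rule sum.cong[OF refl])
      fix i :: nat assume i: "i \<in> {..<2 ^ n}"
      have "real (Suc i) \<le> real (2 ^ n)" using i by (metis Suc_leI lessThan_iff of_nat_le_iff)
      then have "h * real (Suc i) \<le> h * real (2 ^ n)" using h by (intro mult_left_mono) auto
      then have in01: "h * real i \<in> {0..T}" "h * real (Suc i) \<in> {0..T}" using h by (auto simp: algebra_simps)
      have "dist (\<theta> (h * real (Suc i))) (\<theta> (h * real i)) < 1 / 2"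
        using h by (intro d(2) in01) (simp add: dist_real_def algebra_simps)
      then have "dist (\<gamma> (h * real i)) (\<gamma> (h * real (Suc i))) = \<bar>\<theta> (h * real (Suc i)) - \<theta> (h * real i)\<bar>"
        unfolding \<theta>(2)[OF in01(1)] \<theta>(2)[OF in01(2)] by (subst dist_commute, subst dist_circle_of_eq) (auto simp: dist_real_def)
      then have "dist (\<gamma> (h * real i)) (\<gamma> (h * real (Suc i))) / h = \<bar>(\<theta> (h * real (Suc i)) - \<theta> (h * real i)) / h\<bar>"
        using h by simp
      then show "ennreal h * ennreal (lagrangian ((\<theta> (h * real (Suc i)) - \<theta> (h * real i)) / h)) =
        ennreal (h * lagrangian (dist (\<gamma> (h * real i)) (\<gamma> (h * real (Suc i))) / h))"
        using h lagrangian_nonneg by (simp only: lagrangian_abs) (simp add: ennreal_mult)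
    qed
    also have "\<dots> = ennreal (energy T n \<gamma>)"
      unfolding energy_def h_def by (rule sum_ennreal) (simp add: energy_terms_nonneg[OF T])
    also have "\<dots> \<le> ennreal a" by (intro ennreal_leI E)
    finally show "(\<integral>\<^sup>+ x. ?u n x \<partial>lebesgue) \<le> ennreal a" .
  qed
  have "AE x in lebesgue. x \<noteq> 0" by (metis AE_completion AE_lborel_singleton)
  then have "AE x in lebesgue. ennreal (lagrangian (g x)) * indicator {0..<T} x = liminf (\<lambda>n. ?u n x)"
    using g(2)
  proof eventually_elim
    case (elim x)
    show ?case
    proof (cases "x \<in> {0<..<T}")
      case True
      then have "(\<lambda>n. step_quotient \<theta> 0 (mesh T n) x) \<longlonglongrightarrow> g x"
        using elim by (intro step_quotient_tendsto mesh_pos[OF T] mesh_tendsto) auto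
      then have "(\<lambda>n. ?u n x) \<longlonglongrightarrow> ennreal (lagrangian (g x)) * indicator {0..<T} x"
        using True by (auto intro!: tendsto_ennrealI lagrangian_tendsto)
      then show ?thesis by (intro lim_imp_Liminf[symmetric]) auto
    next
      case False
      then have "x \<notin> {0..<T}" using elim by auto
      then show ?thesis by (simp add: Liminf_const)
    qed
  qed
  then have "(\<integral>\<^sup>+ s. ennreal (lagrangian (g s)) * indicator {0..<T} s \<partial>lebesgue) = (\<integral>\<^sup>+ x. liminf (\<lambda>n. ?u n x) \<partial>lebesgue)"
    by (rule nn_integral_cong_AE)
  also have "\<dots> \<le> liminf (\<lambda>n. \<integral>\<^sup>+ x. ?u n x \<partial>lebesgue)"
    by (rule nn_integral_liminf, rule borel_measurable_lebesgueI) simp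
  also have "\<dots> \<le> ennreal a"
    using Liminf_mono[OF ev] by (simp add: Liminf_const)
  finally have I: "(\<integral>\<^sup>+ s\<in>{0..T}. ennreal (lagrangian (circle_deriv T \<gamma> s)) \<partial>lebesgue) \<le> ennreal a" unfolding g(3) .
  have "0 \<le> energy T 0 \<gamma>" unfolding energy_def by (intro sum_nonneg energy_terms_nonneg[OF T])
  then have "a \<ge> 0" using E[of 0] by linarith
  then have "enn2ereal (ennreal a) = ereal a" by (simp add: enn2ereal_ennreal)
  moreover have "enn2ereal (\<integral>\<^sup>+ s\<in>{0..T}. ennreal (lagrangian (circle_deriv T \<gamma> s)) \<partial>lebesgue) \<le> enn2ereal (ennreal a)"
    using I by (simp only: less_eq_ennreal.rep_eq)
  ultimately show ?thesis using ac unfolding rate_function_def by simp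
qed

section \<open>Compactness of paths with small energy\<close>

lemma circle_limit_of_coord:
  assumes "(\<lambda>n. coord (x n)) \<longlonglongrightarrow> l"
  shows "x \<longlonglongrightarrow> circle_of l"
proof (rule metric_tendsto_imp_tendsto[OF assms])
  show "\<forall>\<^sub>F n in sequentially. dist (x n) (circle_of l) \<le> dist (coord (x n)) l"
    using dist_circle_of_le[of "coord (x _)" l] by (auto simp: dist_real_def)
qed

lemma circle_Cauchy_convergent:
  fixes x :: "nat \<Rightarrow> circle"
  assumes "Cauchy x"
  shows "convergent x"
proof -
  have "range (\<lambda>n. coord (x n)) \<subseteq> {0..1}" by (auto simp: coord_lt_1[THEN less_imp_le])
  then have "bounded (range (\<lambda>n. coord (x n)))" by (rule bounded_subset[OF bounded_closed_interval])
  then obtain l r where "strict_mono r" "((\<lambda>n. coord (x n)) \<circ> r) \<longlonglongrightarrow> l"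
    using bounded_imp_convergent_subsequence by blast
  then have "(x \<circ> r) \<longlonglongrightarrow> circle_of l" using circle_limit_of_coord[of "x \<circ> r" l] by (simp add: o_def)
  then have "x \<longlonglongrightarrow> circle_of l" using assms \<open>strict_mono r\<close> by (rule Cauchy_converges_subseq[rotated 2])
  then show ?thesis by (rule convergentI)
qed

text \<open>The identity is an admissible time change.\<close>

lemma skorohod_dist_le:
  assumes T: "T > 0" and "\<And>t. t \<in> {0..T} \<Longrightarrow> dist (\<gamma> t) (\<eta> t) \<le> e"
  shows "skorohod_dist T \<gamma> \<eta> \<le> e"
  unfolding skorohod_dist_def
proof (rule cInf_lower)
  have "e \<ge> 0" using order_trans[OF zero_le_dist assms(2)[of 0]] T by simp
  then show "e \<in> {e. \<exists>\<mu>\<in>time_changes T. \<forall>t\<in>{0..T}. \<bar>\<mu> t - t\<bar> \<le> e \<and> dist (\<gamma> t) (\<eta> (\<mu> t)) \<le> e}"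
    using assms(2) id_time_change by (intro CollectI bexI[of _ "\<lambda>t. t"]) auto
  show "bdd_below {e. \<exists>\<mu>\<in>time_changes T. \<forall>t\<in>{0..T}. \<bar>\<mu> t - t\<bar> \<le> e \<and> dist (\<gamma> t) (\<eta> (\<mu> t)) \<le> e}"
    using T by (intro bdd_belowI[of _ 0]) force
qed

lemma skorohod_open_ball:
  assumes T: "T > 0" and U: "openin (skorohod_topology T) U" and \<gamma>: "\<gamma> \<in> U"
  obtains r where "r > 0" "\<And>\<eta>. \<eta> \<in> skorohod_space T \<Longrightarrow> (\<And>t. t \<in> {0..T} \<Longrightarrow> dist (\<gamma> t) (\<eta> t) \<le> r) \<Longrightarrow> \<eta> \<in> U"
proof -
  interpret S: Metric_space "skorohod_space T" "skorohod_dist T" by (rule Metric_space_skorohod[OF T])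
  obtain r where r: "r > 0" "S.mball \<gamma> r \<subseteq> U"
    using U \<gamma> unfolding skorohod_topology_def S.openin_mtopology by blast
  have gS: "\<gamma> \<in> skorohod_space T" using U \<gamma> unfolding skorohod_topology_def S.openin_mtopology by blast
  show ?thesis
  proof (rule that[of "r / 2"])
    fix \<eta> assume \<eta>: "\<eta> \<in> skorohod_space T" "\<And>t. t \<in> {0..T} \<Longrightarrow> dist (\<gamma> t) (\<eta> t) \<le> r / 2"
    have "skorohod_dist T \<gamma> \<eta> \<le> r / 2" by (rule skorohod_dist_le[OF T \<eta>(2)])
    then show "\<eta> \<in> U" using r \<eta>(1) gS by (intro subsetD[OF r(2)]) (simp add: S.in_mball)
  qed (use r in simp)
qed

text \<open>Small energy controls a path at grid times only; this controls a path with jumps between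
  them.\<close>

definition cell_oscillation_le :: "real \<Rightarrow> nat \<Rightarrow> real \<Rightarrow> (real \<Rightarrow> circle) \<Rightarrow> bool" where
  "cell_oscillation_le T n \<delta> \<gamma> \<longleftrightarrow>
     (\<forall>i<2 ^ n. \<forall>t\<in>{mesh T n * real i..mesh T n * real (Suc i)}. dist (\<gamma> (mesh T n * real i)) (\<gamma> t) \<le> \<delta>)"

lemma grid_cell:
  assumes T: "T > 0" and t: "t \<in> {0..T}"
  obtains i where "i < 2 ^ n" "t \<in> {mesh T n * real i..mesh T n * real (Suc i)}"
proof (cases "t = T")
  case True
  have "real (Suc (2 ^ n - 1)) = 2 ^ n" by simp
  moreover have "mesh T n * real (2 ^ n - 1) \<le> mesh T n * real (2 ^ n)"
    using mesh_pos[OF T, of n] by (intro mult_left_mono) auto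
  ultimately show ?thesis using that[of "2 ^ n - 1"] True mesh_total[of T n] by (simp add: of_nat_diff)
next
  case False
  define h where "h = mesh T n"
  have h: "h > 0" "h * 2 ^ n = T" using mesh_pos[OF T] mesh_total[of T n] unfolding h_def by auto
  define i where "i = nat \<lfloor>t / h\<rfloor>"
  have "0 \<le> t / h" using t h by simp
  then have "real i = of_int \<lfloor>t / h\<rfloor>" unfolding i_def by (simp add: of_nat_nat)
  then have i: "real i \<le> t / h" "t / h < real (Suc i)" unfolding of_nat_Suc by linarith+
  then have "h * real i \<le> t" "t < h * real (Suc i)" using h by (auto simp: field_simps)
  moreover have "t / h < 2 ^ n" using h t False by (simp add: field_simps)
  then have "real i < 2 ^ n" using i by linarith
  then have "i < 2 ^ n" by (metis of_nat_less_iff of_nat_numeral of_nat_power)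
  ultimately show ?thesis using that[of i] unfolding h_def by auto
qed

text \<open>One modulus of continuity serves all levels, because the energy of a coarse block is at
  most the energy of the path.\<close>

lemma energy_modulus:
  assumes T: "T > 0" and \<epsilon>: "\<epsilon> > 0"
  obtains \<rho> where "\<rho> > 0" "\<And>n \<gamma> i j. energy T n \<gamma> \<le> a \<Longrightarrow> i \<le> 2 ^ n \<Longrightarrow> j \<le> 2 ^ n \<Longrightarrow>
     \<bar>mesh T n * real i - mesh T n * real j\<bar> < \<rho> \<Longrightarrow> dist (\<gamma> (mesh T n * real i)) (\<gamma> (mesh T n * real j)) \<le> \<epsilon>"
proof -
  define \<alpha> where "\<alpha> = (\<bar>a\<bar> + 1) / \<epsilon>"
  have \<alpha>: "\<alpha> > 0" unfolding \<alpha>_def using \<epsilon> by simp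
  define \<rho> where "\<rho> = 1 / (cumulant \<alpha> + 1)"
  have \<rho>: "\<rho> > 0" "\<rho> * cumulant \<alpha> \<le> 1" unfolding \<rho>_def using cumulant_nonneg[of \<alpha>] by (auto simp: field_simps)
  have *: "dist (\<gamma> (mesh T n * real i)) (\<gamma> (mesh T n * real j)) \<le> \<epsilon>"
    if E: "energy T n \<gamma> \<le> a" and ij: "i < j" "j \<le> 2 ^ n" and d: "mesh T n * real j - mesh T n * real i < \<rho>" for n \<gamma> i j
  proof -
    define r where "r = mesh T n * real (j - i)"
    define D where "D = dist (\<gamma> (mesh T n * real i)) (\<gamma> (mesh T n * real j))"
    have r: "r > 0" "r < \<rho>" unfolding r_def using ij d mesh_pos[OF T, of n] by (auto simp: of_nat_diff right_diff_distrib)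
    have "\<alpha> * D \<le> r * lagrangian (D / r) + r * cumulant \<alpha>" by (rule scaled_young[OF r(1)])
    also have "r * lagrangian (D / r) \<le> a"
      using energy_block_le[OF T ij, of \<gamma>] E unfolding r_def D_def by linarith
    also have "r * cumulant \<alpha> \<le> 1" using mult_right_mono[of r \<rho> "cumulant \<alpha>"] r \<rho>(2) cumulant_nonneg[of \<alpha>] by linarith
    finally have "\<alpha> * D \<le> \<bar>a\<bar> + 1" by linarith
    then have "D \<le> (\<bar>a\<bar> + 1) / \<alpha>" using \<alpha> by (simp add: pos_le_divide_eq mult.commute)
    also have "\<dots> = \<epsilon>" unfolding \<alpha>_def using \<epsilon> by (simp add: field_simps)
    finally show ?thesis unfolding D_def .
  qed
  show ?thesis
  proof (rule that[OF \<rho>(1)])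
    fix n \<gamma> i j assume E: "energy T n \<gamma> \<le> a" "i \<le> 2 ^ n" "j \<le> 2 ^ n"
      "\<bar>mesh T n * real i - mesh T n * real j\<bar> < \<rho>"
    consider "i < j" | "i = j" | "j < i" by linarith
    then show "dist (\<gamma> (mesh T n * real i)) (\<gamma> (mesh T n * real j)) \<le> \<epsilon>"
    proof cases
      case 1
      then show ?thesis using *[OF E(1) 1 E(3)] E(4) by simp
    next
      case 2
      then show ?thesis using \<epsilon> by simp
    next
      case 3
      then show ?thesis using *[OF E(1) 3 E(2)] E(4) by (simp add: dist_commute)
    qed
  qed
qed

lemma energy_oscillation_modulus:
  assumes T: "T > 0" and \<epsilon>: "\<epsilon> > 0"
  obtains \<rho> where "\<rho> > 0" "\<And>n \<gamma> \<delta> s t. energy T n \<gamma> \<le> a \<Longrightarrow> cell_oscillation_le T n \<delta> \<gamma> \<Longrightarrow> s \<in> {0..T} \<Longrightarrow> t \<in> {0..T} \<Longrightarrow>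
     \<bar>s - t\<bar> + 2 * mesh T n < \<rho> \<Longrightarrow> dist (\<gamma> s) (\<gamma> t) \<le> \<epsilon> + 2 * \<delta>"
proof -
  obtain \<rho> where \<rho>: "\<rho> > 0" "\<And>n \<gamma> i j. energy T n \<gamma> \<le> a \<Longrightarrow> i \<le> 2 ^ n \<Longrightarrow> j \<le> 2 ^ n \<Longrightarrow>
     \<bar>mesh T n * real i - mesh T n * real j\<bar> < \<rho> \<Longrightarrow> dist (\<gamma> (mesh T n * real i)) (\<gamma> (mesh T n * real j)) \<le> \<epsilon>"
    by (rule energy_modulus[OF T \<epsilon>, of a]) blast
  show ?thesis
  proof (rule that[OF \<rho>(1)])
    fix n \<gamma> \<delta> s t
    assume E: "energy T n \<gamma> \<le> a" "cell_oscillation_le T n \<delta> \<gamma>" "s \<in> {0..T}" "t \<in> {0..T}" "\<bar>s - t\<bar> + 2 * mesh T n < \<rho>"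
    define h where "h = mesh T n"
    obtain i where i: "i < 2 ^ n" "s \<in> {h * real i..h * real (Suc i)}" using grid_cell[OF T E(3), of n] unfolding h_def by blast
    obtain j where j: "j < 2 ^ n" "t \<in> {h * real j..h * real (Suc j)}" using grid_cell[OF T E(4), of n] unfolding h_def by blast
    have "dist (\<gamma> (h * real i)) (\<gamma> s) \<le> \<delta>" "dist (\<gamma> (h * real j)) (\<gamma> t) \<le> \<delta>"
      using E(2) i j unfolding cell_oscillation_le_def h_def by blast+
    moreover have "dist (\<gamma> (h * real i)) (\<gamma> (h * real j)) \<le> \<epsilon>"
      unfolding h_def
    proof (rule \<rho>(2)[OF E(1)])
      show "\<bar>mesh T n * real i - mesh T n * real j\<bar> < \<rho>"
      proof -
        have "h * real (Suc l) = h * real l + h" for l by (simp add: algebra_simps)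
        then show ?thesis using i(2) j(2) E(5) mesh_pos[OF T, of n] unfolding h_def[symmetric] atLeastAtMost_iff by (smt (verit))
      qed
    qed (use i j in auto)
    ultimately show "dist (\<gamma> s) (\<gamma> t) \<le> \<epsilon> + 2 * \<delta>"
      using dist_triangle[of "\<gamma> s" "\<gamma> t" "\<gamma> (h * real i)"] dist_triangle[of "\<gamma> (h * real i)" "\<gamma> t" "\<gamma> (h * real j)"]
      by (simp add: dist_commute)
  qed
qed

lemma continuous_in_skorohod_space:
  fixes \<gamma> :: "real \<Rightarrow> circle"
  assumes "continuous_on {0..T} \<gamma>" "\<gamma> \<in> extensional {0..T}"
  shows "\<gamma> \<in> skorohod_space T"
  unfolding skorohod_space_def cadlag_def
proof (intro CollectI conjI assms(2) ballI)
  fix t assume t: "t \<in> {0..<T}"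
  have "(\<gamma> \<longlongrightarrow> \<gamma> t) (at t within {0..T})" using assms(1) t by (auto simp: continuous_on_def)
  then have "(\<gamma> \<longlongrightarrow> \<gamma> t) (at t within {t..T})" by (rule tendsto_within_subset) (use t in auto)
  then show "(\<gamma> \<longlongrightarrow> \<gamma> t) (at_right t)" using t by (simp add: at_within_Icc_at_right)
next
  fix t assume t: "t \<in> {0<..T}"
  have "(\<gamma> \<longlongrightarrow> \<gamma> t) (at t within {0..T})" using assms(1) t by (auto simp: continuous_on_def)
  then have "(\<gamma> \<longlongrightarrow> \<gamma> t) (at t within {0..t})" by (rule tendsto_within_subset) (use t in auto)
  then show "\<exists>l. (\<gamma> \<longlongrightarrow> l) (at_left t)" using t by (auto simp: at_within_Icc_at_left)
qed

text \<open>An Arzela-Ascoli argument. A diagonal subsequence converges at all dyadic times; the paths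
  are asymptotically equicontinuous, so convergence is uniform and the limit is continuous. Its
  energies are limits of energies that increase with the level, hence bounded by
  \<open>a\<close>.\<close>

lemma low_energy_compactness:
  fixes \<gamma> :: "nat \<Rightarrow> real \<Rightarrow> circle"
  assumes T: "T > 0" and n: "\<And>j. n j \<ge> j" and \<delta>: "\<delta> \<longlonglongrightarrow> 0"
    and osc: "\<And>j. cell_oscillation_le T (n j) (\<delta> j) (\<gamma> j)" and E: "\<And>j. energy T (n j) (\<gamma> j) \<le> a"
  obtains \<eta> r where "strict_mono r" "continuous_on {0..T} \<eta>" "\<eta> \<in> extensional {0..T}" "\<And>m. energy T m \<eta> \<le> a"
    "uniform_limit {0..T} (\<lambda>j. \<gamma> (r j)) \<eta> sequentially"
proof -
  define S where "S = {mesh T m * real i | m i. i \<le> 2 ^ m}"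
  have "S \<subseteq> (\<lambda>(m, i). mesh T m * real i) ` UNIV" unfolding S_def by auto
  then have cS: "countable S" by (rule countable_subset) auto
  obtain r where r: "strict_mono r" "\<And>x. x \<in> S \<Longrightarrow> \<exists>l. (\<lambda>j. coord (\<gamma> (r j) x)) \<longlonglongrightarrow> l"
    by (rule function_convergent_subsequence[OF cS, of "\<lambda>j x. coord (\<gamma> j x)" 1]) (auto intro: less_imp_le)
  have rj: "r j \<ge> j" for j using r(1) by (rule seq_suble)
  have nr: "n (r j) \<ge> j" for j using rj[of j] n[of "r j"] by linarith
  have Sconv: "Cauchy (\<lambda>j. \<gamma> (r j) x)" if "x \<in> S" for x
  proof -
    obtain l where "(\<lambda>j. coord (\<gamma> (r j) x)) \<longlonglongrightarrow> l" using r(2)[OF \<open>x \<in> S\<close>] by blast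
    from circle_limit_of_coord[OF this] show ?thesis by (rule LIMSEQ_imp_Cauchy)
  qed
  have \<delta>r: "(\<lambda>j. \<delta> (r j)) \<longlonglongrightarrow> 0" using LIMSEQ_subseq_LIMSEQ[OF \<delta> r(1)] by (simp add: o_def)
  have mr: "(\<lambda>j. mesh T (n (r j))) \<longlonglongrightarrow> 0"
  proof (rule Lim_null_comparison[OF always_eventually mesh_tendsto[of T]], rule allI)
    fix j
    have "(2::real) ^ j \<le> 2 ^ n (r j)" using nr[of j] by (intro power_increasing) auto
    then show "norm (mesh T (n (r j))) \<le> mesh T j" unfolding mesh_def using T by (simp add: frac_le)
  qed
  \<comment> \<open>The paths jump, so they share a modulus of continuity only up to an error that vanishes
    along the sequence.\<close>
  have equi: "\<exists>\<rho>>0. \<forall>\<^sub>F j in sequentially. \<forall>s\<in>{0..T}. \<forall>t\<in>{0..T}. \<bar>s - t\<bar> < \<rho> \<longrightarrow> dist (\<gamma> (r j) s) (\<gamma> (r j) t) \<le> \<epsilon>"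
    if \<epsilon>: "\<epsilon> > 0" for \<epsilon>
  proof -
    have e: "\<epsilon> / 2 > 0" using \<epsilon> by simp
    obtain \<rho> where \<rho>: "\<rho> > 0" "\<And>n \<gamma> \<delta> s t. energy T n \<gamma> \<le> a \<Longrightarrow> cell_oscillation_le T n \<delta> \<gamma> \<Longrightarrow> s \<in> {0..T} \<Longrightarrow> t \<in> {0..T} \<Longrightarrow>
     \<bar>s - t\<bar> + 2 * mesh T n < \<rho> \<Longrightarrow> dist (\<gamma> s) (\<gamma> t) \<le> \<epsilon> / 2 + 2 * \<delta>"
      by (rule energy_oscillation_modulus[OF T e, of a]) blast
    have "\<forall>\<^sub>F j in sequentially. \<delta> (r j) < \<epsilon> / 4" "\<forall>\<^sub>F j in sequentially. mesh T (n (r j)) < \<rho> / 4"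
      by (rule order_tendstoD(2)[OF \<delta>r] order_tendstoD(2)[OF mr]; use \<epsilon> \<rho> in simp)+
    then have "\<forall>\<^sub>F j in sequentially. \<forall>s\<in>{0..T}. \<forall>t\<in>{0..T}. \<bar>s - t\<bar> < \<rho> / 2 \<longrightarrow> dist (\<gamma> (r j) s) (\<gamma> (r j) t) \<le> \<epsilon>"
    proof eventually_elim
      case (elim j)
      show ?case
      proof (intro ballI impI)
        fix s t assume st: "s \<in> {0..T}" "t \<in> {0..T}" "\<bar>s - t\<bar> < \<rho> / 2"
        have "dist (\<gamma> (r j) s) (\<gamma> (r j) t) \<le> \<epsilon> / 2 + 2 * \<delta> (r j)"
          by (rule \<rho>(2)[OF E osc st(1,2)]) (use st elim in linarith)
        then show "dist (\<gamma> (r j) s) (\<gamma> (r j) t) \<le> \<epsilon>" using elim by linarith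
      qed
    qed
    then show ?thesis using \<rho>(1) by (intro exI[of _ "\<rho> / 2"]) auto
  qed
  have ucauchy: "\<exists>N. \<forall>i\<ge>N. \<forall>j\<ge>N. \<forall>t\<in>{0..T}. dist (\<gamma> (r i) t) (\<gamma> (r j) t) < \<epsilon>" if \<epsilon>: "\<epsilon> > 0" for \<epsilon>
  proof -
    have e: "\<epsilon> / 4 > 0" using \<epsilon> by simp
    obtain \<rho> where \<rho>: "\<rho> > 0" "\<forall>\<^sub>F j in sequentially. \<forall>s\<in>{0..T}. \<forall>t\<in>{0..T}. \<bar>s - t\<bar> < \<rho> \<longrightarrow> dist (\<gamma> (r j) s) (\<gamma> (r j) t) \<le> \<epsilon> / 4"
      using equi[OF e] by blast
    obtain N1 where N1: "\<And>j s t. j \<ge> N1 \<Longrightarrow> s \<in> {0..T} \<Longrightarrow> t \<in> {0..T} \<Longrightarrow> \<bar>s - t\<bar> < \<rho> \<Longrightarrow> dist (\<gamma> (r j) s) (\<gamma> (r j) t) \<le> \<epsilon> / 4"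
      using \<rho>(2) unfolding eventually_sequentially by blast
    obtain m where m: "mesh T m < \<rho>"
      using order_tendstoD(2)[OF mesh_tendsto \<rho>(1), of T] unfolding eventually_sequentially by blast
    have "\<exists>N. \<forall>i\<ge>N. \<forall>j\<ge>N. dist (\<gamma> (r i) (mesh T m * real l)) (\<gamma> (r j) (mesh T m * real l)) < \<epsilon> / 4" if "l \<in> {..2 ^ m}" for l
    proof -
      have "mesh T m * real l \<in> S" using that unfolding S_def by auto
      then show ?thesis using Sconv e unfolding Cauchy_def by blast
    qed
    then obtain N2 where N2: "\<And>l i j. l \<le> 2 ^ m \<Longrightarrow> i \<ge> N2 l \<Longrightarrow> j \<ge> N2 l \<Longrightarrow> dist (\<gamma> (r i) (mesh T m * real l)) (\<gamma> (r j) (mesh T m * real l)) < \<epsilon> / 4"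
      by (metis atMost_iff)
    define N where "N = max N1 (Max (N2 ` {..2 ^ m}))"
    have NN2: "N \<ge> N2 l" if "l \<le> 2 ^ m" for l unfolding N_def using that by (intro max.coboundedI2 Max_ge) auto
    show ?thesis
    proof (intro exI[of _ N] allI impI ballI)
      fix i j t assume ij: "i \<ge> N" "j \<ge> N" and t: "t \<in> {0..T}"
      obtain l where l: "l < 2 ^ m" "t \<in> {mesh T m * real l..mesh T m * real (Suc l)}" by (rule grid_cell[OF T t])
      define x where "x = mesh T m * real l"
      have x0: "x \<ge> 0" unfolding x_def using mesh_pos[OF T, of m] by simp
      have x: "x \<in> {0..T}" "\<bar>t - x\<bar> < \<rho>" using l m t x0 unfolding x_def by (auto simp: algebra_simps)
      have "dist (\<gamma> (r i) x) (\<gamma> (r j) x) < \<epsilon> / 4"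
        unfolding x_def by (rule N2) (use l NN2[of l] ij in auto)
      moreover have "dist (\<gamma> (r i) t) (\<gamma> (r i) x) \<le> \<epsilon> / 4" "dist (\<gamma> (r j) t) (\<gamma> (r j) x) \<le> \<epsilon> / 4"
        by (rule N1; use ij x t in \<open>simp add: N_def\<close>)+
      ultimately show "dist (\<gamma> (r i) t) (\<gamma> (r j) t) < \<epsilon>"
        using dist_triangle[of "\<gamma> (r i) t" "\<gamma> (r j) t" "\<gamma> (r i) x"] dist_triangle[of "\<gamma> (r i) x" "\<gamma> (r j) t" "\<gamma> (r j) x"] e
        by (simp add: dist_commute)
    qed
  qed
  have "\<exists>l. (\<lambda>j. \<gamma> (r j) t) \<longlonglongrightarrow> l" if "t \<in> {0..T}" for t
  proof -
    have "Cauchy (\<lambda>j. \<gamma> (r j) t)" unfolding Cauchy_def using ucauchy that by blast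
    then show ?thesis using circle_Cauchy_convergent unfolding convergent_def by blast
  qed
  then obtain \<eta>0 where \<eta>0: "\<And>t. t \<in> {0..T} \<Longrightarrow> (\<lambda>j. \<gamma> (r j) t) \<longlonglongrightarrow> \<eta>0 t" by metis
  define \<eta> where "\<eta> = restrict \<eta>0 {0..T}"
  have \<eta>: "(\<lambda>j. \<gamma> (r j) t) \<longlonglongrightarrow> \<eta> t" if "t \<in> {0..T}" for t using \<eta>0[OF that] that unfolding \<eta>_def by simp
  have ul: "uniform_limit {0..T} (\<lambda>j. \<gamma> (r j)) \<eta> sequentially"
  proof (rule uniform_limitI)
    fix \<epsilon> :: real assume "\<epsilon> > 0"
    then have e: "\<epsilon> / 2 > 0" by simp
    obtain N where N: "\<And>i j t. i \<ge> N \<Longrightarrow> j \<ge> N \<Longrightarrow> t \<in> {0..T} \<Longrightarrow> dist (\<gamma> (r i) t) (\<gamma> (r j) t) < \<epsilon> / 2"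
      using ucauchy[OF e] by blast
    have "dist (\<gamma> (r i) t) (\<eta> t) < \<epsilon>" if "i \<ge> N" "t \<in> {0..T}" for i t
    proof -
      have "dist (\<gamma> (r i) t) (\<eta> t) \<le> \<epsilon> / 2"
      proof (rule tendsto_upperbound[OF tendsto_dist[OF tendsto_const \<eta>[OF that(2)]]])
        show "\<forall>\<^sub>F j in sequentially. dist (\<gamma> (r i) t) (\<gamma> (r j) t) \<le> \<epsilon> / 2"
          unfolding eventually_sequentially using N[OF that(1) _ that(2)] less_imp_le by blast
      qed simp
      then show ?thesis using e by simp
    qed
    then show "\<forall>\<^sub>F j in sequentially. \<forall>t\<in>{0..T}. dist (\<gamma> (r j) t) (\<eta> t) < \<epsilon>"
      unfolding eventually_sequentially by blast
  qed
  have cont: "continuous_on {0..T} \<eta>"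
    unfolding continuous_on_iff
  proof (intro ballI allI impI)
    fix s and \<epsilon> :: real assume s: "s \<in> {0..T}" and "\<epsilon> > 0"
    then have e: "\<epsilon> / 2 > 0" by simp
    obtain \<rho> where \<rho>: "\<rho> > 0" "\<forall>\<^sub>F j in sequentially. \<forall>s\<in>{0..T}. \<forall>t\<in>{0..T}. \<bar>s - t\<bar> < \<rho> \<longrightarrow> dist (\<gamma> (r j) s) (\<gamma> (r j) t) \<le> \<epsilon> / 2"
      using equi[OF e] by blast
    have "dist (\<eta> t) (\<eta> s) < \<epsilon>" if t: "t \<in> {0..T}" "dist t s < \<rho>" for t
    proof -
      have "dist (\<eta> t) (\<eta> s) \<le> \<epsilon> / 2"
        by (rule tendsto_upperbound[OF tendsto_dist[OF \<eta>[OF t(1)] \<eta>[OF s]] eventually_mono[OF \<rho>(2)]])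
           (use s t in \<open>auto simp: dist_real_def\<close>)
      then show ?thesis using e by simp
    qed
    then show "\<exists>d>0. \<forall>t\<in>{0..T}. dist t s < d \<longrightarrow> dist (\<eta> t) (\<eta> s) < \<epsilon>" using \<rho>(1) by blast
  qed
  have En: "energy T m \<eta> \<le> a" for m
  proof (rule tendsto_upperbound)
    have in01: "mesh T m * real i \<in> {0..T}" if "i \<le> 2 ^ m" for i
    proof -
      have "real i \<le> real (2 ^ m)" using that of_nat_le_iff by blast
      then have "mesh T m * real i \<le> mesh T m * real (2 ^ m)" using mesh_pos[OF T, of m] by (intro mult_left_mono) auto
      then have "mesh T m * real i \<le> T" unfolding mesh_total .
      then show ?thesis using mesh_pos[OF T, of m] by simp
    qed
    show "(\<lambda>j. energy T m (\<gamma> (r j))) \<longlonglongrightarrow> energy T m \<eta>"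
      unfolding energy_def using mesh_pos[OF T, of m]
      by (intro tendsto_sum tendsto_mult tendsto_const lagrangian_tendsto tendsto_divide tendsto_dist \<eta> in01) auto
    have "energy T m (\<gamma> (r j)) \<le> a" if "j \<ge> m" for j
      using energy_mono[OF T, of m "\<gamma> (r j)" "n (r j) - m"] nr[of j] that E[of "r j"] by simp
    then show "\<forall>\<^sub>F j in sequentially. energy T m (\<gamma> (r j)) \<le> a" unfolding eventually_sequentially by blast
  qed simp
  show ?thesis by (rule that[OF r(1) cont _ En ul]) (simp add: \<eta>_def)
qed

text \<open>Otherwise there are paths in \<open>C\<close> with energies at most \<open>a\<close> at finer and finer levels, with
  smaller and smaller oscillations between grid times, and with initial points tending to
  \<open>x\<^sub>0\<close>. They have a uniform limit, which starts at \<open>x\<^sub>0\<close>, lies in the closed set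
  \<open>C\<close>, and has rate at most \<open>a\<close>. The third conclusion makes larger oscillations as unlikely as
  large energies.\<close>

theorem closed_energy_gap:
  assumes T: "T > 0" and C: "closedin (skorohod_topology T) C"
    and a: "\<And>\<gamma>. \<gamma> \<in> C \<Longrightarrow> ereal a < rate_function T x\<^sub>0 \<gamma>"
  obtains n \<delta> \<eta> where "\<delta> > 0" "\<eta> > 0" "a \<le> mesh T n * lagrangian (\<delta> / mesh T n)"
    "\<And>\<gamma>. \<gamma> \<in> C \<Longrightarrow> cell_oscillation_le T n \<delta> \<gamma> \<Longrightarrow> dist (\<gamma> 0) x\<^sub>0 \<le> \<eta> \<Longrightarrow> a < energy T n \<gamma>"
proof (rule ccontr)
  assume no: "\<not> thesis"
  define \<delta> where "\<delta> = (\<lambda>j::nat. 1 / real (Suc j))"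
  have \<delta>0: "\<delta> \<longlonglongrightarrow> 0" unfolding \<delta>_def by real_asymp
  have \<delta>p: "\<delta> j > 0" for j unfolding \<delta>_def by simp
  have "\<exists>n\<ge>j. \<exists>\<gamma>. \<gamma> \<in> C \<and> cell_oscillation_le T n (\<delta> j) \<gamma> \<and> dist (\<gamma> 0) x\<^sub>0 \<le> \<delta> j \<and> energy T n \<gamma> \<le> a" for j
  proof -
    obtain h0 where h0: "h0 > 0" "\<And>h. 0 < h \<Longrightarrow> h < h0 \<Longrightarrow> a \<le> h * lagrangian (\<delta> j / h)"
      by (rule lagrangian_superlinear[OF \<delta>p[of j], of a]) blast
    have "\<forall>\<^sub>F n in sequentially. mesh T n < h0" by (rule order_tendstoD(2)[OF mesh_tendsto h0(1)])
    then obtain n where n: "n \<ge> j" "mesh T n < h0" unfolding eventually_sequentially by (meson nle_le)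
    have "a \<le> mesh T n * lagrangian (\<delta> j / mesh T n)" by (rule h0(2)[OF mesh_pos[OF T] n(2)])
    then show ?thesis using no that[OF \<delta>p[of j] \<delta>p[of j]] n(1) by (meson not_le)
  qed
  then obtain n \<gamma> where n: "\<And>j. n j \<ge> j" and \<gamma>: "\<And>j. \<gamma> j \<in> C" "\<And>j. cell_oscillation_le T (n j) (\<delta> j) (\<gamma> j)"
    "\<And>j. dist (\<gamma> j 0) x\<^sub>0 \<le> \<delta> j" "\<And>j. energy T (n j) (\<gamma> j) \<le> a" by metis
  obtain \<eta> r where \<eta>: "strict_mono r" "continuous_on {0..T} \<eta>" "\<eta> \<in> extensional {0..T}" "\<And>m. energy T m \<eta> \<le> a"
    "uniform_limit {0..T} (\<lambda>j. \<gamma> (r j)) \<eta> sequentially"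
    using low_energy_compactness[OF T n \<delta>0 \<gamma>(2,4)] by metis
  have \<eta>S: "\<eta> \<in> skorohod_space T" by (rule continuous_in_skorohod_space[OF \<eta>(2,3)])
  interpret S: Metric_space "skorohod_space T" "skorohod_dist T" by (rule Metric_space_skorohod[OF T])
  have top: "topspace (skorohod_topology T) = skorohod_space T" unfolding skorohod_topology_def by simp
  have "\<eta> \<in> C"
  proof (rule ccontr)
    assume "\<eta> \<notin> C"
    then have 1: "\<eta> \<in> skorohod_space T - C" using \<eta>S by simp
    have 2: "openin (skorohod_topology T) (skorohod_space T - C)" using C unfolding closedin_def top by simp
    obtain e where e: "e > 0" "\<And>\<zeta>. \<zeta> \<in> skorohod_space T \<Longrightarrow> (\<And>t. t \<in> {0..T} \<Longrightarrow> dist (\<eta> t) (\<zeta> t) \<le> e) \<Longrightarrow> \<zeta> \<in> skorohod_space T - C"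
      by (rule skorohod_open_ball[OF T 2 1]) blast
    obtain j where j: "\<And>t. t \<in> {0..T} \<Longrightarrow> dist (\<gamma> (r j) t) (\<eta> t) < e"
      using uniform_limitD[OF \<eta>(5) e(1)] unfolding eventually_sequentially by blast
    have "\<gamma> (r j) \<in> skorohod_space T" using \<gamma>(1) closedin_subset[OF C] top by auto
    then have "\<gamma> (r j) \<in> skorohod_space T - C" by (rule e(2)) (use j in \<open>auto simp: dist_commute less_imp_le\<close>)
    then show False using \<gamma>(1) by blast
  qed
  moreover have "\<eta> 0 = x\<^sub>0"
  proof -
    have "(\<lambda>j. \<gamma> (r j) 0) \<longlonglongrightarrow> \<eta> 0" using tendsto_uniform_limitI[OF \<eta>(5)] T by simp
    moreover have "(\<lambda>j. \<gamma> (r j) 0) \<longlonglongrightarrow> x\<^sub>0"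
    proof -
      have "(\<lambda>j. \<delta> (r j)) \<longlonglongrightarrow> 0" using LIMSEQ_subseq_LIMSEQ[OF \<delta>0 \<eta>(1)] by (simp add: o_def)
      then have "(\<lambda>j. dist (\<gamma> (r j) 0) x\<^sub>0) \<longlonglongrightarrow> 0"
        by (rule Lim_null_comparison[rotated]) (use \<gamma>(3) in auto)
      then show ?thesis by (rule tendsto_dist_iff[THEN iffD2])
    qed
    ultimately show ?thesis by (rule LIMSEQ_unique)
  qed
  ultimately show False using a[of \<eta>] rate_le_energy_bound[OF T \<eta>(2,4)] by auto
qed

section \<open>Transition probabilities of the walk\<close>

definition rotation :: "real \<Rightarrow> circle \<Rightarrow> circle" where
  "rotation s x = circle_of (coord x + s)"

lemma rotation_circle_of: "rotation s (circle_of a) = circle_of (a + s)"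
proof -
  have "frac a + s - (a + s) = of_int (- \<lfloor>a\<rfloor>)" by (simp add: frac_def)
  then show ?thesis unfolding rotation_def coord_circle_of circle_of_eq_iff by (metis Ints_of_int)
qed

lemma rotation_rotation: "rotation s (rotation t x) = rotation (s + t) x"
proof -
  have "rotation s (rotation t x) = rotation s (circle_of (coord x + t))" by (simp add: rotation_def)
  also have "\<dots> = rotation (s + t) x" unfolding rotation_circle_of by (simp add: rotation_def add_ac)
  finally show ?thesis .
qed

lemma rotation_0 [simp]: "rotation 0 x = x" by (simp add: rotation_def)

text \<open>The generator is \<open>k\<close> times this positive operator minus \<open>2 k\<close>, so its semigroup is
  \<open>exp (- 2 k t)\<close> times a series of positive terms that count nearest neighbour paths.\<close>

definition neighbour_sum :: "nat \<Rightarrow> (circle \<Rightarrow> real) \<Rightarrow> circle \<Rightarrow> real" where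
  "neighbour_sum k f x = f (rotation (1 / real k) x) + f (rotation (- (1 / real k)) x)"

definition walk_generator :: "nat \<Rightarrow> (circle \<Rightarrow> real) \<Rightarrow> circle \<Rightarrow> real" where
  "walk_generator k = (\<lambda>f x. real k * discrete_laplacian k f x)"

lemma walk_generator_eq: "walk_generator k f x = real k * neighbour_sum k f x - 2 * real k * f x"
  unfolding walk_generator_def discrete_laplacian_def neighbour_sum_def rotation_def by (simp add: algebra_simps)

definition iterated_sum :: "nat \<Rightarrow> nat \<Rightarrow> (circle \<Rightarrow> real) \<Rightarrow> circle \<Rightarrow> real" where
  "iterated_sum k n = neighbour_sum k ^^ n"

lemma iterated_sum_0 [simp]: "iterated_sum k 0 f = f" by (simp add: iterated_sum_def)

lemma iterated_sum_Suc: "iterated_sum k (Suc n) f = neighbour_sum k (iterated_sum k n f)"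
  by (simp add: iterated_sum_def)

lemma iterated_sum_Suc_apply:
  "iterated_sum k (Suc n) f x = iterated_sum k n f (rotation (1 / real k) x) + iterated_sum k n f (rotation (- (1 / real k)) x)"
  by (simp add: iterated_sum_Suc neighbour_sum_def)

text \<open>The binomial theorem for the commuting operators \<open>k * neighbour_sum k\<close> and \<open>- 2 k\<close>.\<close>

lemma generator_power:
  "(walk_generator k ^^ n) f x =
     (\<Sum>i\<le>n. real (n choose i) * (- 2 * real k) ^ (n - i) * (real k ^ i * iterated_sum k i f x))"
proof (induction n arbitrary: x)
  case 0
  then show ?case by simp
next
  case (Suc n)
  define c where "c = - 2 * real k"
  define b where "b = (\<lambda>i. real k ^ i * iterated_sum k i f x)"
  have shift: "real k * neighbour_sum k (\<lambda>x. \<Sum>i\<le>n. real (n choose i) * c ^ (n - i) * (real k ^ i * iterated_sum k i f x)) x =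
    (\<Sum>i\<le>n. real (n choose i) * c ^ (n - i) * b (Suc i))"
    unfolding neighbour_sum_def b_def iterated_sum_Suc_apply
    by (simp add: sum.distrib[symmetric] sum_distrib_left algebra_simps)
  have "(walk_generator k ^^ Suc n) f x = walk_generator k ((walk_generator k ^^ n) f) x" by simp
  also have "(walk_generator k ^^ n) f = (\<lambda>x. \<Sum>i\<le>n. real (n choose i) * c ^ (n - i) * (real k ^ i * iterated_sum k i f x))"
    using Suc.IH unfolding c_def by blast
  also have "walk_generator k \<dots> x = (\<Sum>i\<le>n. real (n choose i) * c ^ (n - i) * b (Suc i)) + c * (\<Sum>i\<le>n. real (n choose i) * c ^ (n - i) * b i)"
    unfolding walk_generator_eq shift by (simp add: c_def b_def)
  also have "c * (\<Sum>i\<le>n. real (n choose i) * c ^ (n - i) * b i) = (\<Sum>i\<le>n. real (n choose i) * c ^ (Suc n - i) * b i)"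
    unfolding sum_distrib_left by (intro sum.cong) (auto simp: Suc_diff_le)
  also have "\<dots> = (\<Sum>i\<le>Suc n. real (n choose i) * c ^ (Suc n - i) * b i)" by simp
  also have "\<dots> = c ^ Suc n * b 0 + (\<Sum>i\<le>n. real (n choose Suc i) * c ^ (n - i) * b (Suc i))"
    by (subst sum.atMost_Suc_shift) simp
  also have "(\<Sum>i\<le>n. real (n choose i) * c ^ (n - i) * b (Suc i)) + (c ^ Suc n * b 0 + (\<Sum>i\<le>n. real (n choose Suc i) * c ^ (n - i) * b (Suc i))) =
    c ^ Suc n * b 0 + (\<Sum>i\<le>n. real (Suc n choose Suc i) * c ^ (n - i) * b (Suc i))"
    by (simp add: sum.distrib[symmetric] algebra_simps)
  also have "\<dots> = (\<Sum>i\<le>Suc n. real (Suc n choose i) * c ^ (Suc n - i) * b i)"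
    by (subst sum.atMost_Suc_shift) simp
  finally show ?case unfolding c_def b_def .
qed

lemma neighbour_sum_mono: "(\<And>x. f x \<le> g x) \<Longrightarrow> neighbour_sum k f x \<le> neighbour_sum k g x"
  unfolding neighbour_sum_def by (intro add_mono) auto

lemma iterated_sum_mono: "(\<And>x. f x \<le> g x) \<Longrightarrow> iterated_sum k n f x \<le> iterated_sum k n g x"
  by (induction n arbitrary: x) (auto simp: iterated_sum_Suc intro!: neighbour_sum_mono)

lemma iterated_sum_nonneg: "(\<And>x. 0 \<le> f x) \<Longrightarrow> 0 \<le> iterated_sum k n f x"
  by (induction n arbitrary: x) (auto simp: iterated_sum_Suc_apply)

lemma iterated_sum_supersolution:
  assumes "\<And>x. neighbour_sum k w x \<le> c * w x" "c \<ge> 0"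
  shows "iterated_sum k n w x \<le> c ^ n * w x"
proof (induction n arbitrary: x)
  case (Suc n)
  have "iterated_sum k (Suc n) w x \<le> neighbour_sum k (\<lambda>x. c ^ n * w x) x"
    unfolding iterated_sum_Suc by (intro neighbour_sum_mono Suc)
  also have "\<dots> = c ^ n * neighbour_sum k w x" by (simp add: neighbour_sum_def distrib_left)
  also have "\<dots> \<le> c ^ n * (c * w x)" using assms by (intro mult_left_mono) auto
  finally show ?case by (simp add: mult_ac)
qed simp

lemma iterated_sum_lin:
  "finite A \<Longrightarrow> iterated_sum k n (\<lambda>z. \<Sum>y\<in>A. w y * f y z) x = (\<Sum>y\<in>A. w y * iterated_sum k n (f y) x)"
  by (induction n arbitrary: x) (simp_all add: iterated_sum_Suc_apply sum.distrib[symmetric] distrib_left)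

definition trans_prob :: "nat \<Rightarrow> real \<Rightarrow> circle \<Rightarrow> circle \<Rightarrow> real" where
  "trans_prob k t x y = semigroup_of (walk_generator k) t (indicator {y}) x"

definition path_count :: "nat \<Rightarrow> nat \<Rightarrow> circle \<Rightarrow> circle \<Rightarrow> real" where
  "path_count k n x y = iterated_sum k n (indicator {y}) x"

lemma path_count_bounds: "0 \<le> path_count k n x y" "path_count k n x y \<le> 2 ^ n"
proof -
  show "0 \<le> path_count k n x y" unfolding path_count_def by (rule iterated_sum_nonneg) simp
  have "path_count k n x y \<le> iterated_sum k n (\<lambda>_. 1) x"
    unfolding path_count_def by (rule iterated_sum_mono) (simp add: indicator_def)
  also have "\<dots> \<le> 2 ^ n * 1" by (rule iterated_sum_supersolution) (auto simp: neighbour_sum_def)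
  finally show "path_count k n x y \<le> 2 ^ n" by simp
qed

text \<open>The Cauchy product of the series of \<open>exp (- 2 k t)\<close> and \<open>exp (k t * neighbour_sum
  k)\<close>.\<close>

lemma trans_prob_sums:
  assumes t: "t \<ge> 0"
  shows "(\<lambda>n. exp (- 2 * real k * t) * ((real k * t) ^ n / fact n * path_count k n x y)) sums trans_prob k t x y"
proof -
  define a where "a = (\<lambda>n. (real k * t) ^ n / fact n * path_count k n x y)"
  define b where "b = (\<lambda>n. (- 2 * real k * t) ^ n / fact n)"
  have exp_sums: "(\<lambda>n. z ^ n / fact n) sums exp z" for z :: real
    using exp_converges[of z] by (simp add: field_simps)
  have b: "b sums exp (- 2 * real k * t)" unfolding b_def by (rule exp_sums)
  have sb: "summable (\<lambda>n. norm (b n))"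
    unfolding b_def using summable_norm_exp[of "- 2 * real k * t"] by (simp add: field_simps)
  have sa: "summable (\<lambda>n. norm (a n))"
  proof (rule summable_comparison_test'[of "\<lambda>n. (2 * (real k * t)) ^ n / fact n" 0])
    show "summable (\<lambda>n. (2 * (real k * t)) ^ n / fact n)" using exp_sums sums_summable by blast
    fix n
    have "norm (norm (a n)) = (real k * t) ^ n / fact n * path_count k n x y"
      unfolding a_def using t path_count_bounds by simp
    also have "\<dots> \<le> (real k * t) ^ n / fact n * 2 ^ n" using t path_count_bounds by (intro mult_left_mono) auto
    finally show "norm (norm (a n)) \<le> (2 * (real k * t)) ^ n / fact n" by (simp add: power_mult_distrib mult_ac)
  qed
  have "(\<lambda>n. \<Sum>i\<le>n. a i * b (n - i)) sums ((\<Sum>n. a n) * (\<Sum>n. b n))" by (rule Cauchy_product_sums[OF sa sb])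
  moreover have "(\<Sum>i\<le>n. a i * b (n - i)) = t ^ n / fact n * (walk_generator k ^^ n) (indicator {y}) x" for n
    unfolding generator_power sum_distrib_left
  proof (rule sum.cong[OF refl])
    fix i assume i: "i \<in> {..n}"
    have tn: "t ^ n = t ^ i * t ^ (n - i)" using i by (simp add: power_add[symmetric])
    obtain c where c: "c = - 2 * real k" by simp
    show "a i * b (n - i) = t ^ n / fact n * (real (n choose i) * (- 2 * real k) ^ (n - i) * (real k ^ i * iterated_sum k i (indicator {y}) x))"
    proof -
      have "i \<le> n" using i by simp
      then have bf: "real (n choose i) = fact n / (fact i * fact (n - i))" by (rule binomial_fact)
      show ?thesis unfolding a_def b_def path_count_def tn c[symmetric] power_mult_distrib bf by simp
    qed
  qed
  ultimately have "(\<lambda>n. t ^ n / fact n * (walk_generator k ^^ n) (indicator {y}) x) sums ((\<Sum>n. a n) * (\<Sum>n. b n))"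
    by (simp only:)
  then have 1: "trans_prob k t x y = (\<Sum>n. a n) * exp (- 2 * real k * t)"
    unfolding trans_prob_def semigroup_of_def sums_unique[OF b] by (rule sums_unique[symmetric])
  have "a sums (\<Sum>n. a n)" using sa summable_norm_cancel summable_sums by blast
  from sums_mult[OF this, of "exp (- 2 * real k * t)"] show ?thesis unfolding 1 a_def by (simp add: mult.commute)
qed

lemma trans_prob_nonneg: "t \<ge> 0 \<Longrightarrow> 0 \<le> trans_prob k t x y"
  by (rule sums_le[OF _ sums_zero trans_prob_sums]) (auto simp: path_count_bounds)

text \<open>If the neighbours of any point carry at most \<open>2 c\<close> times its weight, then the weight grows
  at most by the factor \<open>exp (k t (2 c - 2))\<close> in mean. With \<open>w = 1\<close> this says that the kernel
  has mass at most one.\<close>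

lemma trans_prob_supersolution:
  assumes t: "t \<ge> 0" and w: "\<And>x. 0 \<le> w x" "\<And>x. neighbour_sum k w x \<le> 2 * c * w x" "c \<ge> 0" and A: "finite A"
  shows "(\<Sum>y\<in>A. trans_prob k t x y * w y) \<le> exp (real k * t * (2 * c - 2)) * w x"
proof (rule sums_le)
  show "(\<lambda>n. \<Sum>y\<in>A. exp (- 2 * real k * t) * ((real k * t) ^ n / fact n * path_count k n x y) * w y) sums
    (\<Sum>y\<in>A. trans_prob k t x y * w y)"
    by (intro sums_sum sums_mult2 trans_prob_sums t)
  have "(\<lambda>n. (2 * c * (real k * t)) ^ n / fact n) sums exp (2 * c * (real k * t))"
    using exp_converges[of "2 * c * (real k * t)"] by (simp add: field_simps)
  from sums_mult[OF this, of "exp (- 2 * real k * t) * w x"]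
  have "(\<lambda>n. exp (- 2 * real k * t) * w x * ((2 * c * (real k * t)) ^ n / fact n)) sums (exp (- 2 * real k * t) * w x * exp (2 * c * (real k * t)))" .
  also have "exp (- 2 * real k * t) * w x * exp (2 * c * (real k * t)) = exp (- 2 * real k * t + 2 * c * (real k * t)) * w x"
    by (simp only: exp_add mult_ac)
  also have "- 2 * real k * t + 2 * c * (real k * t) = real k * t * (2 * c - 2)" by (simp add: algebra_simps)
  finally show "(\<lambda>n. exp (- 2 * real k * t) * w x * ((2 * c * (real k * t)) ^ n / fact n)) sums (exp (real k * t * (2 * c - 2)) * w x)" .
  fix n
  have ind: "(\<Sum>y\<in>A. w y * indicator {y} z) \<le> w z" for z
  proof -
    have "(\<Sum>y\<in>A. w y * indicator {y} z) = (\<Sum>y\<in>A. if y = z then w y else 0)"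
      by (intro sum.cong) (auto simp: indicator_def)
    also have "\<dots> \<le> w z" using A w(1)[of z] by (simp add: sum.delta)
    finally show ?thesis .
  qed
  have "(\<Sum>y\<in>A. w y * path_count k n x y) = iterated_sum k n (\<lambda>z. \<Sum>y\<in>A. w y * indicator {y} z) x"
    unfolding path_count_def iterated_sum_lin[OF A] ..
  also have "\<dots> \<le> iterated_sum k n w x" by (rule iterated_sum_mono) (rule ind)
  also have "\<dots> \<le> (2 * c) ^ n * w x" by (rule iterated_sum_supersolution) (use w in auto)
  finally have *: "(\<Sum>y\<in>A. w y * path_count k n x y) \<le> (2 * c) ^ n * w x" .
  have "(\<Sum>y\<in>A. exp (- 2 * real k * t) * ((real k * t) ^ n / fact n * path_count k n x y) * w y) =
    exp (- 2 * real k * t) * ((real k * t) ^ n / fact n) * (\<Sum>y\<in>A. w y * path_count k n x y)"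
    unfolding sum_distrib_left by (intro sum.cong) (auto simp: mult_ac)
  also have "\<dots> \<le> exp (- 2 * real k * t) * ((real k * t) ^ n / fact n) * ((2 * c) ^ n * w x)"
    by (rule mult_left_mono[OF *]) (use t in auto)
  also have "\<dots> = exp (- 2 * real k * t) * w x * ((2 * c * (real k * t)) ^ n / fact n)"
    by (simp add: power_mult_distrib mult_ac)
  finally show "(\<Sum>y\<in>A. exp (- 2 * real k * t) * ((real k * t) ^ n / fact n * path_count k n x y) * w y) \<le>
    exp (- 2 * real k * t) * w x * ((2 * c * (real k * t)) ^ n / fact n)" .
qed

lemma trans_prob_total: "t \<ge> 0 \<Longrightarrow> finite A \<Longrightarrow> (\<Sum>y\<in>A. trans_prob k t x y) \<le> 1"
  using trans_prob_supersolution[of t "\<lambda>_. 1" k 1 A x] by (simp add: neighbour_sum_def)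

text \<open>On the line equality holds, by the addition theorem. On the circle the distance to
  \<open>c\<close> of a neighbour is at most the absolute value of the lifted displacement, so wrapping
  around can only help.\<close>

lemma cosh_dist_supersolution:
  assumes k: "k \<ge> 1"
  shows "neighbour_sum k (\<lambda>z. cosh (\<alpha> * real k * dist z c)) x \<le> 2 * cosh \<alpha> * cosh (\<alpha> * real k * dist x c)"
proof -
  define u where "u = signed_arc c x"
  have x: "x = circle_of (coord c + u)" unfolding u_def using circle_of_add_signed_arc[of "coord c" c x] by simp
  have du: "dist x c = \<bar>u\<bar>" unfolding u_def abs_signed_arc_eq_dist by (rule dist_commute)
  have cu: "cosh (\<alpha> * real k * dist (rotation s x) c) \<le> cosh (\<alpha> * real k * (u + s))" for s
  proof -
    have "dist (rotation s x) c = dist (circle_of (coord c + u + s)) (circle_of (coord c))"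
      unfolding x rotation_circle_of by simp
    also have "\<dots> \<le> \<bar>u + s\<bar>" using dist_circle_of_le[of "coord c + u + s" "coord c"] by simp
    finally have "\<bar>\<alpha> * real k\<bar> * dist (rotation s x) c \<le> \<bar>\<alpha> * real k\<bar> * \<bar>u + s\<bar>" by (rule mult_left_mono) simp
    then have "cosh (\<bar>\<alpha> * real k\<bar> * dist (rotation s x) c) \<le> cosh (\<bar>\<alpha> * real k\<bar> * \<bar>u + s\<bar>)"
      by (subst cosh_real_nonneg_le_iff) auto
    then show ?thesis
      by (metis (no_types, lifting) abs_mult abs_of_nonneg cosh_real_abs zero_le_dist)
  qed
  have k1: "\<alpha> * real k * (u + 1 / real k) = \<alpha> * real k * u + \<alpha>" "\<alpha> * real k * (u + - (1 / real k)) = \<alpha> * real k * u - \<alpha>"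
    using k by (auto simp: field_simps)
  have "neighbour_sum k (\<lambda>z. cosh (\<alpha> * real k * dist z c)) x \<le> cosh (\<alpha> * real k * u + \<alpha>) + cosh (\<alpha> * real k * u - \<alpha>)"
    unfolding neighbour_sum_def using cu[of "1 / real k"] cu[of "- (1 / real k)"] unfolding k1 by linarith
  also have "\<dots> = 2 * cosh \<alpha> * cosh (\<alpha> * real k * u)" by (simp add: cosh_add cosh_diff)
  also have "cosh (\<alpha> * real k * u) = cosh (\<alpha> * real k * dist x c)"
    unfolding du by (metis abs_mult abs_abs cosh_real_abs)
  finally show ?thesis .
qed

lemma trans_prob_cosh:
  assumes "k \<ge> 1" "t \<ge> 0" "finite A"
  shows "(\<Sum>y\<in>A. trans_prob k t x y * cosh (\<alpha> * real k * dist y c)) \<le> exp (real k * t * cumulant \<alpha>) * cosh (\<alpha> * real k * dist x c)"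
  using trans_prob_supersolution[OF assms(2) _ _ _ assms(3), of "\<lambda>z. cosh (\<alpha> * real k * dist z c)" k "cosh \<alpha>" x]
    cosh_dist_supersolution[OF assms(1), of \<alpha> c] unfolding cumulant_def by (simp add: cosh_real_nonneg)

lemma cosh_ge_half_exp: "exp x / 2 \<le> cosh (x::real)"
  unfolding cosh_def by (simp add: field_simps)

text \<open>The exponential Chebyshev bound with weight \<open>cosh (\<alpha> k dist y x)\<close> at the optimal
  \<open>\<alpha>\<close>.\<close>

theorem trans_prob_upper:
  assumes k: "k \<ge> 1" and t: "t > 0"
  shows "trans_prob k t x y \<le> 2 * exp (- real k * (t * lagrangian (dist x y / t)))"
proof -
  define d where "d = dist x y"
  have "d \<ge> 0" unfolding d_def by simp
  then obtain \<alpha> where \<alpha>: "\<alpha> \<ge> 0" and ad: "\<alpha> * d = t * lagrangian (d / t) + t * cumulant \<alpha>"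
    by (rule scaled_young_attained[OF t])
  have "trans_prob k t x y * (exp (\<alpha> * real k * d) / 2) \<le> trans_prob k t x y * cosh (\<alpha> * real k * dist y x)"
    using cosh_ge_half_exp trans_prob_nonneg t unfolding d_def by (intro mult_left_mono) (auto simp: dist_commute)
  also have "\<dots> \<le> exp (real k * t * cumulant \<alpha>)"
    using trans_prob_cosh[OF k, of t "{y}" x \<alpha> x] t by simp
  finally have "trans_prob k t x y \<le> 2 * (exp (real k * t * cumulant \<alpha>) / exp (\<alpha> * real k * d))"
    by (simp add: field_simps)
  also have "exp (real k * t * cumulant \<alpha>) / exp (\<alpha> * real k * d) = exp (- real k * (t * lagrangian (d / t)))"
  proof -
    have "real k * t * cumulant \<alpha> - \<alpha> * real k * d = real k * (t * cumulant \<alpha> - \<alpha> * d)" by (simp add: algebra_simps)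
    also have "\<dots> = - real k * (t * lagrangian (d / t))" unfolding ad by (simp add: algebra_simps)
    finally show ?thesis by (simp add: exp_diff[symmetric])
  qed
  finally show ?thesis unfolding d_def .
qed

text \<open>With \<open>a\<close> steps forward and \<open>n - a\<close> steps backward one ends there in any order of the
  steps.\<close>

lemma path_count_ge_binomial:
  "a \<le> n \<Longrightarrow> real (n choose a) \<le> path_count k n x (rotation ((2 * real a - real n) / real k) x)"
proof (induction n arbitrary: a x)
  case 0
  then show ?case by (simp add: path_count_def)
next
  case (Suc n)
  define y where "y = rotation ((2 * real a - real (Suc n)) / real k) x"
  have S: "path_count k (Suc n) x y = path_count k n (rotation (1 / real k) x) y + path_count k n (rotation (- (1 / real k)) x) y"
    unfolding path_count_def iterated_sum_Suc_apply ..
  have up: "real (n choose (a - 1)) \<le> path_count k n (rotation (1 / real k) x) y" if a: "a \<ge> 1"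
  proof -
    have "rotation ((2 * real (a - 1) - real n) / real k) (rotation (1 / real k) x) = y"
      unfolding y_def rotation_rotation using a by (simp add: of_nat_diff add_divide_distrib[symmetric] algebra_simps)
    then show ?thesis using Suc.IH[of "a - 1" "rotation (1 / real k) x"] Suc.prems a by auto
  qed
  have down: "real (n choose a) \<le> path_count k n (rotation (- (1 / real k)) x) y"
  proof (cases "a \<le> n")
    case True
    have "rotation ((2 * real a - real n) / real k) (rotation (- (1 / real k)) x) = y"
      unfolding y_def rotation_rotation by (simp add: diff_divide_distrib add_divide_distrib algebra_simps)
    then show ?thesis using Suc.IH[OF True, of "rotation (- (1 / real k)) x"] by auto
  next
    case False
    then show ?thesis by (simp add: path_count_bounds binomial_eq_0)
  qed
  show ?case
  proof (cases a)
    case 0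
    then show ?thesis using down path_count_bounds(1)[of k n "rotation (1 / real k) x" y] S unfolding y_def[symmetric] by simp
  next
    case (Suc a')
    then show ?thesis using up down S unfolding y_def[symmetric] by simp
  qed
qed

lemma trans_prob_ge_term:
  assumes t: "t \<ge> 0" and y: "y = rotation ((real a - real b) / real k) x"
  shows "exp (- 2 * real k * t) * ((real k * t) ^ a / fact a * ((real k * t) ^ b / fact b)) \<le> trans_prob k t x y"
proof -
  define n where "n = a + b"
  have c: "real (n choose a) \<le> path_count k n x y"
    using path_count_ge_binomial[of a n k x] unfolding y n_def by (simp add: algebra_simps)
  have "(real k * t) ^ a / fact a * ((real k * t) ^ b / fact b) = (real k * t) ^ n / fact n * real (n choose a)"
    unfolding n_def by (simp add: binomial_fact power_add field_simps)
  also have "\<dots> \<le> (real k * t) ^ n / fact n * path_count k n x y" using c t by (intro mult_left_mono) auto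
  finally have "exp (- 2 * real k * t) * ((real k * t) ^ a / fact a * ((real k * t) ^ b / fact b)) \<le>
     exp (- 2 * real k * t) * ((real k * t) ^ n / fact n * path_count k n x y)" by (rule mult_left_mono) simp
  also have "\<dots> \<le> trans_prob k t x y"
  proof -
    define g where "g = (\<lambda>n. exp (- 2 * real k * t) * ((real k * t) ^ n / fact n * path_count k n x y))"
    have g: "g sums trans_prob k t x y" unfolding g_def by (rule trans_prob_sums[OF t])
    have "sum g {n} \<le> suminf g" by (rule sum_le_suminf[OF sums_summable[OF g]]) (use t path_count_bounds in \<open>auto simp: g_def\<close>)
    then show ?thesis using sums_unique[OF g] unfolding g_def by simp
  qed
  finally show ?thesis .
qed

lemma fact_upper: "a \<ge> 1 \<Longrightarrow> ln (fact a) \<le> real a * ln (real a) - real a + ln (real a) + 1"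
proof (induction a rule: nat_induct_at_least)
  case base
  then show ?case by simp
next
  case (Suc a)
  have a: "real a > 0" using Suc by simp
  have 1: "ln (fact (Suc a)) = ln (real (Suc a)) + ln (fact a)" using ln_mult[of "real (Suc a)" "fact a"] by (simp add: add.commute)
  have "ln (real a / real (Suc a)) \<le> real a / real (Suc a) - 1" using a by (intro ln_le_minus_one) simp
  then have 2: "ln (real (Suc a)) - ln (real a) \<ge> 1 / real (Suc a)"
    using a by (simp add: ln_div field_simps)
  have "real (Suc a) * (ln (real (Suc a)) - ln (real a)) \<ge> real (Suc a) * (1 / real (Suc a))"
    using 2 by (intro mult_left_mono) auto
  then have 3: "real (Suc a) * ln (real (Suc a)) - real (Suc a) * ln (real a) \<ge> 1" by (simp add: right_diff_distrib)
  have "real (Suc a) * ln (real a) = real a * ln (real a) + ln (real a)" by (simp add: algebra_simps)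
  then show ?case using 1 3 Suc.IH by simp
qed

text \<open>A Poisson weight near its mean \<open>l\<close> is only polynomially small.\<close>

lemma poisson_term_lower:
  assumes l: "l > 0" and a: "a \<ge> 1" "\<bar>real a - l\<bar> \<le> 1"
  shows "exp (l - 1 / l) / (exp 1 * real a) \<le> l ^ a / fact a"
proof -
  have a0: "real a > 0" using a by simp
  have "ln (real a / l) \<le> real a / l - 1" using a0 l by (intro ln_le_minus_one) simp
  then have 1: "ln l - ln (real a) \<ge> 1 - real a / l" using a0 l by (simp add: ln_div)
  have "real a * (ln l - ln (real a)) \<ge> real a * (1 - real a / l)" using 1 by (intro mult_left_mono) auto
  then have 2: "real a * ln l - real a * ln (real a) + real a \<ge> 2 * real a - real a * real a / l"
    by (simp add: algebra_simps)
  have "(real a - l)\<^sup>2 \<le> 1" using a(2) by (simp add: abs_square_le_1)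
  then have "(real a - l)\<^sup>2 / l \<le> 1 / l" using l by (intro divide_right_mono) auto
  moreover have "(real a - l)\<^sup>2 / l = real a * real a / l - 2 * real a + l" using l by (simp add: power2_eq_square field_simps)
  ultimately have "l - 1 / l \<le> 2 * real a - real a * real a / l" by linarith
  then have "l - 1 / l - (1 + ln (real a)) \<le> real a * ln l - ln (fact a)" using 2 fact_upper[OF a(1)] by linarith
  then have "exp (l - 1 / l - (1 + ln (real a))) \<le> exp (real a * ln l - ln (fact a))" by simp
  moreover have "exp (l - 1 / l - (1 + ln (real a))) = exp (l - 1 / l) / (exp 1 * real a)" using a0 by (simp add: exp_diff exp_add)
  moreover have "exp (real a * ln l - ln (fact a)) = l ^ a / fact a" using l by (simp add: exp_diff exp_of_nat_mult)
  ultimately show ?thesis by simp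
qed

text \<open>The signed arc between two grid points is a multiple of \<open>1 / k\<close>.\<close>

lemma grid_displacement:
  assumes k: "k \<ge> 1" and x: "x \<in> grid k" and y: "y \<in> grid k"
  obtains j :: int where "y = rotation (of_int j / real k) x" "\<bar>of_int j\<bar> = real k * dist x y"
proof -
  obtain i where i: "x = circle_of (real i / real k)" using x unfolding grid_def by auto
  obtain l where l: "y = circle_of (real l / real k)" using y unfolding grid_def by auto
  define u where "u = signed_arc x y"
  have "circle_of (real i / real k + u) = y" unfolding u_def by (rule circle_of_add_signed_arc) (simp add: i)
  then have "real i / real k + u - real l / real k \<in> \<int>" unfolding l circle_of_eq_iff .
  then obtain m where m: "real i / real k + u - real l / real k = of_int m" by (auto elim: Ints_cases)
  define j where "j = int l - int i + m * int k"
  have "u = of_int m + real l / real k - real i / real k" using m by simp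
  then have j: "u = of_int j / real k" unfolding j_def using k by (simp add: add_divide_distrib diff_divide_distrib)
  have "y = rotation u x" unfolding u_def rotation_def by (rule circle_of_add_signed_arc[symmetric]) simp
  moreover have "\<bar>u\<bar> = dist x y" unfolding u_def by (rule abs_signed_arc_eq_dist)
  ultimately show ?thesis using that[of j] k unfolding j by (simp add: field_simps)
qed

text \<open>What remains of the polynomial corrections after a factor \<open>1 / k ^ 2\<close> is taken out: a
  positive number that is independent of \<open>k\<close> and of the points.\<close>

definition lower_const :: "real \<Rightarrow> real" where
  "lower_const t = exp (- (1 / t + 2) / t) / (exp 2 * (3 + t)\<^sup>2)"

lemma lower_const_pos: "t > 0 \<Longrightarrow> lower_const t > 0"
  unfolding lower_const_def by (auto simp: power2_eq_square intro!: divide_pos_pos mult_pos_pos)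

text \<open>Keep only the paths with \<open>a\<close> forward and \<open>b\<close> backward jumps, where \<open>a - b\<close> is the
  displacement \<open>k d\<close> and \<open>a\<close>, \<open>b\<close> are close to the means \<open>la\<close>, \<open>lb\<close> of the tilted jump rates
  \<open>exp \<beta>\<close> and \<open>exp (- \<beta>)\<close>. Since \<open>la - lb = k d\<close> exactly, rounding \<open>lb\<close> up moves both numbers by
  the same amount, less than one.\<close>

theorem trans_prob_lower:
  assumes k: "k \<ge> 1" and t: "t > 0" and x: "x \<in> grid k" and y: "y \<in> grid k"
  shows "lower_const t / (real k)\<^sup>2 * exp (- real k * (t * lagrangian (dist x y / t))) \<le> trans_prob k t x y"
proof -
  define d where "d = dist x y"
  have k0: "real k \<ge> 1" using k by simp
  obtain j where j: "y = rotation (of_int j / real k) x" "\<bar>of_int j\<bar> = real k * d"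
    unfolding d_def by (rule grid_displacement[OF k x y])
  have d: "0 \<le> d" "d \<le> 1 / 2" unfolding d_def using dist_circle_le[of x y] by auto
  obtain \<beta> where \<beta>: "\<beta> \<ge> 0" "\<beta> * d = t * lagrangian (d / t) + t * cumulant \<beta>" "d / t = 2 * sinh \<beta>"
    by (rule scaled_young_attained[OF t d(1)])
  define la where "la = real k * t * exp \<beta>"
  define lb where "lb = real k * t * exp (- \<beta>)"
  have l0: "la > 0" "lb > 0" unfolding la_def lb_def using k t by auto
  have eb: "exp \<beta> - exp (- \<beta>) = d / t" unfolding \<beta>(3) by (simp add: sinh_field_def)
  have lab: "la - lb = real k * d"
  proof -
    have "la - lb = real k * t * (exp \<beta> - exp (- \<beta>))" unfolding la_def lb_def by (simp add: algebra_simps)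
    then show ?thesis unfolding eb using t by simp
  qed
  define jn where "jn = nat \<bar>j\<bar>"
  have jn: "real jn = real k * d" unfolding jn_def using j(2) by simp
  \<comment> \<open>Rounding up keeps \<open>b\<close> positive.\<close>
  define b where "b = nat \<lceil>lb\<rceil>"
  define a where "a = b + jn"
  have b: "b \<ge> 1" "lb \<le> real b" "real b < lb + 1" unfolding b_def using l0(2) by (auto simp: of_nat_nat; linarith)+
  have a: "a \<ge> 1" "la \<le> real a" "real a < la + 1" using b lab jn unfolding a_def by auto
  have e1: "exp (- \<beta>) \<le> 1" "exp \<beta> \<ge> 1" using \<beta>(1) by auto
  have d2: "d / t \<le> 1 / (2 * t)" using d t by (simp add: field_simps)
  have eb2: "exp \<beta> \<le> 1 / (2 * t) + 1" using eb e1 d2 by linarith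
  have amax: "real a \<le> real k * (3 + t)"
  proof -
    have "la \<le> real k * t * (1 / (2 * t) + 1)" unfolding la_def using eb2 k t by (intro mult_left_mono) auto
    also have "\<dots> = real k * (1 / 2 + t)" using t by (simp add: field_simps)
    finally have "real a \<le> real k * (1 / 2 + t) + real k * 1" using a(3) k0 by linarith
    also have "\<dots> = real k * (3 / 2 + t)" by (simp add: algebra_simps)
    also have "\<dots> \<le> real k * (3 + t)" using k0 by (intro mult_left_mono) auto
    finally show ?thesis .
  qed
  have bmax: "real b \<le> real k * (3 + t)" using amax unfolding a_def by simp
  have "lower_const t / (real k)\<^sup>2 * exp (- real k * (t * lagrangian (d / t))) \<le>
    exp (- (1 / la + 1 / lb)) / (exp 2 * (real a * real b)) * exp (- real k * (t * lagrangian (d / t)))"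
  proof (rule mult_right_mono)
    have "1 / la + 1 / lb = (exp (- \<beta>) + exp \<beta>) / (real k * t)"
      unfolding la_def lb_def using k t by (simp add: exp_minus field_simps)
    also have "\<dots> \<le> (1 / t + 2) / t"
    proof -
      have "exp (- \<beta>) + exp \<beta> \<le> 1 / t + 2"
        using e1 eb2 t by (smt (verit) divide_le_cancel divide_nonneg_pos field_sum_of_halves frac_le)
      moreover have "t \<le> real k * t" using k0 t by simp
      ultimately show ?thesis using t by (intro frac_le) (auto intro!: add_nonneg_nonneg)
    qed
    finally have 1: "exp (- (1 / t + 2) / t) \<le> exp (- (1 / la + 1 / lb))"
      unfolding exp_le_cancel_iff minus_divide_left[symmetric] neg_le_iff_le .
    have "real a * real b \<le> (real k * (3 + t)) * (real k * (3 + t))" using amax bmax by (intro mult_mono) auto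
    then have "exp 2 * (real a * real b) \<le> exp 2 * ((real k * (3 + t)) * (real k * (3 + t)))" by (rule mult_left_mono) simp
    also have "\<dots> = exp 2 * (3 + t)\<^sup>2 * (real k)\<^sup>2" by (simp add: power2_eq_square mult_ac)
    finally have 2: "exp 2 * (real a * real b) \<le> exp 2 * (3 + t)\<^sup>2 * (real k)\<^sup>2" .
    have "lower_const t / (real k)\<^sup>2 = exp (- (1 / t + 2) / t) / (exp 2 * (3 + t)\<^sup>2 * (real k)\<^sup>2)"
      unfolding lower_const_def by simp
    also have "\<dots> \<le> exp (- (1 / la + 1 / lb)) / (exp 2 * (real a * real b))"
      using 1 2 a(1) b(1) by (intro frac_le) auto
    finally show "lower_const t / (real k)\<^sup>2 \<le> exp (- (1 / la + 1 / lb)) / (exp 2 * (real a * real b))" .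
  qed simp
  also have "\<dots> = exp (- 2 * real k * t) * exp (- \<beta> * real jn) * (exp (la - 1 / la) / (exp 1 * real a) * (exp (lb - 1 / lb) / (exp 1 * real b)))"
  proof -
    have tl: "t * lagrangian (d / t) = \<beta> * d - t * cumulant \<beta>" using \<beta>(2) by simp
    have "- real k * (t * lagrangian (d / t)) = - \<beta> * real jn + real k * t * cumulant \<beta>" unfolding tl jn by (simp add: algebra_simps)
    also have "real k * t * cumulant \<beta> = la + lb - 2 * real k * t" unfolding la_def lb_def cumulant_def cosh_def by (simp add: algebra_simps)
    finally have E: "- (1 / la + 1 / lb) + - real k * (t * lagrangian (d / t)) = - 2 * real k * t + - \<beta> * real jn + (la - 1 / la) + (lb - 1 / lb)"
      by linarith
    have e2: "exp 2 = exp 1 * exp (1::real)" by (simp add: exp_add[symmetric])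
    have "exp (- (1 / la + 1 / lb)) / (exp 2 * (real a * real b)) * exp (- real k * (t * lagrangian (d / t))) =
      exp (- (1 / la + 1 / lb) + - real k * (t * lagrangian (d / t))) / (exp 2 * (real a * real b))" unfolding exp_add by (simp only: times_divide_eq_left)
    also have "\<dots> = exp (- 2 * real k * t) * exp (- \<beta> * real jn) * exp (la - 1 / la) * exp (lb - 1 / lb) / (exp 2 * (real a * real b))"
      unfolding E exp_add by (rule refl)
    also have "exp (- 2 * real k * t) * exp (- \<beta> * real jn) * exp (la - 1 / la) * exp (lb - 1 / lb) / (exp 2 * (real a * real b)) =
      exp (- 2 * real k * t) * exp (- \<beta> * real jn) * (exp (la - 1 / la) / (exp 1 * real a) * (exp (lb - 1 / lb) / (exp 1 * real b)))"
      unfolding e2 by (simp only: times_divide_eq_left times_divide_eq_right divide_divide_eq_left mult_ac)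
    finally show ?thesis .
  qed
  also have "\<dots> \<le> exp (- 2 * real k * t) * exp (- \<beta> * real jn) * (la ^ a / fact a * (lb ^ b / fact b))"
    using a b l0 by (intro mult_left_mono mult_mono poisson_term_lower) auto
  also have "\<dots> = exp (- 2 * real k * t) * ((real k * t) ^ a / fact a * ((real k * t) ^ b / fact b))"
  proof -
    have "la ^ a * lb ^ b = (real k * t) ^ a * (real k * t) ^ b * (exp \<beta> ^ a * exp (- \<beta>) ^ b)"
      unfolding la_def lb_def by (simp add: power_mult_distrib)
    also have "exp \<beta> ^ a * exp (- \<beta>) ^ b = exp (\<beta> * real jn)"
      unfolding a_def by (simp add: exp_of_nat_mult[symmetric] exp_add[symmetric] algebra_simps)
    finally have "exp (- \<beta> * real jn) * (la ^ a * lb ^ b) = (real k * t) ^ a * (real k * t) ^ b"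
      by (simp add: exp_minus field_simps)
    then show ?thesis by (simp add: field_simps)
  qed
  also have "\<dots> \<le> trans_prob k t x y"
  proof (cases "j \<ge> 0")
    case True
    then have "y = rotation ((real a - real b) / real k) x" using j(1) unfolding a_def jn_def by simp
    then show ?thesis using t by (intro trans_prob_ge_term) auto
  next
    case False
    then have "y = rotation ((real b - real a) / real k) x" using j(1) unfolding a_def jn_def by simp
    then show ?thesis using trans_prob_ge_term[of t y b a k x] t by (simp add: mult_ac)
  qed
  finally show ?thesis unfolding d_def .
qed

lemma trans_prob_pos: "k \<ge> 1 \<Longrightarrow> t > 0 \<Longrightarrow> x \<in> grid k \<Longrightarrow> y \<in> grid k \<Longrightarrow> trans_prob k t x y > 0"
  by (rule less_le_trans[OF _ trans_prob_lower]) (auto intro!: mult_pos_pos divide_pos_pos lower_const_pos)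

section \<open>Weights of discrete paths\<close>

definition paths :: "nat \<Rightarrow> nat \<Rightarrow> circle list set" where
  "paths k N = {ys. set ys \<subseteq> grid k \<and> length ys = N}"

fun weight :: "nat \<Rightarrow> real \<Rightarrow> circle \<Rightarrow> circle list \<Rightarrow> real" where
  "weight k \<tau> x [] = 1"
| "weight k \<tau> x (y # ys) = trans_prob k \<tau> x y * weight k \<tau> y ys"

fun path_energy :: "real \<Rightarrow> circle \<Rightarrow> circle list \<Rightarrow> real" where
  "path_energy h x [] = 0"
| "path_energy h x (y # ys) = h * lagrangian (dist x y / h) + path_energy h y ys"

lemma finite_grid: "finite (grid k)" and card_grid_le: "card (grid k) \<le> k"
proof -
  have *: "grid k = (\<lambda>j. circle_of (real j / real k)) ` {..<k}" unfolding grid_def by auto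
  show "finite (grid k)" unfolding * by simp
  show "card (grid k) \<le> k" unfolding * using card_image_le[of "{..<k}"] by fastforce
qed

lemma finite_paths: "finite (paths k N)"
  unfolding paths_def by (rule finite_lists_length_eq[OF finite_grid])

lemma card_paths_le: "card (paths k N) \<le> k ^ N"
  unfolding paths_def card_lists_length_eq[OF finite_grid] by (rule power_mono[OF card_grid_le]) simp

lemma paths_0: "paths k 0 = {[]}" unfolding paths_def by auto

lemma sum_paths_Suc: "(\<Sum>ys\<in>paths k (Suc N). f ys) = (\<Sum>y\<in>grid k. \<Sum>ys\<in>paths k N. f (y # ys))"
proof -
  have P: "paths k (Suc N) = (\<lambda>(y, ys). y # ys) ` (grid k \<times> paths k N)"
    unfolding paths_def by (auto simp: length_Suc_conv image_iff)
  have "(\<Sum>ys\<in>paths k (Suc N). f ys) = (\<Sum>(y, ys)\<in>grid k \<times> paths k N. f (y # ys))"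
    unfolding P by (subst sum.reindex) (auto simp: inj_on_def intro!: sum.cong)
  then show ?thesis by (simp add: sum.cartesian_product)
qed

lemma weight_nonneg: "\<tau> \<ge> 0 \<Longrightarrow> 0 \<le> weight k \<tau> x ys"
  by (induction ys arbitrary: x) (auto simp: trans_prob_nonneg)

lemma weight_pos: "k \<ge> 1 \<Longrightarrow> \<tau> > 0 \<Longrightarrow> x \<in> grid k \<Longrightarrow> set ys \<subseteq> grid k \<Longrightarrow> 0 < weight k \<tau> x ys"
  by (induction ys arbitrary: x) (auto simp: trans_prob_pos)

lemma weight_total: "\<tau> \<ge> 0 \<Longrightarrow> (\<Sum>ys\<in>paths k N. weight k \<tau> x ys) \<le> 1"
proof (induction N arbitrary: x)
  case (Suc N)
  have "(\<Sum>ys\<in>paths k (Suc N). weight k \<tau> x ys) = (\<Sum>y\<in>grid k. trans_prob k \<tau> x y * (\<Sum>ys\<in>paths k N. weight k \<tau> y ys))"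
    by (simp add: sum_paths_Suc sum_distrib_left)
  also have "\<dots> \<le> (\<Sum>y\<in>grid k. trans_prob k \<tau> x y * 1)"
    using Suc by (intro sum_mono mult_left_mono trans_prob_nonneg) auto
  also have "\<dots> \<le> 1" using trans_prob_total[OF Suc.prems finite_grid] by simp
  finally show ?case .
qed (simp add: paths_0)

lemma weight_prod: "weight k \<tau> x ys = (\<Prod>i<length ys. trans_prob k \<tau> ((x # ys) ! i) ((x # ys) ! Suc i))"
proof (induction ys arbitrary: x)
  case (Cons y ys)
  show ?case unfolding weight.simps Cons list.size(4) add_Suc_right add_0_right
    by (subst prod.lessThan_Suc_shift) simp
qed simp

lemma path_energy_sum: "path_energy h x ys = (\<Sum>i<length ys. h * lagrangian (dist ((x # ys) ! i) ((x # ys) ! Suc i) / h))"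
proof (induction ys arbitrary: x)
  case (Cons y ys)
  show ?case unfolding path_energy.simps Cons list.size(4) add_Suc_right add_0_right
    by (subst sum.lessThan_Suc_shift) simp
qed simp

text \<open>The function \<open>w\<close> dominates the indicator of \<open>R\<close> and grows at most by the factor
  \<open>e\<close> per step, so backward induction on the number of steps bounds the probability of ever
  visiting \<open>R\<close>: a maximal inequality.\<close>

lemma weight_exit:
  assumes \<tau>: "\<tau> \<ge> 0" and w: "\<And>x. 0 \<le> w x" "\<And>x. R x \<Longrightarrow> 1 \<le> w x" and e: "e \<ge> 1"
    and step: "\<And>x. (\<Sum>y\<in>grid k. trans_prob k \<tau> x y * w y) \<le> e * w x"
  shows "(\<Sum>ys\<in>paths k m. weight k \<tau> x ys * of_bool (\<exists>y\<in>set (x # ys). R y)) \<le> e ^ m * w x"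
proof (induction m arbitrary: x)
  case 0
  then show ?case using w by (simp add: paths_0)
next
  case (Suc m)
  show ?case
  proof (cases "R x")
    case True
    have "(\<Sum>ys\<in>paths k (Suc m). weight k \<tau> x ys * of_bool (\<exists>y\<in>set (x # ys). R y)) \<le> 1"
      using True weight_total[OF \<tau>, where k=k and N="Suc m" and x=x] by simp
    also have "\<dots> \<le> 1 * w x" using w(2)[OF True] by simp
    also have "\<dots> \<le> e ^ Suc m * w x" using e w by (intro mult_right_mono one_le_power) auto
    finally show ?thesis .
  next
    case False
    have "(\<Sum>ys\<in>paths k (Suc m). weight k \<tau> x ys * of_bool (\<exists>y\<in>set (x # ys). R y)) =
      (\<Sum>y\<in>grid k. trans_prob k \<tau> x y * (\<Sum>ys\<in>paths k m. weight k \<tau> y ys * of_bool (\<exists>z\<in>set (y # ys). R z)))"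
      using False by (simp add: sum_paths_Suc sum_distrib_left mult.assoc)
    also have "\<dots> \<le> (\<Sum>y\<in>grid k. trans_prob k \<tau> x y * (e ^ m * w y))"
      by (intro sum_mono mult_left_mono Suc trans_prob_nonneg \<tau>)
    also have "\<dots> = e ^ m * (\<Sum>y\<in>grid k. trans_prob k \<tau> x y * w y)" by (simp add: sum_distrib_left mult_ac)
    also have "\<dots> \<le> e ^ m * (e * w x)" using step e by (intro mult_left_mono) auto
    finally show ?thesis by (simp add: mult_ac)
  qed
qed

text \<open>The maximal inequality with \<open>w\<close> proportional to \<open>cosh (\<alpha> k dist z x)\<close> and the optimal
  \<open>\<alpha>\<close>. The bound depends on the total time \<open>h\<close> only, so it passes to the limit of infinitely
  fine times.\<close>

lemma weight_oscillation:
  assumes k: "k \<ge> 1" and \<tau>: "\<tau> > 0" and m: "m > 0" and \<delta>: "\<delta> > 0"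
  defines "h \<equiv> \<tau> * real m"
  shows "(\<Sum>ys\<in>paths k m. weight k \<tau> x ys * of_bool (\<exists>y\<in>set (x # ys). \<delta> < dist y x))
    \<le> 2 * exp (- real k * (h * lagrangian (\<delta> / h)))"
proof -
  have h: "h > 0" unfolding h_def using \<tau> m by simp
  obtain \<alpha> where \<alpha>: "\<alpha> \<ge> 0" and ad: "\<alpha> * \<delta> = h * lagrangian (\<delta> / h) + h * cumulant \<alpha>"
    by (rule scaled_young_attained[OF h less_imp_le[OF \<delta>]])
  define c where "c = cosh (\<alpha> * real k * \<delta>)"
  have c: "c > 0" "exp (\<alpha> * real k * \<delta>) / 2 \<le> c" unfolding c_def by (simp add: cosh_real_pos, rule cosh_ge_half_exp)
  define w where "w = (\<lambda>z. cosh (\<alpha> * real k * dist z x) / c)"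
  have "(\<Sum>ys\<in>paths k m. weight k \<tau> x ys * of_bool (\<exists>y\<in>set (x # ys). \<delta> < dist y x)) \<le> exp (real k * \<tau> * cumulant \<alpha>) ^ m * w x"
  proof (rule weight_exit)
    show "0 \<le> w z" for z unfolding w_def using c by (simp add: cosh_real_nonneg)
    show "1 \<le> w z" if "\<delta> < dist z x" for z
    proof -
      have "\<alpha> * real k * \<delta> \<le> \<alpha> * real k * dist z x" using that \<alpha> by (intro mult_left_mono) auto
      then have "c \<le> cosh (\<alpha> * real k * dist z x)" unfolding c_def using \<alpha> \<delta> by (subst cosh_real_nonneg_le_iff) auto
      then show ?thesis unfolding w_def using c by simp
    qed
    show "1 \<le> exp (real k * \<tau> * cumulant \<alpha>)" using \<tau> cumulant_nonneg by simp
    show "(\<Sum>y\<in>grid k. trans_prob k \<tau> z y * w y) \<le> exp (real k * \<tau> * cumulant \<alpha>) * w z" for z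
      using divide_right_mono[OF trans_prob_cosh[OF k less_imp_le[OF \<tau>] finite_grid, where \<alpha>=\<alpha> and c=x and x=z], of c] c
      unfolding w_def by (simp add: sum_divide_distrib)
  qed (use \<tau> in simp)
  also have "exp (real k * \<tau> * cumulant \<alpha>) ^ m = exp (real k * (h * cumulant \<alpha>))"
    unfolding h_def by (simp add: exp_of_nat_mult[symmetric] mult_ac)
  also have "exp (real k * (h * cumulant \<alpha>)) * w x \<le> exp (real k * (h * cumulant \<alpha>)) * (2 * exp (- (\<alpha> * real k * \<delta>)))"
  proof (rule mult_left_mono)
    have "w x = 1 / c" unfolding w_def by simp
    also have "\<dots> \<le> 1 / (exp (\<alpha> * real k * \<delta>) / 2)" using c by (intro divide_left_mono) auto
    finally show "w x \<le> 2 * exp (- (\<alpha> * real k * \<delta>))" by (simp add: exp_minus field_simps)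
  qed simp
  also have "\<dots> = 2 * exp (real k * (h * cumulant \<alpha>) + - (\<alpha> * real k * \<delta>))" unfolding exp_add by (simp only: mult_ac)
  also have "real k * (h * cumulant \<alpha>) + - (\<alpha> * real k * \<delta>) = real k * (h * cumulant \<alpha> - \<alpha> * \<delta>)" by (simp add: algebra_simps)
  also have "\<dots> = - real k * (h * lagrangian (\<delta> / h))" unfolding ad by (simp add: algebra_simps)
  finally show ?thesis .
qed

text \<open>The Markov property at step \<open>p\<close>.\<close>

lemma weight_oscillation_shift:
  assumes k: "k \<ge> 1" and \<tau>: "\<tau> > 0" and m: "m > 0" and \<delta>: "\<delta> > 0"
  defines "h \<equiv> \<tau> * real m"
  shows "(\<Sum>ys\<in>paths k (p + m). weight k \<tau> x ys * of_bool (\<exists>y\<in>set (drop p (x # ys)). \<delta> < dist y ((x # ys) ! p)))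
    \<le> 2 * exp (- real k * (h * lagrangian (\<delta> / h)))" (is "_ \<le> ?B")
proof (induction p arbitrary: x)
  case 0
  then show ?case using weight_oscillation[OF k \<tau> m \<delta>, of x] unfolding h_def by simp
next
  case (Suc p)
  have "(\<Sum>ys\<in>paths k (Suc p + m). weight k \<tau> x ys * of_bool (\<exists>y\<in>set (drop (Suc p) (x # ys)). \<delta> < dist y ((x # ys) ! Suc p))) =
    (\<Sum>y\<in>grid k. trans_prob k \<tau> x y * (\<Sum>ys\<in>paths k (p + m). weight k \<tau> y ys * of_bool (\<exists>z\<in>set (drop p (y # ys)). \<delta> < dist z ((y # ys) ! p))))"
    by (simp add: sum_paths_Suc sum_distrib_left mult.assoc)
  also have "\<dots> \<le> (\<Sum>y\<in>grid k. trans_prob k \<tau> x y * ?B)"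
    using \<tau> by (intro sum_mono mult_left_mono Suc trans_prob_nonneg) auto
  also have "\<dots> = (\<Sum>y\<in>grid k. trans_prob k \<tau> x y) * ?B" by (rule sum_distrib_right[symmetric])
  also have "\<dots> \<le> 1 * ?B" using \<tau> by (intro mult_right_mono trans_prob_total finite_grid) auto
  finally show ?case by simp
qed

lemma weight_le_energy:
  assumes k: "k \<ge> 1" and h: "h > 0"
  shows "weight k h x ys \<le> 2 ^ length ys * exp (- real k * path_energy h x ys)"
proof (induction ys arbitrary: x)
  case (Cons y ys)
  have "weight k h x (y # ys) \<le> (2 * exp (- real k * (h * lagrangian (dist x y / h)))) * (2 ^ length ys * exp (- real k * path_energy h y ys))"
    unfolding weight.simps using h by (intro mult_mono trans_prob_upper[OF k h] Cons weight_nonneg) auto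
  also have "\<dots> = 2 ^ length (y # ys) * exp (- real k * (h * lagrangian (dist x y / h)) + - real k * path_energy h y ys)"
    unfolding exp_add by simp
  also have "- real k * (h * lagrangian (dist x y / h)) + - real k * path_energy h y ys = - real k * path_energy h x (y # ys)"
    by (simp add: algebra_simps)
  finally show ?case .
qed simp

lemma weight_ge_energy:
  assumes k: "k \<ge> 1" and h: "h > 0"
  shows "x \<in> grid k \<Longrightarrow> set ys \<subseteq> grid k \<Longrightarrow>
    (lower_const h / (real k)\<^sup>2) ^ length ys * exp (- real k * path_energy h x ys) \<le> weight k h x ys"
proof (induction ys arbitrary: x)
  case (Cons y ys)
  define c where "c = lower_const h / (real k)\<^sup>2"
  have c: "c \<ge> 0" unfolding c_def using lower_const_pos[OF h] by simp
  have "c ^ length (y # ys) * exp (- real k * path_energy h x (y # ys)) =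
    c ^ length (y # ys) * exp (- real k * (h * lagrangian (dist x y / h)) + - real k * path_energy h y ys)"
    by (simp add: algebra_simps)
  also have "\<dots> = (c * exp (- real k * (h * lagrangian (dist x y / h)))) * (c ^ length ys * exp (- real k * path_energy h y ys))"
    unfolding exp_add by simp
  also have "\<dots> \<le> weight k h x (y # ys)"
    unfolding weight.simps c_def using Cons c h
    by (intro mult_mono trans_prob_lower[OF k h]) (auto simp: c_def trans_prob_nonneg)
  finally show ?case unfolding c_def .
qed simp

text \<open>There are at most \<open>k ^ N\<close> paths, a number that is polynomial in \<open>k\<close> for fixed
  \<open>N\<close>; each of those with energy above \<open>a\<close> has weight at most \<open>2 ^ N * exp (- k a)\<close>.\<close>

lemma sum_weight_high_energy:
  assumes k: "k \<ge> 1" and h: "h > 0"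
  shows "(\<Sum>ys\<in>paths k N. weight k h x ys * of_bool (a < path_energy h x ys)) \<le> (2 * real k) ^ N * exp (- real k * a)"
proof -
  have "(\<Sum>ys\<in>paths k N. weight k h x ys * of_bool (a < path_energy h x ys)) \<le> (\<Sum>ys\<in>paths k N. 2 ^ N * exp (- real k * a))"
  proof (rule sum_mono)
    fix ys assume ys: "ys \<in> paths k N"
    show "weight k h x ys * of_bool (a < path_energy h x ys) \<le> 2 ^ N * exp (- real k * a)"
    proof (cases "a < path_energy h x ys")
      case True
      have "weight k h x ys \<le> 2 ^ N * exp (- real k * path_energy h x ys)"
        using weight_le_energy[OF k h, of x ys] ys unfolding paths_def by simp
      also have "\<dots> \<le> 2 ^ N * exp (- real k * a)" using True k by (intro mult_left_mono) auto
      finally show ?thesis using True by simp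
    qed simp
  qed
  also have "\<dots> = real (card (paths k N)) * (2 ^ N * exp (- real k * a))" by simp
  also have "\<dots> \<le> real (k ^ N) * (2 ^ N * exp (- real k * a))"
    using card_paths_le by (intro mult_right_mono) (auto simp del: of_nat_power)
  finally show ?thesis by (simp add: power_mult_distrib mult_ac)
qed

definition nearest_grid_point :: "nat \<Rightarrow> circle \<Rightarrow> circle" where
  "nearest_grid_point k z = circle_of (of_int \<lfloor>real k * coord z\<rfloor> / real k)"

lemma nearest_grid_point_dist:
  assumes "k \<ge> 1"
  shows "dist (nearest_grid_point k z) z \<le> 1 / real k"
proof -
  have k0: "real k > 0" using assms by simp
  have "dist (nearest_grid_point k z) (circle_of (coord z)) \<le> \<bar>of_int \<lfloor>real k * coord z\<rfloor> / real k - coord z\<bar>"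
    unfolding nearest_grid_point_def by (rule dist_circle_of_le)
  also have "of_int \<lfloor>real k * coord z\<rfloor> / real k - coord z = (of_int \<lfloor>real k * coord z\<rfloor> - real k * coord z) / real k"
    using k0 by (simp add: diff_divide_distrib)
  also have "\<bar>\<dots>\<bar> = \<bar>of_int \<lfloor>real k * coord z\<rfloor> - real k * coord z\<bar> / real k"
    using k0 by (simp only: abs_divide abs_of_pos)
  also have "\<dots> \<le> 1 / real k" using k0 by (intro divide_right_mono) linarith+
  finally show ?thesis by simp
qed

lemma nearest_grid_point_in_grid:
  assumes k: "k \<ge> 1"
  shows "nearest_grid_point k z \<in> grid k"
proof -
  have "0 \<le> real k * coord z" "real k * coord z < real k * 1"
    using k by (auto intro!: mult_nonneg_nonneg mult_strict_left_mono)
  then have "0 \<le> \<lfloor>real k * coord z\<rfloor>" "\<lfloor>real k * coord z\<rfloor> < int k" by linarith+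
  then have "nat \<lfloor>real k * coord z\<rfloor> < k" "nearest_grid_point k z = circle_of (real (nat \<lfloor>real k * coord z\<rfloor>) / real k)"
    unfolding nearest_grid_point_def by (linarith, simp)
  then show ?thesis unfolding grid_def by blast
qed

lemma nearest_grid_point_tendsto: "(\<lambda>k. nearest_grid_point k z) \<longlonglongrightarrow> z"
proof (rule metric_tendsto_imp_tendsto[OF lim_const_over_n[of 1]])
  show "\<forall>\<^sub>F k in sequentially. dist (nearest_grid_point k z) z \<le> dist (1 / real k) 0"
    using eventually_ge_at_top[of 1] by eventually_elim (simp add: nearest_grid_point_dist)
qed

section \<open>The law of the walk\<close>

locale walk =
  fixes T :: real and x\<^sub>0 :: circle and k :: nat and M :: "'w measure" and X :: "'w \<Rightarrow> real \<Rightarrow> circle"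
  assumes T: "T > 0" and k: "k \<ge> 1" and rw: "random_walk M T k x\<^sub>0 X"
begin

definition start :: circle where "start = nearest_grid_point k x\<^sub>0"

lemma markov: "markov_chain_with_generator M T (grid k) (walk_generator k) (return_pmf start) X"
  using rw unfolding random_walk_def start_def nearest_grid_point_def walk_generator_def .

sublocale prob_space M
  using markov unfolding markov_chain_with_generator_def by blast

lemma X_measurable: "X \<in> measurable M (skorohod_borel T)"
  using markov unfolding markov_chain_with_generator_def by blast

lemma X_grid: "\<omega> \<in> space M \<Longrightarrow> t \<in> {0..T} \<Longrightarrow> X \<omega> t \<in> grid k"
  using markov unfolding markov_chain_with_generator_def by blast

lemma X_skorohod: "\<omega> \<in> space M \<Longrightarrow> X \<omega> \<in> skorohod_space T"
  using measurable_space[OF X_measurable, of \<omega>] unfolding skorohod_borel_def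
  by (simp add: space_measure_of_conv)

lemma start_grid: "start \<in> grid k"
  unfolding start_def by (rule nearest_grid_point_in_grid[OF k])

definition cylinder :: "real \<Rightarrow> circle list \<Rightarrow> 'w set" where
  "cylinder \<tau> ys = {\<omega> \<in> space M. \<forall>i\<le>length ys. X \<omega> (real i * \<tau>) = (start # ys) ! i}"

text \<open>Measurability comes from the formula for the measure of a cylinder: its value is positive,
  whereas a set that is not measurable has measure zero by convention.\<close>

lemma cylinder_prob:
  assumes ys: "ys \<in> paths k N" and \<tau>: "\<tau> > 0" "real N * \<tau> \<le> T"
  shows "cylinder \<tau> ys \<in> sets M" "measure M (cylinder \<tau> ys) = weight k \<tau> start ys"
proof -
  have N: "length ys = N" "set ys \<subseteq> grid k" using ys unfolding paths_def by auto
  have fdd: "\<forall>n. \<forall>t :: nat \<Rightarrow> real. \<forall>y :: nat \<Rightarrow> circle.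
        t 0 = 0 \<and> (\<forall>i<n. t i \<le> t (Suc i)) \<and> t n \<le> T \<and> (\<forall>i\<le>n. y i \<in> grid k) \<longrightarrow>
        measure M {\<omega> \<in> space M. \<forall>i\<le>n. X \<omega> (t i) = y i} =
          pmf (return_pmf start) (y 0) *
          (\<Prod>i<n. semigroup_of (walk_generator k) (t (Suc i) - t i) (indicator {y (Suc i)}) (y i))"
    using markov unfolding markov_chain_with_generator_def by blast
  have g: "(start # ys) ! i \<in> grid k" if "i \<le> N" for i
    using that start_grid N by (cases i) (auto simp: nth_mem subset_iff)
  have s: "real (Suc i) * \<tau> - real i * \<tau> = \<tau>" for i by (simp add: algebra_simps)
  have "measure M (cylinder \<tau> ys) = pmf (return_pmf start) ((start # ys) ! 0) *
     (\<Prod>i<N. semigroup_of (walk_generator k) (real (Suc i) * \<tau> - real i * \<tau>) (indicator {(start # ys) ! Suc i}) ((start # ys) ! i))"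
    unfolding cylinder_def N(1)
    using fdd[rule_format, of "\<lambda>i. real i * \<tau>" N "\<lambda>i. (start # ys) ! i"] \<tau> g by (simp add: mult_right_mono)
  also have "\<dots> = weight k \<tau> start ys"
    unfolding weight_prod N(1) s trans_prob_def[symmetric] by simp
  finally show *: "measure M (cylinder \<tau> ys) = weight k \<tau> start ys" .
  have "weight k \<tau> start ys > 0" by (rule weight_pos[OF k \<tau>(1) start_grid N(2)])
  then show "cylinder \<tau> ys \<in> sets M" using * measure_notin_sets by fastforce
qed

definition skeleton :: "real \<Rightarrow> nat \<Rightarrow> 'w \<Rightarrow> circle list" where
  "skeleton \<tau> N \<omega> = map (\<lambda>i. X \<omega> (real i * \<tau>)) [1..<Suc N]"

lemma length_skeleton [simp]: "length (skeleton \<tau> N \<omega>) = N" unfolding skeleton_def by simp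

lemma skeleton_nth: "i \<le> N \<Longrightarrow> X \<omega> 0 = start \<Longrightarrow> (start # skeleton \<tau> N \<omega>) ! i = X \<omega> (real i * \<tau>)"
  unfolding skeleton_def by (cases i) (auto simp del: upt_Suc)

lemma skeleton_paths:
  assumes "\<omega> \<in> space M" "\<tau> > 0" "real N * \<tau> \<le> T"
  shows "skeleton \<tau> N \<omega> \<in> paths k N"
proof -
  have "X \<omega> (real i * \<tau>) \<in> grid k" if "i < Suc N" for i
  proof (rule X_grid[OF assms(1)])
    have "real i * \<tau> \<le> real N * \<tau>" using that assms by (intro mult_right_mono) auto
    then have "real i * \<tau> \<le> T" using assms(3) by (rule order_trans)
    then show "real i * \<tau> \<in> {0..T}" using assms by auto
  qed
  then show ?thesis unfolding paths_def by (auto simp: skeleton_def simp del: upt_Suc)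
qed

text \<open>All events are restricted to this event of probability one: cylinders with another
  starting point have measure zero by the given formula, which does not tell whether they are
  measurable.\<close>

definition started :: "'w set" where "started = {\<omega> \<in> space M. X \<omega> 0 = start}"

lemma cylinder_eq:
  "length ys = N \<Longrightarrow> cylinder \<tau> ys = {\<omega> \<in> started. skeleton \<tau> N \<omega> = ys}"
proof (intro set_eqI iffI)
  fix \<omega> assume N: "length ys = N" and "\<omega> \<in> cylinder \<tau> ys"
  then have \<omega>: "\<omega> \<in> space M" "\<And>i. i \<le> N \<Longrightarrow> X \<omega> (real i * \<tau>) = (start # ys) ! i" unfolding cylinder_def by auto
  have 0: "X \<omega> 0 = start" using \<omega>(2)[of 0] by simp
  have "skeleton \<tau> N \<omega> = ys"
  proof (rule nth_equalityI)
    fix i assume "i < length (skeleton \<tau> N \<omega>)"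
    then show "skeleton \<tau> N \<omega> ! i = ys ! i" using skeleton_nth[of "Suc i" N \<omega> \<tau>] \<omega>(2)[of "Suc i"] 0 by simp
  qed (use N in simp)
  then show "\<omega> \<in> {\<omega> \<in> started. skeleton \<tau> N \<omega> = ys}" using \<omega>(1) 0 unfolding started_def by simp
next
  fix \<omega> assume N: "length ys = N" and "\<omega> \<in> {\<omega> \<in> started. skeleton \<tau> N \<omega> = ys}"
  then have "\<omega> \<in> space M" "X \<omega> 0 = start" "skeleton \<tau> N \<omega> = ys" unfolding started_def by auto
  then show "\<omega> \<in> cylinder \<tau> ys" unfolding cylinder_def using skeleton_nth[of _ N \<omega> \<tau>] N by auto
qed

lemma skeleton_law:
  assumes \<tau>: "\<tau> > 0" "real N * \<tau> \<le> T"
  shows "{\<omega> \<in> started. R (skeleton \<tau> N \<omega>)} \<in> sets M"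
    "measure M {\<omega> \<in> started. R (skeleton \<tau> N \<omega>)} = (\<Sum>ys\<in>paths k N. weight k \<tau> start ys * of_bool (R ys))"
proof -
  define S where "S = {ys \<in> paths k N. R ys}"
  have S: "finite S" unfolding S_def using finite_paths by simp
  have eq: "{\<omega> \<in> started. R (skeleton \<tau> N \<omega>)} = (\<Union>ys\<in>S. cylinder \<tau> ys)"
  proof -
    have "cylinder \<tau> ys = {\<omega> \<in> started. skeleton \<tau> N \<omega> = ys}" if "ys \<in> S" for ys
      using that cylinder_eq unfolding S_def paths_def by auto
    then show ?thesis using skeleton_paths[OF _ \<tau>] unfolding S_def started_def by auto
  qed
  show "{\<omega> \<in> started. R (skeleton \<tau> N \<omega>)} \<in> sets M"
    unfolding eq using S cylinder_prob(1)[OF _ \<tau>] unfolding S_def by (intro sets.finite_UN) auto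
  have "disjoint_family_on (cylinder \<tau>) S"
    unfolding disjoint_family_on_def S_def using cylinder_eq[of _ N \<tau>] by (auto simp: paths_def)
  then have "measure M (\<Union>ys\<in>S. cylinder \<tau> ys) = (\<Sum>ys\<in>S. measure M (cylinder \<tau> ys))"
    using S cylinder_prob(1)[OF _ \<tau>] unfolding S_def by (intro finite_measure_finite_Union) auto
  also have "\<dots> = (\<Sum>ys\<in>S. weight k \<tau> start ys)"
    using cylinder_prob(2)[OF _ \<tau>] unfolding S_def by (intro sum.cong) auto
  also have "\<dots> = (\<Sum>ys\<in>paths k N. weight k \<tau> start ys * of_bool (R ys))"
    unfolding S_def by (rule sum.mono_neutral_cong_left) (auto simp: finite_paths)
  finally show "measure M {\<omega> \<in> started. R (skeleton \<tau> N \<omega>)} = (\<Sum>ys\<in>paths k N. weight k \<tau> start ys * of_bool (R ys))"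
    unfolding eq .
qed

lemma started_prob: "started \<in> sets M" "measure M started = 1"
  using skeleton_law[of 1 0 "\<lambda>_. True"] T by (simp_all add: paths_0)

lemma prob_restrict_started:
  assumes "A \<in> sets M"
  shows "measure M A = measure M (A \<inter> started)"
proof -
  have "AE \<omega> in M. \<omega> \<in> started" using started_prob by (simp add: prob_eq_1)
  then show ?thesis by (intro measure_eq_AE) (use assms started_prob in auto)
qed

text \<open>Large deviation from the value at the beginning of the cell \<open>i\<close> of level \<open>n\<close>, seen at some
  time of level \<open>n + l\<close> in that cell.\<close>

definition fine_oscillation :: "nat \<Rightarrow> real \<Rightarrow> nat \<Rightarrow> nat \<Rightarrow> 'w set" where
  "fine_oscillation n \<delta> i l = {\<omega> \<in> started. \<exists>j\<in>{i * 2 ^ l..i * 2 ^ l + 2 ^ l}.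
     \<delta> < dist (X \<omega> (real j * mesh T (n + l))) (X \<omega> (mesh T n * real i))}"

lemma fine_oscillation_prob:
  assumes i: "i < 2 ^ n" and \<delta>: "\<delta> > 0"
  shows "fine_oscillation n \<delta> i l \<in> sets M"
    "measure M (fine_oscillation n \<delta> i l) \<le> 2 * exp (- real k * (mesh T n * lagrangian (\<delta> / mesh T n)))"
proof -
  define \<tau> where "\<tau> = mesh T (n + l)"
  define p where "p = i * 2 ^ l"
  define m where "m = (2::nat) ^ l"
  have \<tau>: "\<tau> > 0" unfolding \<tau>_def by (rule mesh_pos[OF T])
  have m: "m > 0" unfolding m_def by simp
  have h: "mesh T n = \<tau> * real m" unfolding \<tau>_def m_def by (rule mesh_refine)
  have "Suc i * 2 ^ l \<le> 2 ^ n * 2 ^ l" using i by (intro mult_right_mono) auto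
  then have "p + m \<le> 2 ^ (n + l)" unfolding p_def m_def by (simp add: power_add)
  then have "real (p + m) \<le> real (2 ^ (n + l))" using of_nat_le_iff by blast
  then have "real (p + m) * \<tau> \<le> real (2 ^ (n + l)) * \<tau>" using \<tau> by (intro mult_right_mono) auto
  then have N: "real (p + m) * \<tau> \<le> T" using mesh_total[of T "n + l"] unfolding \<tau>_def by (simp add: mult.commute)
  define R where "R = (\<lambda>ys. \<exists>y\<in>set (drop p (start # ys)). \<delta> < dist y ((start # ys) ! p))"
  have eq: "fine_oscillation n \<delta> i l = {\<omega> \<in> started. R (skeleton \<tau> (p + m) \<omega>)}"
  proof -
    have "(\<exists>j\<in>{p..p + m}. \<delta> < dist (X \<omega> (real j * \<tau>)) (X \<omega> (mesh T n * real i))) \<longleftrightarrow> R (skeleton \<tau> (p + m) \<omega>)"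
      if \<omega>: "\<omega> \<in> started" for \<omega>
    proof -
      define zs where "zs = start # skeleton \<tau> (p + m) \<omega>"
      have z: "zs ! j = X \<omega> (real j * \<tau>)" if "j \<le> p + m" for j
        unfolding zs_def using skeleton_nth[OF that] \<omega> unfolding started_def by simp
      have "mesh T n * real i = real p * \<tau>" unfolding h p_def m_def by (simp add: mult_ac)
      then have zp: "X \<omega> (mesh T n * real i) = zs ! p" using z[of p] by simp
      have len: "length zs = Suc (p + m)" unfolding zs_def by simp
      have "set (drop p zs) = (\<lambda>j. zs ! j) ` {p..p + m}"
      proof -
        have "set (drop p zs) = (\<lambda>j. drop p zs ! j) ` {..<Suc m}" using len by (auto simp: set_conv_nth image_iff)
        also have "\<dots> = (\<lambda>j. zs ! (p + j)) ` {..<Suc m}" using len by (intro image_cong) auto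
        also have "\<dots> = (\<lambda>j. zs ! j) ` ((+) p ` {..<Suc m})" by (simp add: image_image)
        also have "(+) p ` {..<Suc m} = {p..p + m}"
        proof (intro set_eqI iffI)
          fix j assume "j \<in> {p..p + m}"
          then show "j \<in> (+) p ` {..<Suc m}" by (intro image_eqI[of _ _ "j - p"]) auto
        qed auto
        finally show ?thesis .
      qed
      then have "R (skeleton \<tau> (p + m) \<omega>) \<longleftrightarrow> (\<exists>j\<in>{p..p + m}. \<delta> < dist (zs ! j) (zs ! p))"
        unfolding R_def zs_def[symmetric] by simp
      also have "\<dots> \<longleftrightarrow> (\<exists>j\<in>{p..p + m}. \<delta> < dist (X \<omega> (real j * \<tau>)) (zs ! p))"
        by (rule bex_cong[OF refl]) (simp add: z)
      finally show ?thesis unfolding zp by simp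
    qed
    then show ?thesis unfolding fine_oscillation_def \<tau>_def[symmetric] p_def[symmetric]
      unfolding m_def[symmetric] by (intro Collect_cong conj_cong refl)
  qed
  show "fine_oscillation n \<delta> i l \<in> sets M" unfolding eq by (rule skeleton_law(1)[OF \<tau> N])
  show "measure M (fine_oscillation n \<delta> i l) \<le> 2 * exp (- real k * (mesh T n * lagrangian (\<delta> / mesh T n)))"
    unfolding eq skeleton_law(2)[OF \<tau> N, of R] h unfolding R_def by (rule weight_oscillation_shift[OF k \<tau> m \<delta>])
qed

lemma fine_oscillation_mono: "fine_oscillation n \<delta> i l \<subseteq> fine_oscillation n \<delta> i (Suc l)"
proof
  fix \<omega> assume "\<omega> \<in> fine_oscillation n \<delta> i l"
  then obtain j where j: "\<omega> \<in> started" "j \<in> {i * 2 ^ l..i * 2 ^ l + 2 ^ l}"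
    "\<delta> < dist (X \<omega> (real j * mesh T (n + l))) (X \<omega> (mesh T n * real i))" unfolding fine_oscillation_def by blast
  have "real j * mesh T (n + l) = real (2 * j) * mesh T (n + Suc l)" unfolding mesh_def by simp
  with j(3) have "\<delta> < dist (X \<omega> (real (2 * j) * mesh T (n + Suc l))) (X \<omega> (mesh T n * real i))" by (simp only:)
  moreover have "2 * j \<in> {i * 2 ^ Suc l..i * 2 ^ Suc l + 2 ^ Suc l}" using j(2) by auto
  ultimately show "\<omega> \<in> fine_oscillation n \<delta> i (Suc l)"
    unfolding fine_oscillation_def using j(1) by blast
qed

definition big_oscillation :: "nat \<Rightarrow> real \<Rightarrow> 'w set" where
  "big_oscillation n \<delta> = (\<Union>i<2 ^ n. \<Union>l. fine_oscillation n \<delta> i l)"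

lemma big_oscillation_prob:
  assumes \<delta>: "\<delta> > 0"
  shows "big_oscillation n \<delta> \<in> sets M"
    "measure M (big_oscillation n \<delta>) \<le> 2 ^ n * (2 * exp (- real k * (mesh T n * lagrangian (\<delta> / mesh T n))))" (is "_ \<le> _ * ?B")
proof -
  have s: "(\<Union>l. fine_oscillation n \<delta> i l) \<in> sets M" if "i < 2 ^ n" for i
    using fine_oscillation_prob(1)[OF that \<delta>] by (intro sets.countable_UN) auto
  show "big_oscillation n \<delta> \<in> sets M" unfolding big_oscillation_def by (rule sets.finite_UN) (use s in blast)+
  have b: "measure M (\<Union>l. fine_oscillation n \<delta> i l) \<le> ?B" if i: "i < 2 ^ n" for i
  proof (rule tendsto_upperbound)
    show "(\<lambda>l. measure M (fine_oscillation n \<delta> i l)) \<longlonglongrightarrow> measure M (\<Union>l. fine_oscillation n \<delta> i l)"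
      using fine_oscillation_prob(1)[OF i \<delta>] fine_oscillation_mono
      by (intro finite_Lim_measure_incseq incseq_SucI) auto
    show "\<forall>\<^sub>F l in sequentially. measure M (fine_oscillation n \<delta> i l) \<le> ?B"
      using fine_oscillation_prob(2)[OF i \<delta>] by simp
  qed simp
  have "measure M (big_oscillation n \<delta>) \<le> (\<Sum>i<2 ^ n. measure M (\<Union>l. fine_oscillation n \<delta> i l))"
    unfolding big_oscillation_def by (rule finite_measure_subadditive_finite) (use s in blast)+
  also have "\<dots> \<le> (\<Sum>i<(2::nat) ^ n. ?B)" by (rule sum_mono) (use b in auto)
  finally show "measure M (big_oscillation n \<delta>) \<le> 2 ^ n * ?B" by simp
qed

text \<open>A deviation larger than \<open>\<delta>\<close> persists for a short time to the right, by right continuity,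
  and so it is seen at some dyadic time.\<close>

lemma small_oscillation:
  assumes \<omega>: "\<omega> \<in> started" "\<omega> \<notin> big_oscillation n \<delta>"
  shows "cell_oscillation_le T n \<delta> (X \<omega>)"
  unfolding cell_oscillation_le_def
proof (intro allI impI ballI)
  fix i t assume i: "i < 2 ^ n" and t: "t \<in> {mesh T n * real i..mesh T n * real (Suc i)}"
  define h where "h = mesh T n"
  have h: "h > 0" unfolding h_def by (rule mesh_pos[OF T])
  have nf: "\<omega> \<notin> fine_oscillation n \<delta> i l" for l using \<omega>(2) i unfolding big_oscillation_def by auto
  have dy: "dist (X \<omega> (real j * mesh T (n + l))) (X \<omega> (h * real i)) \<le> \<delta>" if "j \<in> {i * 2 ^ l..i * 2 ^ l + 2 ^ l}" for j l
    using nf[of l] \<omega>(1) that unfolding fine_oscillation_def h_def by force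
  show "dist (X \<omega> (mesh T n * real i)) (X \<omega> t) \<le> \<delta>"
  proof (cases "t = h * real (Suc i)")
    case True
    then show ?thesis using dy[of "Suc i" 0] unfolding h_def by (simp add: dist_commute mult.commute)
  next
    case False
    then have t': "h * real i \<le> t" "t < h * real (Suc i)" using t unfolding h_def by auto
    have "real (Suc i) \<le> real (2 ^ n)" using i by (metis Suc_leI of_nat_le_iff)
    then have "h * real (Suc i) \<le> T" using h mesh_total[of T n] unfolding h_def by (metis mult_le_cancel_left_pos)
    then have t0: "t \<in> {0..<T}" using t' h by (auto intro: order_trans[of 0 "h * real i"])
    show ?thesis
    proof (rule ccontr)
      assume "\<not> dist (X \<omega> (mesh T n * real i)) (X \<omega> t) \<le> \<delta>"
      then have d: "\<delta> < dist (X \<omega> t) (X \<omega> (h * real i))" unfolding h_def by (simp add: dist_commute)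
      have "\<omega> \<in> space M" using \<omega>(1) unfolding started_def by simp
      then have "(X \<omega> \<longlongrightarrow> X \<omega> t) (at_right t)"
        using X_skorohod t0 unfolding skorohod_space_def cadlag_def by blast
      then have "((\<lambda>s. dist (X \<omega> s) (X \<omega> (h * real i))) \<longlongrightarrow> dist (X \<omega> t) (X \<omega> (h * real i))) (at_right t)"
        by (intro tendsto_dist tendsto_const)
      then have "\<forall>\<^sub>F s in at_right t. \<delta> < dist (X \<omega> s) (X \<omega> (h * real i))" using d by (rule order_tendstoD(1))
      then obtain b where b: "t < b" "\<And>s. t < s \<Longrightarrow> s < b \<Longrightarrow> \<delta> < dist (X \<omega> s) (X \<omega> (h * real i))"
        unfolding eventually_at_right_field by blast
      define c where "c = min b (h * real (Suc i))"
      have c: "t < c" "c \<le> b" "c \<le> h * real (Suc i)" unfolding c_def using b t' by auto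
      have "(\<lambda>l. mesh T (l + n)) \<longlonglongrightarrow> 0" using mesh_tendsto by (rule LIMSEQ_ignore_initial_segment)
      then have "\<forall>\<^sub>F l in sequentially. mesh T (l + n) < c - t" by (rule order_tendstoD(2)) (use c in simp)
      then obtain l where l: "mesh T (n + l) < c - t" unfolding eventually_sequentially by (metis add.commute le_refl)
      define \<tau> where "\<tau> = mesh T (n + l)"
      have \<tau>: "\<tau> > 0" "\<tau> < c - t" unfolding \<tau>_def using l by (auto simp: mesh_pos[OF T])
      have h\<tau>: "h = \<tau> * 2 ^ l" unfolding h_def \<tau>_def using mesh_refine[of T n l] by simp
      \<comment> \<open>The first dyadic time of level \<open>n + l\<close> after \<open>t\<close>.\<close>
      define j where "j = nat (\<lfloor>t / \<tau>\<rfloor> + 1)"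
      have "0 \<le> t / \<tau>" using t0 \<tau> by simp
      then have "real j = of_int \<lfloor>t / \<tau>\<rfloor> + 1" unfolding j_def by simp
      then have "t / \<tau> < real j" "real j \<le> t / \<tau> + 1" by linarith+
      then have j: "t < real j * \<tau>" "real j * \<tau> \<le> t + \<tau>" using \<tau> by (auto simp: field_simps)
      have "h * real i = real (i * 2 ^ l) * \<tau>" "h * real (Suc i) = real (i * 2 ^ l + 2 ^ l) * \<tau>" unfolding h\<tau> by (simp_all add: algebra_simps)
      note hi = this
      have "real (i * 2 ^ l) * \<tau> < real j * \<tau>" using j(1) t'(1) hi(1) by linarith
      then have j1: "i * 2 ^ l < j" using \<tau> by (metis mult_less_cancel_right_pos of_nat_less_iff)
      have "real j * \<tau> < real (i * 2 ^ l + 2 ^ l) * \<tau>" using j(2) \<tau>(2) c(3) hi(2) by linarith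
      then have j2: "j < i * 2 ^ l + 2 ^ l" using \<tau> by (metis mult_less_cancel_right_pos of_nat_less_iff)
      have "dist (X \<omega> (real j * \<tau>)) (X \<omega> (h * real i)) \<le> \<delta>" unfolding \<tau>_def using j1 j2 by (intro dy) auto
      moreover have "\<delta> < dist (X \<omega> (real j * \<tau>)) (X \<omega> (h * real i))" using j \<tau> c by (intro b(2)) auto
      ultimately show False by simp
    qed
  qed
qed

lemma path_energy_skeleton:
  assumes "\<omega> \<in> started"
  shows "path_energy (mesh T n) start (skeleton (mesh T n) (2 ^ n) \<omega>) = energy T n (X \<omega>)"
  unfolding path_energy_sum energy_def length_skeleton
proof (rule sum.cong[OF refl])
  fix i :: nat assume "i \<in> {..<2 ^ n}"
  then show "mesh T n * lagrangian (dist ((start # skeleton (mesh T n) (2 ^ n) \<omega>) ! i) ((start # skeleton (mesh T n) (2 ^ n) \<omega>) ! Suc i) / mesh T n) =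
    mesh T n * lagrangian (dist (X \<omega> (mesh T n * real i)) (X \<omega> (mesh T n * real (Suc i))) / mesh T n)"
    using assms skeleton_nth[of i "2 ^ n" \<omega> "mesh T n"] skeleton_nth[of "Suc i" "2 ^ n" \<omega> "mesh T n"]
    unfolding started_def by (simp add: mult.commute)
qed

lemma mesh_time: "real (2 ^ n) * mesh T n \<le> T" using mesh_total[of T n] by (simp add: mult.commute)

lemma dist_start: "dist start x\<^sub>0 \<le> 1 / real k"
  unfolding start_def by (rule nearest_grid_point_dist[OF k])

text \<open>A path in \<open>C\<close> oscillates much between grid times or has energy above \<open>a\<close>. Both are
  unlikely.\<close>

theorem walk_upper:
  assumes C: "C \<in> sets (skorohod_borel T)" and \<delta>: "\<delta> > 0" "a \<le> mesh T n * lagrangian (\<delta> / mesh T n)" and \<eta>: "1 / real k \<le> \<eta>"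
    and gap: "\<And>\<gamma>. \<gamma> \<in> C \<Longrightarrow> cell_oscillation_le T n \<delta> \<gamma> \<Longrightarrow> dist (\<gamma> 0) x\<^sub>0 \<le> \<eta> \<Longrightarrow> a < energy T n \<gamma>"
  shows "measure M (X -` C \<inter> space M) \<le> (2 * 2 ^ n + (2 * real k) ^ (2 ^ n)) * exp (- real k * a)"
proof -
  have CM: "X -` C \<inter> space M \<in> sets M" using X_measurable C by (rule measurable_sets)
  define H where "H = {\<omega> \<in> started. a < path_energy (mesh T n) start (skeleton (mesh T n) (2 ^ n) \<omega>)}"
  have H: "H \<in> sets M" "measure M H \<le> (2 * real k) ^ (2 ^ n) * exp (- real k * a)"
    unfolding H_def using skeleton_law[OF mesh_pos[OF T] mesh_time, of "\<lambda>ys. a < path_energy (mesh T n) start ys"]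
      sum_weight_high_energy[OF k mesh_pos[OF T]] by auto
  have B: "big_oscillation n \<delta> \<in> sets M" "measure M (big_oscillation n \<delta>) \<le> 2 ^ n * (2 * exp (- real k * (mesh T n * lagrangian (\<delta> / mesh T n))))"
    using big_oscillation_prob[OF \<delta>(1)] by auto
  have "measure M (X -` C \<inter> space M) = measure M (X -` C \<inter> space M \<inter> started)" by (rule prob_restrict_started[OF CM])
  also have "\<dots> \<le> measure M (big_oscillation n \<delta> \<union> H)"
  proof (rule finite_measure_mono)
    show "X -` C \<inter> space M \<inter> started \<subseteq> big_oscillation n \<delta> \<union> H"
    proof
      fix \<omega> assume \<omega>: "\<omega> \<in> X -` C \<inter> space M \<inter> started"
      show "\<omega> \<in> big_oscillation n \<delta> \<union> H"
      proof (cases "\<omega> \<in> big_oscillation n \<delta>")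
        case False
        have s: "\<omega> \<in> started" using \<omega> by simp
        have "a < energy T n (X \<omega>)"
        proof (rule gap)
          show "X \<omega> \<in> C" using \<omega> by simp
          show "cell_oscillation_le T n \<delta> (X \<omega>)" by (rule small_oscillation[OF s False])
          show "dist (X \<omega> 0) x\<^sub>0 \<le> \<eta>" using s dist_start \<eta> unfolding started_def by simp
        qed
        then show ?thesis unfolding H_def path_energy_skeleton[OF s, symmetric] using s by simp
      qed simp
    qed
  qed (use B H in auto)
  also have "\<dots> \<le> measure M (big_oscillation n \<delta>) + measure M H" using B H by (intro measure_Un_le)
  also have "\<dots> \<le> 2 ^ n * (2 * exp (- real k * a)) + (2 * real k) ^ (2 ^ n) * exp (- real k * a)"
  proof (rule add_mono[OF order_trans[OF B(2)] H(2)])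
    show "2 ^ n * (2 * exp (- real k * (mesh T n * lagrangian (\<delta> / mesh T n)))) \<le> 2 ^ n * (2 * exp (- real k * a))"
      using \<delta>(2) k by (intro mult_left_mono) auto
  qed
  finally show ?thesis by (simp add: algebra_simps)
qed

text \<open>Visiting given points at the grid times has a probability given by the energy, and it
  implies membership in \<open>U\<close> unless the path oscillates much in between.\<close>

theorem walk_lower:
  assumes U: "U \<in> sets (skorohod_borel T)" and \<delta>: "\<delta> > 0" and ys: "ys \<in> paths k (2 ^ n)"
    and sub: "\<And>\<gamma>. \<gamma> \<in> skorohod_space T \<Longrightarrow> cell_oscillation_le T n \<delta> \<gamma> \<Longrightarrow>
       (\<And>i. i \<le> 2 ^ n \<Longrightarrow> \<gamma> (mesh T n * real i) = (start # ys) ! i) \<Longrightarrow> \<gamma> \<in> U"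
  shows "(lower_const (mesh T n) / (real k)\<^sup>2) ^ (2 ^ n) * exp (- real k * path_energy (mesh T n) start ys)
    - 2 * 2 ^ n * exp (- real k * (mesh T n * lagrangian (\<delta> / mesh T n))) \<le> measure M (X -` U \<inter> space M)"
proof -
  have UM: "X -` U \<inter> space M \<in> sets M" using X_measurable U by (rule measurable_sets)
  define A where "A = cylinder (mesh T n) ys"
  have A: "A \<in> sets M" "measure M A = weight k (mesh T n) start ys"
    unfolding A_def using cylinder_prob[OF ys mesh_pos[OF T] mesh_time] by auto
  have B: "big_oscillation n \<delta> \<in> sets M" "measure M (big_oscillation n \<delta>) \<le> 2 ^ n * (2 * exp (- real k * (mesh T n * lagrangian (\<delta> / mesh T n))))"
    using big_oscillation_prob[OF \<delta>] by auto
  have "measure M A \<le> measure M ((X -` U \<inter> space M) \<union> big_oscillation n \<delta>)"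
  proof (rule finite_measure_mono)
    show "A \<subseteq> (X -` U \<inter> space M) \<union> big_oscillation n \<delta>"
    proof
      fix \<omega> assume \<omega>: "\<omega> \<in> A"
      have len: "length ys = 2 ^ n" using ys unfolding paths_def by simp
      have sp: "\<omega> \<in> space M" using \<omega> unfolding A_def cylinder_def by simp
      have c: "X \<omega> (mesh T n * real i) = (start # ys) ! i" if "i \<le> 2 ^ n" for i
        using \<omega> that len unfolding A_def cylinder_def by (simp add: mult.commute)
      have s: "\<omega> \<in> started" using c[of 0] sp unfolding started_def by simp
      show "\<omega> \<in> (X -` U \<inter> space M) \<union> big_oscillation n \<delta>"
      proof (cases "\<omega> \<in> big_oscillation n \<delta>")
        case False
        have "X \<omega> \<in> U" by (rule sub[OF X_skorohod[OF sp] small_oscillation[OF s False] c])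
        then show ?thesis using sp by simp
      qed simp
    qed
  qed (use UM B in auto)
  also have "\<dots> \<le> measure M (X -` U \<inter> space M) + measure M (big_oscillation n \<delta>)" using UM B by (intro measure_Un_le)
  finally have 1: "weight k (mesh T n) start ys \<le> measure M (X -` U \<inter> space M) + 2 ^ n * (2 * exp (- real k * (mesh T n * lagrangian (\<delta> / mesh T n))))"
    using A B by linarith
  have "(lower_const (mesh T n) / (real k)\<^sup>2) ^ (2 ^ n) * exp (- real k * path_energy (mesh T n) start ys) \<le> weight k (mesh T n) start ys"
    using weight_ge_energy[OF k mesh_pos[OF T] start_grid, of ys n] ys unfolding paths_def by simp
  then show ?thesis using 1 by (simp add: mult_ac)
qed

end

section \<open>The large deviation principle\<close>

lemma skorohod_borel_sets:
  assumes T: "T > 0"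
  shows "openin (skorohod_topology T) U \<Longrightarrow> U \<in> sets (skorohod_borel T)"
    and "closedin (skorohod_topology T) C \<Longrightarrow> C \<in> sets (skorohod_borel T)"
proof -
  interpret S: Metric_space "skorohod_space T" "skorohod_dist T" by (rule Metric_space_skorohod[OF T])
  have top: "topspace (skorohod_topology T) = skorohod_space T" unfolding skorohod_topology_def by simp
  have sub: "{U. openin (skorohod_topology T) U} \<subseteq> Pow (skorohod_space T)" using openin_subset top by blast
  have sp: "space (skorohod_borel T) = skorohod_space T" unfolding skorohod_borel_def by (simp add: space_measure_of_conv)
  show op: "U \<in> sets (skorohod_borel T)" if "openin (skorohod_topology T) U" for U
    using that sub unfolding skorohod_borel_def by (auto simp: sets_measure_of)
  show "C \<in> sets (skorohod_borel T)" if C: "closedin (skorohod_topology T) C"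
  proof -
    have "skorohod_space T - C \<in> sets (skorohod_borel T)" using C op unfolding closedin_def top by blast
    then have "space (skorohod_borel T) - (skorohod_space T - C) \<in> sets (skorohod_borel T)" by (rule sets.compl_sets)
    moreover have "space (skorohod_borel T) - (skorohod_space T - C) = C" using C unfolding sp closedin_def top by blast
    ultimately show ?thesis by simp
  qed
qed

lemma log_prob_mono_lower:
  assumes "0 < q" "q \<le> p" "k \<ge> 1"
  shows "ereal (ln q / real k) \<le> ereal (1 / real k) * log_prob p"
proof -
  have "ln q / real k \<le> 1 / real k * ln p" using assms by (simp add: divide_right_mono)
  then show ?thesis using assms unfolding log_prob_def by simp
qed

lemma log_prob_mono_upper:
  assumes "0 \<le> p" "p \<le> q" "0 < q" "k \<ge> 1"
  shows "ereal (1 / real k) * log_prob p \<le> ereal (ln q / real k)"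
proof (cases "p = 0")
  case True
  then show ?thesis using assms unfolding log_prob_def by simp
next
  case False
  then have "1 / real k * ln p \<le> ln q / real k" using assms by (simp add: divide_right_mono)
  then show ?thesis using False unfolding log_prob_def by simp
qed

lemma ln_poly_rate:
  fixes A B c :: real
  shows "(\<lambda>k. (A + B * ln (real k) - real k * c) / real k) \<longlonglongrightarrow> - c"
proof -
  have "(\<lambda>k. A / real k + B * (ln (real k) / real k) - c) \<longlonglongrightarrow> 0 + B * 0 - c"
    by (intro tendsto_intros lim_const_over_n lim_ln_over_n)
  moreover have "\<forall>\<^sub>F k in sequentially. A / real k + B * (ln (real k) / real k) - c = (A + B * ln (real k) - real k * c) / real k"
    using eventually_gt_at_top[of 0] by eventually_elim (simp add: add_divide_distrib diff_divide_distrib)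
  ultimately show ?thesis using Lim_transform_eventually by fastforce
qed

text \<open>The error of a bound at exponential rate \<open>e + 2\<close> is negligible against one at rate at most
  \<open>e + 1\<close>, in spite of the polynomial factor.\<close>

lemma dominated_exponential:
  fixes c e \<zeta> :: real and N m :: nat
  assumes c: "c > 0" and \<zeta>: "\<zeta> \<le> 1"
  shows "\<forall>\<^sub>F k in sequentially. 2 * real m * exp (- real k * (e + 2)) \<le> (c / (real k)\<^sup>2) ^ N / 2 * exp (- real k * (e + \<zeta>))"
proof -
  have "((\<lambda>x::real. x ^ (2 * N) / exp x) \<longlongrightarrow> 0) at_top" by (rule tendsto_power_div_exp_0)
  then have "(\<lambda>k. real k ^ (2 * N) / exp (real k)) \<longlonglongrightarrow> 0"
    by (rule filterlim_compose[OF _ filterlim_real_sequentially])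
  then have "(\<lambda>k. 4 * real m / c ^ N * (real k ^ (2 * N) / exp (real k))) \<longlonglongrightarrow> 4 * real m / c ^ N * 0"
    by (intro tendsto_intros)
  then have "\<forall>\<^sub>F k in sequentially. 4 * real m / c ^ N * (real k ^ (2 * N) / exp (real k)) < 1"
    by (rule order_tendstoD(2)) simp
  then show ?thesis using eventually_ge_at_top[of 1]
  proof eventually_elim
    case (elim k)
    define K where "K = real k ^ (2 * N)"
    have K: "K > 0" unfolding K_def using elim by simp
    have cN: "c ^ N > 0" using c by simp
    have q: "(c / (real k)\<^sup>2) ^ N = c ^ N / K" unfolding K_def by (simp add: power_divide power_mult)
    have "4 * real m * K < c ^ N * exp (real k)"
      using elim(1) cN unfolding K_def[symmetric] by (simp add: field_simps)
    then have "4 * real m * K * exp (- real k) \<le> c ^ N" by (simp add: exp_minus field_simps)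
    then have 1: "2 * real m * exp (- real k) \<le> c ^ N / K / 2" using K by (simp add: field_simps)
    have "2 * real m * exp (- real k * (e + 2)) = 2 * real m * exp (- real k) * exp (- real k * (e + 1))"
      by (simp add: exp_add[symmetric] algebra_simps)
    also have "\<dots> \<le> c ^ N / K / 2 * exp (- real k * (e + 1))" using 1 by (intro mult_right_mono) auto
    also have "\<dots> \<le> c ^ N / K / 2 * exp (- real k * (e + \<zeta>))"
      using \<zeta> K cN elim by (intro mult_left_mono) (auto simp: mult_left_mono)
    finally show ?case unfolding q .
  qed
qed

text \<open>For every \<open>a\<close> below the infimum of the rate, \<open>closed_energy_gap\<close> provides one level
  \<open>n\<close> at which \<open>walk_upper\<close> applies for all large \<open>k\<close>. The factor in front of the exponential is
  polynomial in \<open>k\<close>.\<close>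

theorem walk_upper_bound:
  fixes M :: "nat \<Rightarrow> 'w measure" and X :: "nat \<Rightarrow> 'w \<Rightarrow> real \<Rightarrow> circle"
  assumes T: "T > 0" and rw: "\<And>k. k \<ge> 1 \<Longrightarrow> random_walk (M k) T k x\<^sub>0 (X k)"
    and C: "closedin (skorohod_topology T) C"
  shows "limsup (\<lambda>k. ereal (1 / real k) * log_prob (measure (M k) (X k -` C \<inter> space (M k)))) \<le> - (INF \<gamma>\<in>C. rate_function T x\<^sub>0 \<gamma>)"
    (is "limsup ?L \<le> - ?I")
proof (rule ccontr)
  assume "\<not> limsup ?L \<le> - ?I"
  then have "- ?I < limsup ?L" by (simp only: not_le)
  then have "- limsup ?L < ?I" by (rule ereal_uminus_less_reorder[THEN iffD1])
  then obtain a where a: "- limsup ?L < ereal a" "ereal a < ?I" using ereal_dense2 by blast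
  have aC: "ereal a < rate_function T x\<^sub>0 \<gamma>" if "\<gamma> \<in> C" for \<gamma>
    using a(2) that by (meson INF_lower less_le_trans)
  obtain n \<delta> \<eta> where g: "\<delta> > 0" "\<eta> > 0" "a \<le> mesh T n * lagrangian (\<delta> / mesh T n)"
    "\<And>\<gamma>. \<gamma> \<in> C \<Longrightarrow> cell_oscillation_le T n \<delta> \<gamma> \<Longrightarrow> dist (\<gamma> 0) x\<^sub>0 \<le> \<eta> \<Longrightarrow> a < energy T n \<gamma>"
  proof (rule closed_energy_gap[OF T C aC])
    fix n \<delta> \<eta>
    assume "\<delta> > 0" "\<eta> > 0" "a \<le> mesh T n * lagrangian (\<delta> / mesh T n)"
      "\<And>\<gamma>. \<gamma> \<in> C \<Longrightarrow> cell_oscillation_le T n \<delta> \<gamma> \<Longrightarrow> dist (\<gamma> 0) x\<^sub>0 \<le> \<eta> \<Longrightarrow> a < energy T n \<gamma>"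
    then show thesis by (rule that)
  qed
  define N where "N = (2::nat) ^ n"
  define A where "A = ln (2 * real N + 1) + real N * ln 2"
  have "(\<lambda>k. 1 / real k) \<longlonglongrightarrow> 0" by (rule lim_const_over_n)
  then have "\<forall>\<^sub>F k in sequentially. 1 / real k < \<eta>" by (rule order_tendstoD(2)) (rule g(2))
  then have "\<forall>\<^sub>F k in sequentially. ?L k \<le> ereal ((A + real N * ln (real k) - real k * a) / real k)"
    using eventually_ge_at_top[of 1]
  proof eventually_elim
    case (elim k)
    interpret walk T x\<^sub>0 k "M k" "X k" by unfold_locales (use T elim rw in auto)
    have k1: "1 \<le> 2 * real k" using elim by simp
    have "measure (M k) (X k -` C \<inter> space (M k)) \<le> (2 * real N + (2 * real k) ^ N) * exp (- real k * a)"
      unfolding N_def using walk_upper[OF skorohod_borel_sets(2)[OF T C] g(1,3) less_imp_le[OF elim(1)] g(4)] by simp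
    also have "\<dots> \<le> ((2 * real N + 1) * (2 * real k) ^ N) * exp (- real k * a)"
    proof (rule mult_right_mono)
      have "2 * real N * 1 \<le> 2 * real N * (2 * real k) ^ N" using k1 by (intro mult_left_mono one_le_power) auto
      then show "2 * real N + (2 * real k) ^ N \<le> (2 * real N + 1) * (2 * real k) ^ N" by (simp add: distrib_right)
    qed simp
    finally have p: "measure (M k) (X k -` C \<inter> space (M k)) \<le> ((2 * real N + 1) * (2 * real k) ^ N) * exp (- real k * a)" .
    have pos: "2 * real N + 1 > 0" "(2 * real k) ^ N > 0" using elim by (auto intro: add_nonneg_pos)
    have "ln (((2 * real N + 1) * (2 * real k) ^ N) * exp (- real k * a)) = A + real N * ln (real k) - real k * a"
      using pos elim unfolding A_def by (simp add: ln_mult ln_realpow distrib_left)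
    then show ?case
      using log_prob_mono_upper[OF measure_nonneg p _ elim(2)] pos by simp
  qed
  then have "limsup ?L \<le> limsup (\<lambda>k. ereal ((A + real N * ln (real k) - real k * a) / real k))" by (rule Limsup_mono)
  also have "\<dots> = ereal (- a)"
    by (rule lim_imp_Limsup) (auto intro: tendsto_ereal ln_poly_rate)
  finally have "limsup ?L \<le> - ereal a" by simp
  moreover have "- ereal a < limsup ?L" using a(1) by (rule ereal_uminus_less_reorder[THEN iffD1])
  ultimately show False by simp
qed

text \<open>Round the values of \<open>\<gamma>\<close> at the times of a fine level \<open>n\<close> to grid points. The level is
  chosen such that \<open>\<gamma>\<close> moves by at most a quarter of the radius of a ball in \<open>U\<close> in each cell
  and such that oscillations of the walk of that size have exponential rate above that of
  \<open>\<gamma>\<close>. The energy of the rounded path tends to the energy of \<open>\<gamma>\<close>, which is at most its rate.\<close>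

theorem walk_lower_bound:
  fixes M :: "nat \<Rightarrow> 'w measure" and X :: "nat \<Rightarrow> 'w \<Rightarrow> real \<Rightarrow> circle"
  assumes T: "T > 0" and rw: "\<And>k. k \<ge> 1 \<Longrightarrow> random_walk (M k) T k x\<^sub>0 (X k)"
    and U: "openin (skorohod_topology T) U" and \<gamma>: "\<gamma> \<in> U"
  shows "- rate_function T x\<^sub>0 \<gamma> \<le> liminf (\<lambda>k. ereal (1 / real k) * log_prob (measure (M k) (X k -` U \<inter> space (M k))))"
    (is "_ \<le> liminf ?L")
proof (cases "rate_function T x\<^sub>0 \<gamma> = \<infinity>")
  case True
  then show ?thesis by simp
next
  case False
  then have ac: "abs_continuous T \<gamma>" and \<gamma>0: "\<gamma> 0 = x\<^sub>0" unfolding rate_function_def by (auto split: if_splits)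
  define I where "I = (\<integral>\<^sup>+ s\<in>{0..T}. ennreal (lagrangian (circle_deriv T \<gamma> s)) \<partial>lebesgue)"
  have rI: "rate_function T x\<^sub>0 \<gamma> = enn2ereal I" unfolding rate_function_def I_def using ac \<gamma>0 by simp
  then have "I \<noteq> \<infinity>" using False by auto
  then obtain e where e: "e \<ge> 0" "I = ennreal e" by (cases I) auto
  have rate: "rate_function T x\<^sub>0 \<gamma> = ereal e" unfolding rI e(2) using e(1) by (simp add: enn2ereal_ennreal)
  have E: "energy T n \<gamma> \<le> e" for n
    using energy_le_rate[OF T ac, of n] e unfolding I_def[symmetric] by (simp add: ennreal_le_iff)
  have cont: "continuous_on {0..T} \<gamma>" by (rule abs_continuous_imp_continuous[OF ac])
  obtain r where r: "r > 0" "\<And>\<eta>. \<eta> \<in> skorohod_space T \<Longrightarrow> (\<And>t. t \<in> {0..T} \<Longrightarrow> dist (\<gamma> t) (\<eta> t) \<le> r) \<Longrightarrow> \<eta> \<in> U"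
    by (rule skorohod_open_ball[OF T U \<gamma>]) blast
  \<comment> \<open>One such quarter each for the walk within a cell, for rounding, and for
    \<open>\<gamma>\<close> within a cell.\<close>
  define \<delta> where "\<delta> = r / 4"
  have \<delta>: "\<delta> > 0" unfolding \<delta>_def using r by simp
  have "uniformly_continuous_on {0..T} \<gamma>" using cont by (intro compact_uniformly_continuous) auto
  then obtain \<rho> where \<rho>: "\<rho> > 0" "\<And>s t. s \<in> {0..T} \<Longrightarrow> t \<in> {0..T} \<Longrightarrow> dist t s < \<rho> \<Longrightarrow> dist (\<gamma> t) (\<gamma> s) < \<delta>"
    using \<delta> unfolding uniformly_continuous_on_def by meson
  obtain h0 where h0: "h0 > 0" "\<And>h. 0 < h \<Longrightarrow> h < h0 \<Longrightarrow> e + 2 \<le> h * lagrangian (\<delta> / h)"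
    by (rule lagrangian_superlinear[OF \<delta>, of "e + 2"]) blast
  have "\<forall>\<^sub>F n in sequentially. mesh T n < \<rho>" "\<forall>\<^sub>F n in sequentially. mesh T n < h0"
    by (rule order_tendstoD(2)[OF mesh_tendsto \<rho>(1)], rule order_tendstoD(2)[OF mesh_tendsto h0(1)])
  then have "\<forall>\<^sub>F n in sequentially. mesh T n < \<rho> \<and> mesh T n < h0" by (rule eventually_conj)
  then obtain n where n: "mesh T n < \<rho>" "mesh T n < h0" unfolding eventually_sequentially by blast
  define h where "h = mesh T n"
  define N where "N = (2::nat) ^ n"
  have h: "h > 0" "h < \<rho>" "h * real N = T" unfolding h_def N_def using mesh_pos[OF T] n mesh_total by auto
  have hL: "e + 2 \<le> h * lagrangian (\<delta> / h)" using h0(2)[of h] h n unfolding h_def by simp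
  have in01: "h * real i \<in> {0..T}" if "i \<le> N" for i
  proof -
    have "h * real i \<le> h * real N" using that h by (intro mult_left_mono) auto
    then have "h * real i \<le> T" unfolding h(3) .
    then show ?thesis using h by simp
  qed
  define ys where "ys = (\<lambda>k. map (\<lambda>i. nearest_grid_point k (\<gamma> (h * real i))) [1..<Suc N])"
  define st where "st = (\<lambda>k. nearest_grid_point k x\<^sub>0)"
  have len: "length (ys k) = N" for k unfolding ys_def by simp
  have nth: "(st k # ys k) ! i = nearest_grid_point k (\<gamma> (h * real i))" if "i \<le> N" for i k
    unfolding ys_def st_def using that \<gamma>0 by (cases i) (auto simp del: upt_Suc)
  have ev_energy: "(\<lambda>k. path_energy h (st k) (ys k)) \<longlonglongrightarrow> energy T n \<gamma>"
  proof -
    have "path_energy h (st k) (ys k) = (\<Sum>i<N. h * lagrangian (dist (nearest_grid_point k (\<gamma> (h * real i))) (nearest_grid_point k (\<gamma> (h * real (Suc i)))) / h))" for k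
      unfolding path_energy_sum len
    proof (rule sum.cong[OF refl])
      fix i assume "i \<in> {..<N}"
      then have "i \<le> N" "Suc i \<le> N" by auto
      then show "h * lagrangian (dist ((st k # ys k) ! i) ((st k # ys k) ! Suc i) / h) =
        h * lagrangian (dist (nearest_grid_point k (\<gamma> (h * real i))) (nearest_grid_point k (\<gamma> (h * real (Suc i)))) / h)"
        by (simp only: nth)
    qed
    then show ?thesis unfolding energy_def h_def[symmetric] N_def[symmetric] using h
      by (simp only:) (intro tendsto_sum tendsto_mult tendsto_const lagrangian_tendsto tendsto_divide tendsto_dist nearest_grid_point_tendsto, auto)
  qed
  have main: "ereal (- (e + \<zeta>)) \<le> liminf ?L" if \<zeta>: "0 < \<zeta>" "\<zeta> \<le> 1" for \<zeta>
  proof -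
    define c where "c = lower_const h"
    have c: "c > 0" unfolding c_def by (rule lower_const_pos[OF h(1)])
    define A where "A = ln (1 / 2) + real N * ln c"
    have "energy T n \<gamma> < e + \<zeta>" using E[of n] \<zeta> by linarith
    then have "\<forall>\<^sub>F k in sequentially. path_energy h (st k) (ys k) < e + \<zeta>" by (rule order_tendstoD(2)[OF ev_energy])
    moreover have "\<forall>\<^sub>F k in sequentially. 1 / real k < \<delta>" by (rule order_tendstoD(2)[OF lim_const_over_n \<delta>])
    moreover note dominated_exponential[OF c \<zeta>(2), of N e N]
    ultimately have "\<forall>\<^sub>F k in sequentially. ereal ((A + (- 2 * real N) * ln (real k) - real k * (e + \<zeta>)) / real k) \<le> ?L k"
      using eventually_ge_at_top[of 1]
    proof eventually_elim
      case (elim k)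
      interpret walk T x\<^sub>0 k "M k" "X k" by unfold_locales (use T elim rw in auto)
      have st: "st k = start" unfolding st_def start_def ..
      have ysp: "ys k \<in> paths k (2 ^ n)"
        unfolding paths_def using len[of k] nearest_grid_point_in_grid[OF elim(4)] unfolding N_def ys_def by auto
      define q where "q = (c / (real k)\<^sup>2) ^ N / 2 * exp (- real k * (e + \<zeta>))"
      have "(c / (real k)\<^sup>2) ^ N * exp (- real k * path_energy h start (ys k)) - 2 * real N * exp (- real k * (h * lagrangian (\<delta> / h)))
        \<le> measure (M k) (X k -` U \<inter> space (M k))"
        unfolding c_def h_def N_def
      proof (rule order_trans[OF _ walk_lower[OF skorohod_borel_sets(1)[OF T U] \<delta> ysp]])
        fix \<eta> assume \<eta>: "\<eta> \<in> skorohod_space T" "cell_oscillation_le T n \<delta> \<eta>"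
          "\<And>i. i \<le> 2 ^ n \<Longrightarrow> \<eta> (mesh T n * real i) = (start # ys k) ! i"
        show "\<eta> \<in> U"
        proof (rule r(2)[OF \<eta>(1)])
          fix t assume t: "t \<in> {0..T}"
          obtain i where i: "i < 2 ^ n" "t \<in> {h * real i..h * real (Suc i)}" unfolding h_def by (rule grid_cell[OF T t])
          have "dist (\<eta> (h * real i)) (\<eta> t) \<le> \<delta>" using \<eta>(2) i unfolding cell_oscillation_le_def h_def by blast
          moreover have "\<eta> (h * real i) = nearest_grid_point k (\<gamma> (h * real i))"
            using \<eta>(3)[of i] i(1) nth[of i k] unfolding st h_def N_def by simp
          moreover have "dist (nearest_grid_point k (\<gamma> (h * real i))) (\<gamma> (h * real i)) < \<delta>"
            using nearest_grid_point_dist[OF elim(4), of "\<gamma> (h * real i)"] elim(2) by linarith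
          moreover have "dist (\<gamma> (h * real i)) (\<gamma> t) < \<delta>"
            using i h by (intro \<rho>(2) t in01) (auto simp: N_def dist_real_def algebra_simps)
          ultimately show "dist (\<gamma> t) (\<eta> t) \<le> r"
            using dist_triangle[of "\<gamma> t" "\<eta> t" "\<gamma> (h * real i)"] dist_triangle[of "\<gamma> (h * real i)" "\<eta> t" "\<eta> (h * real i)"] r(1)
            unfolding \<delta>_def by (simp add: dist_commute)
        qed
      qed simp
      moreover have "(c / (real k)\<^sup>2) ^ N * exp (- real k * (e + \<zeta>)) \<le> (c / (real k)\<^sup>2) ^ N * exp (- real k * path_energy h start (ys k))"
        using elim(1,4) c unfolding st by (intro mult_left_mono) auto
      moreover have "2 * real N * exp (- real k * (h * lagrangian (\<delta> / h))) \<le> 2 * real N * exp (- real k * (e + 2))"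
        using mult_left_mono[OF hL, of "real k"] by (intro mult_left_mono) auto
      ultimately have qp: "q \<le> measure (M k) (X k -` U \<inter> space (M k))"
        using elim(3) unfolding q_def by linarith
      have k0: "real k > 0" using elim by simp
      have q0: "q > 0" unfolding q_def using c k0 by simp
      have "ln q = ln ((c / (real k)\<^sup>2) ^ N) + ln (1 / 2) - real k * (e + \<zeta>)"
      proof -
        have "q = ((c / (real k)\<^sup>2) ^ N * (1 / 2)) * exp (- real k * (e + \<zeta>))" unfolding q_def by simp
        moreover have "(c / (real k)\<^sup>2) ^ N > 0" using c k0 by simp
        ultimately show ?thesis by (simp only: ln_mult_pos ln_exp mult_pos_pos exp_gt_zero half_gt_zero zero_less_one)
      qed
      also have "ln ((c / (real k)\<^sup>2) ^ N) = real N * (ln c - 2 * ln (real k))"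
        using c k0 by (simp add: ln_realpow ln_div)
      finally have "ln q = A + (- 2 * real N) * ln (real k) - real k * (e + \<zeta>)"
        unfolding A_def by (simp add: algebra_simps)
      then show ?case using log_prob_mono_lower[OF q0 qp elim(4)] by simp
    qed
    then have "liminf (\<lambda>k. ereal ((A + (- 2 * real N) * ln (real k) - real k * (e + \<zeta>)) / real k)) \<le> liminf ?L" by (rule Liminf_mono)
    moreover have "liminf (\<lambda>k. ereal ((A + (- 2 * real N) * ln (real k) - real k * (e + \<zeta>)) / real k)) = ereal (- (e + \<zeta>))"
      using tendsto_ereal[OF ln_poly_rate[of A "- 2 * real N" "e + \<zeta>"]] by (intro lim_imp_Liminf) simp_all
    ultimately show ?thesis by simp
  qed
  show ?thesis unfolding rate
  proof (rule ccontr)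
    assume "\<not> - ereal e \<le> liminf ?L"
    then have "liminf ?L < ereal (- e)" by simp
    then obtain z where z: "liminf ?L < ereal z" "ereal z < ereal (- e)" using ereal_dense2 by blast
    \<comment> \<open>The bound \<open>1\<close> keeps the rate \<open>e + \<zeta>\<close> below the rate \<open>e + 2\<close> of the oscillations.\<close>
    define \<zeta> where "\<zeta> = min 1 (- e - z)"
    have "0 < \<zeta>" "\<zeta> \<le> 1" "z \<le> - (e + \<zeta>)" using z(2) unfolding \<zeta>_def by auto
    then have "ereal z \<le> liminf ?L" using main[of \<zeta>] by (meson ereal_less_eq(3) order_trans)
    then show False using z(1) by simp
  qed
qed

theorem theorem1:
  fixes T :: real and x\<^sub>0 :: circle
    and M :: "nat \<Rightarrow> 'w measure" and X :: "nat \<Rightarrow> 'w \<Rightarrow> real \<Rightarrow> circle"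
    and P :: "nat \<Rightarrow> (real \<Rightarrow> circle) measure"
  assumes "T > 0"
    and "\<And>k. k \<ge> 1 \<Longrightarrow> random_walk (M k) T k x\<^sub>0 (X k)"
    and "\<And>k. k \<ge> 1 \<Longrightarrow> P k = distr (M k) (skorohod_borel T) (X k)"
  shows "(\<forall>C. closedin (skorohod_topology T) C \<longrightarrow>
            limsup (\<lambda>k. ereal (1 / real k) * log_prob (measure (P k) C))
              \<le> - (INF \<gamma>\<in>C. rate_function T x\<^sub>0 \<gamma>)) \<and>
         (\<forall>U. openin (skorohod_topology T) U \<longrightarrow>
            liminf (\<lambda>k. ereal (1 / real k) * log_prob (measure (P k) U))
              \<ge> - (INF \<gamma>\<in>U. rate_function T x\<^sub>0 \<gamma>))"
proof -
  have law: "\<forall>\<^sub>F k in sequentially. ereal (1 / real k) * log_prob (measure (P k) S) =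
      ereal (1 / real k) * log_prob (measure (M k) (X k -` S \<inter> space (M k)))"
    if S: "S \<in> sets (skorohod_borel T)" for S
    using eventually_ge_at_top[of 1]
  proof eventually_elim
    case (elim k)
    have "X k \<in> measurable (M k) (skorohod_borel T)"
      using assms(2)[OF elim] unfolding random_walk_def markov_chain_with_generator_def by blast
    then show ?case unfolding assms(3)[OF elim] by (simp add: measure_distr S)
  qed
  show ?thesis
  proof (intro conjI allI impI)
    fix C assume C: "closedin (skorohod_topology T) C"
    show "limsup (\<lambda>k. ereal (1 / real k) * log_prob (measure (P k) C)) \<le> - (INF \<gamma>\<in>C. rate_function T x\<^sub>0 \<gamma>)"
      unfolding Limsup_eq[OF law[OF skorohod_borel_sets(2)[OF assms(1) C]]]
      by (rule walk_upper_bound[OF assms(1,2) C])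
  next
    fix U assume U: "openin (skorohod_topology T) U"
    have "- liminf (\<lambda>k. ereal (1 / real k) * log_prob (measure (P k) U)) \<le> (INF \<gamma>\<in>U. rate_function T x\<^sub>0 \<gamma>)"
    proof (rule INF_greatest)
      fix \<gamma> assume \<gamma>: "\<gamma> \<in> U"
      show "- liminf (\<lambda>k. ereal (1 / real k) * log_prob (measure (P k) U)) \<le> rate_function T x\<^sub>0 \<gamma>"
        unfolding Liminf_eq[OF law[OF skorohod_borel_sets(1)[OF assms(1) U]]]
        by (rule ereal_uminus_le_reorder[THEN iffD1], rule walk_lower_bound[OF assms(1,2) U \<gamma>])
    qed
    then show "liminf (\<lambda>k. ereal (1 / real k) * log_prob (measure (P k) U)) \<ge> - (INF \<gamma>\<in>U. rate_function T x\<^sub>0 \<gamma>)"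
      by (rule ereal_uminus_le_reorder[THEN iffD1])
  qed
qed

end
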